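(* Let $c=0$. The operator $\mathcal A:\mathcal D\to\mathcal C_0$ given by $$\mathcal Af(x)=\begin{cases}\dfrac{f(\infty)-f(x)}{\gamma_x}&\text{if }x\in\mathbb S,\\[2ex] \displaystyle\lim_{z\to\infty}\frac{f(\infty)-f(z)}{\gamma_z}&\text{if }x=\infty,\end{cases}$$ has a closure that is the Markov generator of the semigroup $(\Psi_t)_{t\ge 0}$ of the K process over $\mathcal C_0$.
   Context: Let $\mathbb S$ be a countably infinite set, $\infty$ a symbol not in $\mathbb S$, and $\bar{\mathbb S}=\mathbb S\cup\{\infty\}$. The parameters are strictly positive reals $\{\gamma_x,\lambda_x:x\in\mathbb S\}$ with $\sum_{x\in\mathbb S}\lambda_x=\infty$ and $\sum_{x\in\mathbb S}\lambda_x\gamma_x<\infty$; set $\gamma_\infty=0$. (The K process has in general a further parameter $c\ge 0$; here $c=0$.) On a probability space $(\Omega,\mathcal F,\mathbb P)$ let the following be independent: a family $\{N_x:x\in\mathbb S\}$ of independent Poisson processes on $\mathbb R^+$, $N_x$ of rate $\lambda_x$ with marks $0<\sigma^x_1<\sigma^x_2<\cdots$ ($N_x(t)$ is the number of marks in $[0,t]$), and a family $\{T_0\}\cup\{T^x_n:n\ge 1,x\in\mathbb S\}$ of i.i.d. exponential random variables of rate $1$. Clock process (with $c=0$): for $y\in\bar{\mathbb S}$, $t\ge 0$, $\Gamma^y(t)=\gamma_yT_0+\sum_{z\in\mathbb S}\sum_{i=1}^{N_z(t)}\gamma_zT^z_i$ (empty sums are $0$), and $\Gamma^y(s-)$ denotes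 its left limit at $s$. K process with initial state $y\in\bar{\mathbb S}$: $X^y(t)=y$ if $t<\gamma_yT_0$; $X^y(t)=x$ (with $x\in\mathbb S$) if $t\in\bigcup_{i\ge 1}[\Gamma^y(\sigma^x_i-),\Gamma^y(\sigma^x_i))$; $X^y(t)=\infty$ otherwise. Metric on $\bar{\mathbb S}$: $d(x,y)=\gamma_x+\gamma_y$ if $x\ne y$ and $d(x,x)=0$; thus $x\to\infty$ means $\gamma_x\to 0$ (limits as $x\to\infty$ are over $x\in\mathbb S$). $\mathcal C_0$ is the Banach space of bounded $d$-continuous functions $f:\bar{\mathbb S}\to\mathbb R$ with the supremum norm. $\mathcal D$ is the set of $f\in\mathcal C_0$ such that $\sum_{x\in\mathbb S}|f(x)-f(\infty)|\lambda_x<\infty$, $\sum_{x\in\mathbb S}(f(x)-f(\infty))\lambda_x=0$, and $\lim_{x\to\infty}\frac{f(x)-f(\infty)}{\gamma_x}$ exists (in $\mathbb R$). Semigroup: $\Psi_tf(x)=\mathbb E[f(X^x(t))]$. Its generator over $\mathcal C_0$ is the operator $f\mapsto\lim_{t\searrow 0}(\Psi_tf-f)/t$ (limit in supremum norm), defined on those $f\in\mathcal C_0$ for which the limit exists. *)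

theory Defs
  imports "HOL-Probability.Probability"
begin

text \<open>
  The countable set of states is (the universe of) the type \<open>'s\<close>; the extended state
  space \<open>S \<union> {\<infinity>}\<close> is \<open>'s option\<close>, with \<^term>\<open>None\<close> for \<open>\<infinity>\<close>.
\<close>

definition ext_gamma :: "('s \<Rightarrow> real) \<Rightarrow> 's option \<Rightarrow> real" where
  "ext_gamma \<gamma> y = (case y of None \<Rightarrow> 0 | Some x \<Rightarrow> \<gamma> x)"

section \<open>Poisson processes\<close>

text \<open>
  Marks are indexed from 1; the value at index 0 is irrelevant.
\<close>

definition mark_count :: "(nat \<Rightarrow> 'w \<Rightarrow> real) \<Rightarrow> real \<Rightarrow> 'w \<Rightarrow> nat" where
  "mark_count \<sigma> t \<omega> = card {i. 1 \<le> i \<and> \<sigma> i \<omega> \<le> t}"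

definition poisson_process :: "'w measure \<Rightarrow> real \<Rightarrow> (nat \<Rightarrow> 'w \<Rightarrow> real) \<Rightarrow> bool" where
  "poisson_process M r \<sigma> \<longleftrightarrow>
     (\<forall>\<omega>\<in>space M. (\<forall>i\<ge>1. 0 < \<sigma> i \<omega> \<and> \<sigma> i \<omega> < \<sigma> (Suc i) \<omega>) \<and>
                   (\<forall>t\<ge>0. finite {i. 1 \<le> i \<and> \<sigma> i \<omega> \<le> t})) \<and>
     (\<forall>t\<ge>0. mark_count \<sigma> t \<in> measurable M (count_space UNIV)) \<and>
     (\<forall>s t. 0 \<le> s \<and> s < t \<longrightarrow>
        distr M (count_space UNIV) (\<lambda>\<omega>. mark_count \<sigma> t \<omega> - mark_count \<sigma> s \<omega>)
          = measure_pmf (poisson_pmf (r * (t - s)))) \<and>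
     (\<forall>n. \<forall>\<tau> :: nat \<Rightarrow> real. 0 \<le> \<tau> 0 \<and> mono \<tau> \<longrightarrow>
        prob_space.indep_vars M (\<lambda>_. count_space UNIV)
          (\<lambda>i \<omega>. mark_count \<sigma> (\<tau> (Suc i)) \<omega> - mark_count \<sigma> (\<tau> i) \<omega>) {..<n})"

section \<open>Parameters and random inputs of the K process\<close>

datatype 's source = Marks 's | Initial | Stay 's nat

text \<open>
  The sigma-algebra generated by each of the independent random inputs: the Poisson process
  at \<open>x\<close>, the variable \<open>T\<^sub>0\<close>, and the variables \<open>T\<^sup>x\<^sub>n\<close>.
\<close>

fun source_sets ::
  "'w measure \<Rightarrow> ('s \<Rightarrow> nat \<Rightarrow> 'w \<Rightarrow> real) \<Rightarrow> ('w \<Rightarrow> real) \<Rightarrow> ('s \<Rightarrow> nat \<Rightarrow> 'w \<Rightarrow> real) \<Rightarrow>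
     's source \<Rightarrow> 'w set set" where
  "source_sets M \<sigma> T0 T (Marks x) =
     sigma_sets (space M) {mark_count (\<sigma> x) t -` A \<inter> space M | t A. 0 \<le> t}"
| "source_sets M \<sigma> T0 T Initial = {T0 -` A \<inter> space M | A. A \<in> sets borel}"
| "source_sets M \<sigma> T0 T (Stay x n) = {T x n -` A \<inter> space M | A. A \<in> sets borel}"

locale K_process_data = prob_space M
  for M :: "'w measure"
    and \<gamma> lam :: "'s \<Rightarrow> real"
    and \<sigma> :: "'s \<Rightarrow> nat \<Rightarrow> 'w \<Rightarrow> real"
    and T0 :: "'w \<Rightarrow> real"
    and T :: "'s \<Rightarrow> nat \<Rightarrow> 'w \<Rightarrow> real" +
  assumes countable_states: "countable (UNIV :: 's set)"
    and infinite_states: "infinite (UNIV :: 's set)"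
    and gamma_pos: "\<And>x. 0 < \<gamma> x"
    and lam_pos: "\<And>x. 0 < lam x"
    and lam_sum_infinite: "\<not> lam summable_on UNIV"
    and lam_gamma_summable: "(\<lambda>x. lam x * \<gamma> x) summable_on UNIV"
    and poisson: "\<And>x. poisson_process M (lam x) (\<sigma> x)"
    and T0_exponential: "distributed M lborel T0 (exponential_density 1)"
    and T_exponential: "\<And>x n. 1 \<le> n \<Longrightarrow> distributed M lborel (T x n) (exponential_density 1)"
    and independent:
      "indep_sets (source_sets M \<sigma> T0 T) (range Marks \<union> {Initial} \<union> {Stay x n | x n. 1 \<le> n})"

section \<open>The K process with \<open>c = 0\<close>\<close>

text \<open>
  The clock is \<open>[0,\<infinity>]\<close>-valued, because the series is finite only almost surely. The coercion
  \<^term>\<open>ennreal\<close> truncates negative numbers, which matters only on the null event that one of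
  the exponential variables is negative.
\<close>

definition clock ::
  "('s \<Rightarrow> real) \<Rightarrow> ('s \<Rightarrow> nat \<Rightarrow> 'w \<Rightarrow> real) \<Rightarrow> ('w \<Rightarrow> real) \<Rightarrow> ('s \<Rightarrow> nat \<Rightarrow> 'w \<Rightarrow> real) \<Rightarrow>
     's option \<Rightarrow> 'w \<Rightarrow> real \<Rightarrow> ennreal" where
  "clock \<gamma> \<sigma> T0 T y \<omega> t =
     ennreal (ext_gamma \<gamma> y * T0 \<omega>) +
     (\<Sum>\<^sub>\<infinity>z. \<Sum>i=1..mark_count (\<sigma> z) t \<omega>. ennreal (\<gamma> z * T z i \<omega>))"

definition clock_left ::
  "('s \<Rightarrow> real) \<Rightarrow> ('s \<Rightarrow> nat \<Rightarrow> 'w \<Rightarrow> real) \<Rightarrow> ('w \<Rightarrow> real) \<Rightarrow> ('s \<Rightarrow> nat \<Rightarrow> 'w \<Rightarrow> real) \<Rightarrow>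
     's option \<Rightarrow> 'w \<Rightarrow> real \<Rightarrow> ennreal" where
  "clock_left \<gamma> \<sigma> T0 T y \<omega> s = Lim (at_left s) (clock \<gamma> \<sigma> T0 T y \<omega>)"

definition visiting ::
  "('s \<Rightarrow> real) \<Rightarrow> ('s \<Rightarrow> nat \<Rightarrow> 'w \<Rightarrow> real) \<Rightarrow> ('w \<Rightarrow> real) \<Rightarrow> ('s \<Rightarrow> nat \<Rightarrow> 'w \<Rightarrow> real) \<Rightarrow>
     's option \<Rightarrow> 'w \<Rightarrow> real \<Rightarrow> 's \<Rightarrow> bool" where
  "visiting \<gamma> \<sigma> T0 T y \<omega> t x \<longleftrightarrow>
     ennreal t \<in> (\<Union>i\<in>{1..}. {clock_left \<gamma> \<sigma> T0 T y \<omega> (\<sigma> x i \<omega>)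
                               ..< clock \<gamma> \<sigma> T0 T y \<omega> (\<sigma> x i \<omega>)})"

text \<open>
  Almost surely no two Poisson processes share a mark, so at most one state is being visited at
  any time. On the exceptional null event the definite description would be ambiguous; there the
  value is set to \<open>\<infinity>\<close>, which keeps the process measurable.
\<close>

definition K_process ::
  "('s \<Rightarrow> real) \<Rightarrow> ('s \<Rightarrow> nat \<Rightarrow> 'w \<Rightarrow> real) \<Rightarrow> ('w \<Rightarrow> real) \<Rightarrow> ('s \<Rightarrow> nat \<Rightarrow> 'w \<Rightarrow> real) \<Rightarrow>
     's option \<Rightarrow> real \<Rightarrow> 'w \<Rightarrow> 's option" where
  "K_process \<gamma> \<sigma> T0 T y t \<omega> =
     (if t < ext_gamma \<gamma> y * T0 \<omega> then y
      else if \<exists>!x. visiting \<gamma> \<sigma> T0 T y \<omega> t x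
           then Some (THE x. visiting \<gamma> \<sigma> T0 T y \<omega> t x)
      else None)"

definition K_semigroup ::
  "'w measure \<Rightarrow> ('s \<Rightarrow> real) \<Rightarrow> ('s \<Rightarrow> nat \<Rightarrow> 'w \<Rightarrow> real) \<Rightarrow> ('w \<Rightarrow> real) \<Rightarrow>
     ('s \<Rightarrow> nat \<Rightarrow> 'w \<Rightarrow> real) \<Rightarrow> real \<Rightarrow> ('s option \<Rightarrow> real) \<Rightarrow> 's option \<Rightarrow> real" where
  "K_semigroup M \<gamma> \<sigma> T0 T t f x = (\<integral>\<omega>. f (K_process \<gamma> \<sigma> T0 T x t \<omega>) \<partial>M)"

section \<open>The space \<open>C\<^sub>0\<close>\<close>

definition state_dist :: "('s \<Rightarrow> real) \<Rightarrow> 's option \<Rightarrow> 's option \<Rightarrow> real" where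
  "state_dist \<gamma> x y = (if x = y then 0 else ext_gamma \<gamma> x + ext_gamma \<gamma> y)"

lemma Metric_space_state_dist:
  assumes "\<And>x. 0 < \<gamma> x"
  shows "Metric_space UNIV (state_dist \<gamma>)"
proof -
  have nn: "0 \<le> ext_gamma \<gamma> x" for x
    using assms by (auto simp: ext_gamma_def less_imp_le split: option.split)
  have pos: "0 < ext_gamma \<gamma> x + ext_gamma \<gamma> y" if "x \<noteq> y" for x y
    using that assms by (cases x; cases y) (auto simp: ext_gamma_def add_pos_pos)
  show ?thesis
  proof
    show "0 \<le> state_dist \<gamma> x y" for x y
      using nn[of x] nn[of y] by (auto simp: state_dist_def)
    show "state_dist \<gamma> x y = state_dist \<gamma> y x" for x y
      by (auto simp: state_dist_def)
    show "(state_dist \<gamma> x y = 0) = (x = y)" for x y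
      using pos[of x y] by (auto simp: state_dist_def)
    show "state_dist \<gamma> x z \<le> state_dist \<gamma> x y + state_dist \<gamma> y z" for x y z
      using nn[of x] nn[of y] nn[of z] by (auto simp: state_dist_def)
  qed
qed

text \<open>
  The bounded continuous real functions with the supremum metric.
\<close>

definition C0 :: "('s \<Rightarrow> real) \<Rightarrow> ('s option \<Rightarrow> real) metric" where
  "C0 \<gamma> = cfunspace (Metric_space.mtopology UNIV (state_dist \<gamma>)) euclidean_metric"

lemma mem_C0_iff:
  assumes "\<And>x. 0 < \<gamma> x"
  shows "f \<in> mspace (C0 \<gamma>) \<longleftrightarrow> bounded (range f) \<and>
           continuous_map (Metric_space.mtopology UNIV (state_dist \<gamma>)) euclidean f"
proof -
  interpret Metric_space UNIV "state_dist \<gamma>"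
    using assms by (rule Metric_space_state_dist)
  show ?thesis
    by (auto simp: C0_def)
qed

text \<open>
  The filter on the states expressing \<open>x \<rightarrow> \<infinity>\<close>, i.e. \<open>\<gamma> x \<rightarrow> 0\<close>.
\<close>

definition to_infinity :: "('s \<Rightarrow> real) \<Rightarrow> 's filter" where
  "to_infinity \<gamma> = filtercomap \<gamma> (nhds 0)"

section \<open>Operators on \<open>C\<^sub>0\<close>\<close>

definition K_domain :: "('s \<Rightarrow> real) \<Rightarrow> ('s \<Rightarrow> real) \<Rightarrow> ('s option \<Rightarrow> real) set" where
  "K_domain \<gamma> lam =
     {f \<in> mspace (C0 \<gamma>).
        (\<lambda>x. \<bar>f (Some x) - f None\<bar> * lam x) summable_on UNIV \<and>
        (\<Sum>\<^sub>\<infinity>x. (f (Some x) - f None) * lam x) = 0 \<and>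
        (\<exists>l. ((\<lambda>x. (f (Some x) - f None) / \<gamma> x) \<longlongrightarrow> l) (to_infinity \<gamma>))}"

definition K_operator :: "('s \<Rightarrow> real) \<Rightarrow> ('s option \<Rightarrow> real) \<Rightarrow> 's option \<Rightarrow> real" where
  "K_operator \<gamma> f x =
     (case x of
        Some x \<Rightarrow> (f None - f (Some x)) / \<gamma> x
      | None \<Rightarrow> Lim (to_infinity \<gamma>) (\<lambda>z. (f None - f (Some z)) / \<gamma> z))"

text \<open>
  Unbounded operators are represented by their graphs.
\<close>

definition operator_graph :: "'a set \<Rightarrow> ('a \<Rightarrow> 'a) \<Rightarrow> ('a \<times> 'a) set" where
  "operator_graph D A = {(f, A f) | f. f \<in> D}"

definition graph_closure :: "'a metric \<Rightarrow> ('a \<times> 'a) set \<Rightarrow> ('a \<times> 'a) set" where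
  "graph_closure B G = prod_topology (mtopology_of B) (mtopology_of B) closure_of G"

definition generator_graph ::
  "('a \<Rightarrow> real) metric \<Rightarrow> (real \<Rightarrow> ('a \<Rightarrow> real) \<Rightarrow> 'a \<Rightarrow> real) \<Rightarrow> (('a \<Rightarrow> real) \<times> ('a \<Rightarrow> real)) set" where
  "generator_graph B P =
     {(f, g). f \<in> mspace B \<and>
        limitin (mtopology_of B) (\<lambda>t x. (P t f x - f x) / t) g (at_right 0)}"

end

theory Submission
  imports Defs
begin

text \<open>
  Write \<open>A\<close> for the operator. Its graph consists of the pairs \<open>(f, g)\<close> of functions in \<open>C\<^sub>0\<close> with
  \<open>f(x) = f(\<infinity>) - \<gamma>\<^sub>x g(x)\<close> for every state \<open>x\<close> and \<open>\<Sum>\<^sub>x \<lambda>\<^sub>x \<gamma>\<^sub>x g(x) = 0\<close> (\<open>operator_graph_iff\<close>). As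
  \<open>\<Sum>\<^sub>x \<lambda>\<^sub>x \<gamma>\<^sub>x\<close> is finite, these relations survive uniform limits, so \<open>A\<close> is itself closed
  (\<open>graph_closure_eq\<close>); and the equation \<open>f - A f = q\<close> can be solved by hand
  (\<open>resolvent_equation_solvable\<close>). Therefore no proper extension of \<open>A\<close> is the generator of
  contractions (\<open>generator_graph_eqI\<close>), and it remains to show that for \<open>f\<close> in the domain
  \<open>(\<Psi>\<^sub>t f - f) / t\<close> tends to \<open>g = A f\<close> uniformly as \<open>t\<close> decreases to \<open>0\<close>.

  From a state \<open>x\<close>, the process stays for an exponential time of mean \<open>\<gamma>\<^sub>x\<close> and then runs as if
  started from \<open>\<infinity>\<close> (\<open>semigroup_eq\<close>). Since \<open>f(x) = f(\<infinity>) - \<gamma>\<^sub>x g(x)\<close>, the first-order expansion of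
  \<open>\<Psi>\<^sub>t f\<close> at \<open>x\<close>, with an error uniform in \<open>x\<close>, follows from the one at \<open>\<infinity>\<close>
  (\<open>semigroup_expansion_error\<close>).

  For the process from \<open>\<infinity>\<close>, let \<open>p\<^sub>x(t)\<close> be the probability of being at \<open>x\<close> at time \<open>t\<close> and
  \<open>m\<^sub>x(t)\<close> the expected time spent at \<open>x\<close> up to \<open>t\<close>. The expected number of visits to \<open>x\<close> that start
  by time \<open>t\<close> is \<open>\<lambda>\<^sub>x v(t)\<close>, where \<open>v(t)\<close> is the integral over local time \<open>s\<close> of the probability that
  the clock at \<open>s\<close> is at most \<open>t\<close>; in particular \<open>v\<close> does not depend on \<open>x\<close>. As visits to \<open>x\<close> end
  at rate \<open>1 / \<gamma>\<^sub>x\<close>, this gives \<open>p\<^sub>x(t) + m\<^sub>x(t) / \<gamma>\<^sub>x = \<lambda>\<^sub>x v(t)\<close> (\<open>occupation_balance\<close>). Because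
  the clock increases by jumps only, almost no time is spent at \<open>\<infinity>\<close> and \<open>\<Sum>\<^sub>x m\<^sub>x(t) = t\<close>
  (\<open>sum_occ_time\<close>). Multiplying the balance by \<open>f(x) - f(\<infinity>) = - \<gamma>\<^sub>x g(x)\<close> and summing over \<open>x\<close>
  removes \<open>v\<close> and leaves \<open>\<Psi>\<^sub>t f(\<infinity>) - f(\<infinity>) = \<Sum>\<^sub>x g(x) m\<^sub>x(t)\<close> (\<open>dynkin\<close>). Finally, the balance
  implies \<open>m\<^sub>x(t) \<le> t \<lambda>\<^sub>x v(t)\<close>, and \<open>v(t)\<close> tends to \<open>0\<close> because \<open>\<Sum>\<^sub>x \<lambda>\<^sub>x\<close> diverges
  (\<open>potential_tendsto_0\<close>). So up to time \<open>t\<close> all but \<open>o(t)\<close> of the time is spent in states with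
  small \<open>\<gamma>\<^sub>x\<close>, where \<open>g(x)\<close> is close to \<open>g(\<infinity>)\<close>, and the sum is \<open>t g(\<infinity>) + o(t)\<close>.
\<close>

section \<open>The operator and its graph\<close>

lemma real_summable_on_iff_integrable:
  fixes f :: "'a \<Rightarrow> real"
  shows "f summable_on UNIV \<longleftrightarrow> integrable (count_space UNIV) f"
  by (metis summable_on_iff_abs_summable_on_real abs_summable_equivalent abs_summable_on_def)

lemma real_infsum_eq_integral:
  fixes f :: "'a \<Rightarrow> real"
  assumes "integrable (count_space UNIV) f"
  shows "infsum f UNIV = (\<integral>x. f x \<partial>count_space UNIV)"
  using infsetsum_infsum[of f UNIV] assms
  unfolding infsetsum_def abs_summable_on_def by metis

text \<open>
  The conditions on the rates alone, which is all that the operator depends on.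
\<close>
locale K_parameters =
  fixes \<gamma> lam :: "'s \<Rightarrow> real"
  assumes gamma_pos: "\<And>x. 0 < \<gamma> x"
    and lam_pos: "\<And>x. 0 < lam x"
    and lam_sum_infinite: "\<not> lam summable_on UNIV"
    and lam_gamma_summable: "(\<lambda>x. lam x * \<gamma> x) summable_on UNIV"
begin

abbreviation states :: "'s measure" where
  "states \<equiv> count_space UNIV"

abbreviation C\<^sub>0 :: "('s option \<Rightarrow> real) set" where
  "C\<^sub>0 \<equiv> mspace (C0 \<gamma>)"

abbreviation A_graph :: "(('s option \<Rightarrow> real) \<times> ('s option \<Rightarrow> real)) set" where
  "A_graph \<equiv> operator_graph (K_domain \<gamma> lam) (K_operator \<gamma>)"

lemma eventually_to_infinity:
  "eventually P (to_infinity \<gamma>) \<longleftrightarrow> (\<exists>e>0. \<forall>x. \<gamma> x < e \<longrightarrow> P x)"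
proof
  assume "eventually P (to_infinity \<gamma>)"
  then obtain Q where Q: "eventually Q (nhds (0::real))" "\<And>x. Q (\<gamma> x) \<Longrightarrow> P x"
    by (auto simp: to_infinity_def eventually_filtercomap)
  then obtain e where "e > 0" "\<And>r. dist r 0 < e \<Longrightarrow> Q r"
    by (auto simp: eventually_nhds_metric)
  then show "\<exists>e>0. \<forall>x. \<gamma> x < e \<longrightarrow> P x"
    using Q(2) gamma_pos by (intro exI[of _ e]) (auto simp: less_imp_le)
next
  assume "\<exists>e>0. \<forall>x. \<gamma> x < e \<longrightarrow> P x"
  then obtain e where e: "e > 0" "\<And>x. \<gamma> x < e \<Longrightarrow> P x" by blast
  have "eventually (\<lambda>r. r < e) (nhds (0::real))"
    using e(1) by (intro order_tendstoD[OF filterlim_ident]) auto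
  then show "eventually P (to_infinity \<gamma>)"
    unfolding to_infinity_def eventually_filtercomap using e(2) by (intro exI[of _ "\<lambda>r. r < e"]) simp
qed

lemma integrable_lam_gamma: "integrable states (\<lambda>x. lam x * \<gamma> x)"
  using lam_gamma_summable by (simp add: real_summable_on_iff_integrable)

lemma exists_small_gamma:
  assumes "e > 0" shows "\<exists>x. \<gamma> x < e"
proof (rule ccontr)
  assume "\<not> (\<exists>x. \<gamma> x < e)"
  then have "e \<le> \<gamma> x" for x by (simp add: not_less)
  then have le: "lam x \<le> (lam x * \<gamma> x) / e" for x
    using mult_left_mono[of e "\<gamma> x" "lam x"] lam_pos[of x] assms by (simp add: pos_le_divide_eq less_imp_le)
  have "integrable states lam"
  proof (rule Bochner_Integration.integrable_bound)
    show "integrable states (\<lambda>x. lam x * \<gamma> x / e)"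
      using integrable_lam_gamma by simp
    show "AE x in states. norm (lam x) \<le> norm (lam x * \<gamma> x / e)"
      using le lam_pos by (intro AE_I2) (metis abs_ge_self abs_of_pos order_trans real_norm_def)
  qed simp
  then show False
    using lam_sum_infinite by (simp add: real_summable_on_iff_integrable)
qed

lemma to_infinity_neq_bot: "to_infinity \<gamma> \<noteq> bot"
  unfolding trivial_limit_def eventually_to_infinity using exists_small_gamma by blast

text \<open>
  Every state other than \<open>\<infinity>\<close> is isolated, so continuity only has content at \<open>\<infinity>\<close>.
\<close>
lemma mem_C0_iff_tendsto:
  "f \<in> C\<^sub>0 \<longleftrightarrow>
     bounded (range f) \<and> ((\<lambda>x. f (Some x)) \<longlongrightarrow> f None) (to_infinity \<gamma>)"
proof -
  interpret Metric_space UNIV "state_dist \<gamma>"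
    by (rule Metric_space_state_dist) (rule gamma_pos)
  have d0: "state_dist \<gamma> None (Some x) = \<gamma> x" for x
    by (simp add: state_dist_def ext_gamma_def)
  have iso: "\<exists>\<delta>>0. \<forall>y. state_dist \<gamma> (Some x) y < \<delta> \<longrightarrow> y = Some x" for x
    using gamma_pos
    by (intro exI[of _ "\<gamma> x"])
       (auto simp: state_dist_def ext_gamma_def not_less less_imp_le split: option.splits if_splits)
  have "continuous_map mtopology euclidean f \<longleftrightarrow>
     (\<forall>a. \<forall>\<epsilon>>0. \<exists>\<delta>>0. \<forall>x. state_dist \<gamma> a x < \<delta> \<longrightarrow> dist (f a) (f x) < \<epsilon>)"
    using metric_continuous_map[OF Met_TC.Metric_space_axioms, of f] by (simp add: Met_TC.mtopology_def)
  also have "\<dots> \<longleftrightarrow> (\<forall>\<epsilon>>0. \<exists>\<delta>>0. \<forall>x. state_dist \<gamma> None x < \<delta> \<longrightarrow> dist (f None) (f x) < \<epsilon>)"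
  proof (intro iffI allI impI)
    fix a and \<epsilon> :: real
    assume *: "\<forall>\<epsilon>>0. \<exists>\<delta>>0. \<forall>x. state_dist \<gamma> None x < \<delta> \<longrightarrow> dist (f None) (f x) < \<epsilon>" and "\<epsilon> > 0"
    show "\<exists>\<delta>>0. \<forall>x. state_dist \<gamma> a x < \<delta> \<longrightarrow> dist (f a) (f x) < \<epsilon>"
    proof (cases a)
      case None then show ?thesis using * \<open>\<epsilon> > 0\<close> by auto
    next
      case (Some x) then show ?thesis using iso[of x] \<open>\<epsilon> > 0\<close> by force
    qed
  qed auto
  also have "\<dots> \<longleftrightarrow> ((\<lambda>x. f (Some x)) \<longlongrightarrow> f None) (to_infinity \<gamma>)"
  proof -
    have "(\<forall>x. state_dist \<gamma> None x < \<delta> \<longrightarrow> dist (f None) (f x) < \<epsilon>) \<longleftrightarrow>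
          (\<forall>x. \<gamma> x < \<delta> \<longrightarrow> dist (f (Some x)) (f None) < \<epsilon>)" if "\<epsilon> > 0" for \<delta> \<epsilon>
      using that by (simp add: split_option_all d0 dist_commute)
    then show ?thesis
      unfolding tendsto_iff eventually_to_infinity by simp
  qed
  finally show ?thesis
    using mem_C0_iff[of \<gamma> f] gamma_pos by simp
qed

lemma C0_bounded:
  assumes "f \<in> C\<^sub>0"
  obtains B where "B > 0" "\<And>x. \<bar>f x\<bar> \<le> B"
  using assms mem_C0_iff_tendsto bounded_pos[of "range f"] by auto

lemma C0_combination:
  assumes "f \<in> C\<^sub>0" "g \<in> C\<^sub>0"
  shows "(\<lambda>x. a * f x + b * g x) \<in> C\<^sub>0"
proof -
  obtain F G where "\<And>x. \<bar>f x\<bar> \<le> F" "\<And>x. \<bar>g x\<bar> \<le> G"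
    using assms C0_bounded by metis
  then have "\<bar>a * f x + b * g x\<bar> \<le> \<bar>a\<bar> * F + \<bar>b\<bar> * G" for x
    by (intro order_trans[OF abs_triangle_ineq] add_mono) (auto simp: abs_mult intro!: mult_left_mono)
  then show ?thesis
    using assms by (auto simp: mem_C0_iff_tendsto bounded_iff intro!: tendsto_intros)
qed

lemma C0_diff:
  assumes "f \<in> C\<^sub>0" "g \<in> C\<^sub>0"
  shows "(\<lambda>x. f x - g x) \<in> C\<^sub>0"
  using C0_combination[OF assms, of 1 "-1"] by simp

lemma mdist_C0_le_iff:
  assumes "f \<in> C\<^sub>0" "g \<in> C\<^sub>0"
  shows "mdist (C0 \<gamma>) f g \<le> a \<longleftrightarrow> (\<forall>x. \<bar>f x - g x\<bar> \<le> a)"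
proof -
  interpret Metric_space UNIV "state_dist \<gamma>"
    by (rule Metric_space_state_dist) (rule gamma_pos)
  show ?thesis
    using cfunspace_mdist_le[of f mtopology euclidean_metric g a] assms
    by (simp add: C0_def dist_real_def)
qed

lemma generator_graph_iff:
  "(f, g) \<in> generator_graph (C0 \<gamma>) P \<longleftrightarrow>
     f \<in> C\<^sub>0 \<and> g \<in> C\<^sub>0 \<and>
     (\<forall>e>0. \<forall>\<^sub>F t in at_right 0. (\<lambda>x. (P t f x - f x) / t) \<in> C\<^sub>0 \<and>
        (\<forall>x. \<bar>(P t f x - f x) / t - g x\<bar> \<le> e))"
proof -
  let ?Q = "\<lambda>t x. (P t f x - f x) / t"
  interpret C: Metric_space "C\<^sub>0" "mdist (C0 \<gamma>)" by simp
  have "limitin (mtopology_of (C0 \<gamma>)) (\<lambda>t x. (P t f x - f x) / t) g (at_right 0) \<longleftrightarrow>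
     g \<in> C\<^sub>0 \<and> (\<forall>e>0. \<forall>\<^sub>F t in at_right 0. (?Q t) \<in> C\<^sub>0 \<and>
        (\<forall>x. \<bar>?Q t x - g x\<bar> \<le> e))"
    unfolding mtopology_of_def C.limitin_metric
  proof (intro conj_cong refl iffI allI impI)
    fix e :: real
    assume g: "g \<in> C\<^sub>0" and "e > 0"
    { assume *: "\<forall>e>0. \<forall>\<^sub>F t in at_right 0. (?Q t) \<in> C\<^sub>0 \<and>
          mdist (C0 \<gamma>) (?Q t) g < e"
      show "\<forall>\<^sub>F t in at_right 0. (?Q t) \<in> C\<^sub>0 \<and>
          (\<forall>x. \<bar>?Q t x - g x\<bar> \<le> e)"
        using *[rule_format, OF \<open>e > 0\<close>]
      proof eventually_elim
        case (elim t)
        then show ?case using mdist_C0_le_iff[of "?Q t" g e] g by auto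
      qed }
    { assume *: "\<forall>e>0. \<forall>\<^sub>F t in at_right 0. (?Q t) \<in> C\<^sub>0 \<and>
          (\<forall>x. \<bar>?Q t x - g x\<bar> \<le> e)"
      have "e / 2 > 0" using \<open>e > 0\<close> by simp
      from *[rule_format, OF this]
      show "\<forall>\<^sub>F t in at_right 0. (?Q t) \<in> C\<^sub>0 \<and>
          mdist (C0 \<gamma>) (?Q t) g < e"
      proof eventually_elim
        case (elim t)
        then show ?case
          using mdist_C0_le_iff[of "?Q t" g "e/2"] g \<open>e > 0\<close> by auto
      qed }
  qed
  then show ?thesis by (auto simp: generator_graph_def)
qed

lemma integrable_lam_gamma_mult:
  assumes "\<And>x. \<bar>g x\<bar> \<le> B"
  shows "integrable states (\<lambda>x. lam x * \<gamma> x * g x)"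
proof (rule Bochner_Integration.integrable_bound)
  show "integrable states (\<lambda>x. lam x * \<gamma> x * B)"
    using integrable_lam_gamma by (rule integrable_mult_left)
  show "AE x in states. norm (lam x * \<gamma> x * g x) \<le> norm (lam x * \<gamma> x * B)"
    using assms lam_pos gamma_pos
    by (auto simp: abs_mult intro!: mult_left_mono order_trans[OF assms abs_ge_self])
qed simp

text \<open>
  Membership in the domain together with the value of the operator amounts to one equation: near
  \<open>\<infinity>\<close>, existence of the limit of the difference quotients is continuity of the image, and then
  the quotients are bounded, so that the first two conditions defining the domain say that the
  image integrates to zero against the finite measure with weights \<open>lam x * \<gamma> x\<close>.
\<close>
lemma operator_graph_iff:
  "(f, g) \<in> A_graph \<longleftrightarrow>
     f \<in> C\<^sub>0 \<and> g \<in> C\<^sub>0 \<and>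
     (\<forall>x. f (Some x) = f None - \<gamma> x * g (Some x)) \<and>
     (\<integral>x. lam x * \<gamma> x * g (Some x) \<partial>states) = 0"
  (is "?L \<longleftrightarrow> ?R")
proof
  assume ?L
  then have f: "f \<in> K_domain \<gamma> lam" and g: "g = K_operator \<gamma> f"
    by (auto simp: operator_graph_def)
  have gx: "g (Some x) = (f None - f (Some x)) / \<gamma> x" for x
    by (simp add: g K_operator_def)
  have eq: "f (Some x) = f None - \<gamma> x * g (Some x)" for x
    using gamma_pos[of x] by (simp add: gx)
  obtain l where l: "((\<lambda>x. (f (Some x) - f None) / \<gamma> x) \<longlongrightarrow> l) (to_infinity \<gamma>)"
    using f by (auto simp: K_domain_def)
  have "((\<lambda>x. g (Some x)) \<longlongrightarrow> - l) (to_infinity \<gamma>)"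
    using tendsto_minus[OF l] by (simp add: gx minus_divide_left)
  moreover from this have "g None = - l"
    using to_infinity_neq_bot unfolding g K_operator_def by (simp add: tendsto_Lim)
  ultimately have lim: "((\<lambda>x. g (Some x)) \<longlongrightarrow> g None) (to_infinity \<gamma>)" by simp
  have f0: "f \<in> C\<^sub>0" using f by (simp add: K_domain_def)
  obtain B where B: "B > 0" "\<And>x. \<bar>f x\<bar> \<le> B" using C0_bounded[OF f0] by blast
  have "\<forall>\<^sub>F x in to_infinity \<gamma>. \<bar>g (Some x)\<bar> \<le> \<bar>g None\<bar> + 1"
    using tendstoD[OF lim zero_less_one] by eventually_elim (simp add: dist_real_def)
  then obtain e where e: "e > 0" "\<And>x. \<gamma> x < e \<Longrightarrow> \<bar>g (Some x)\<bar> \<le> \<bar>g None\<bar> + 1"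
    by (auto simp: eventually_to_infinity)
  have "\<bar>g y\<bar> \<le> \<bar>g None\<bar> + 1 + 2 * B / e" for y
  proof (cases y)
    case (Some x)
    show ?thesis
    proof (cases "\<gamma> x < e")
      case True
      then show ?thesis using e B Some by (auto intro: add_increasing2)
    next
      case False
      have "\<bar>g (Some x)\<bar> = \<bar>f None - f (Some x)\<bar> / \<gamma> x"
        using gamma_pos[of x] by (simp add: gx abs_divide)
      also have "\<dots> \<le> (2 * B) / e"
        using False e(1) B(2)[of None] B(2)[of "Some x"] by (intro frac_le) auto
      finally show ?thesis using Some by simp
    qed
  qed (use B e in auto)
  then have g0: "g \<in> C\<^sub>0" and int: "integrable states (\<lambda>x. lam x * \<gamma> x * g (Some x))"
    using lim by (auto simp: mem_C0_iff_tendsto bounded_iff intro!: integrable_lam_gamma_mult)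
  have "0 = (\<Sum>\<^sub>\<infinity>x. (f (Some x) - f None) * lam x)"
    using f by (simp add: K_domain_def)
  also have "(\<lambda>x. (f (Some x) - f None) * lam x) = (\<lambda>x. - (lam x * \<gamma> x * g (Some x)))"
    by (subst eq) (simp add: algebra_simps)
  also have "infsum \<dots> UNIV = - (\<integral>x. lam x * \<gamma> x * g (Some x) \<partial>states)"
    using int by (subst real_infsum_eq_integral) auto
  finally show ?R using f0 g0 eq by simp
next
  assume R: ?R
  then obtain B where B: "B > 0" "\<And>x. \<bar>g x\<bar> \<le> B" using C0_bounded by metis
  have lim: "((\<lambda>x. g (Some x)) \<longlongrightarrow> g None) (to_infinity \<gamma>)"
    using R by (simp add: mem_C0_iff_tendsto)
  have gx: "(f None - f (Some x)) / \<gamma> x = g (Some x)" for x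
    using R gamma_pos[of x] by simp
  have gx': "(f (Some x) - f None) / \<gamma> x = - g (Some x)" for x
    using R gamma_pos[of x] by simp
  have int: "integrable states (\<lambda>x. lam x * \<gamma> x * g (Some x))"
    using B by (intro integrable_lam_gamma_mult)
  have eq: "(f (Some x) - f None) * lam x = - (lam x * \<gamma> x * g (Some x))" for x
    using R spec[of "\<lambda>x. f (Some x) = f None - \<gamma> x * g (Some x)" x] by auto
  have "\<bar>f (Some x) - f None\<bar> * lam x = \<bar>lam x * \<gamma> x * g (Some x)\<bar>" for x
    using arg_cong[OF eq[of x], of abs] lam_pos[of x] by (simp add: abs_mult)
  then have "(\<lambda>x. \<bar>f (Some x) - f None\<bar> * lam x) summable_on UNIV"
    using int by (simp add: real_summable_on_iff_integrable integrable_abs)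
  moreover have "(\<Sum>\<^sub>\<infinity>x. (f (Some x) - f None) * lam x) = 0"
    unfolding eq using int R by (subst real_infsum_eq_integral) auto
  moreover have "((\<lambda>x. (f (Some x) - f None) / \<gamma> x) \<longlongrightarrow> - g None) (to_infinity \<gamma>)"
    unfolding gx' by (intro tendsto_intros lim)
  ultimately have "f \<in> K_domain \<gamma> lam"
    using R by (auto simp: K_domain_def)
  moreover have "K_operator \<gamma> f = g"
  proof
    fix y show "K_operator \<gamma> f y = g y"
      using tendsto_Lim[OF to_infinity_neq_bot lim]
      by (cases y) (simp_all add: K_operator_def gx)
  qed
  ultimately show ?L by (auto simp: operator_graph_def)
qed

text \<open>
  The relation between \<open>f\<close> and \<open>g\<close> in the preceding lemma survives uniform limits, since the
  weights \<open>lam x * \<gamma> x\<close> are summable. So the operator is closed.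
\<close>
lemma graph_closure_eq:
  "graph_closure (C0 \<gamma>) (A_graph) =
     A_graph" (is "graph_closure _ ?G = ?G")
proof
  interpret C: Metric_space "C\<^sub>0" "mdist (C0 \<gamma>)" by simp
  have top: "topspace (mtopology_of (C0 \<gamma>)) = C\<^sub>0" by simp
  have sub: "?G \<subseteq> C\<^sub>0 \<times> C\<^sub>0"
    using operator_graph_iff by auto
  then show "?G \<subseteq> graph_closure (C0 \<gamma>) ?G"
    unfolding graph_closure_def by (intro closure_of_subset) (simp add: topspace_prod_topology)
  show "graph_closure (C0 \<gamma>) ?G \<subseteq> ?G"
  proof safe
    fix f g assume fg: "(f, g) \<in> graph_closure (C0 \<gamma>) ?G"
    then have f: "f \<in> C\<^sub>0" and g: "g \<in> C\<^sub>0"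
      by (auto simp: graph_closure_def in_closure_of)
    have approx: "\<exists>f' g'. (f', g') \<in> ?G \<and> (\<forall>x. \<bar>f x - f' x\<bar> \<le> e) \<and> (\<forall>x. \<bar>g x - g' x\<bar> \<le> e)"
      if "e > 0" for e
    proof -
      have "openin (prod_topology (mtopology_of (C0 \<gamma>)) (mtopology_of (C0 \<gamma>)))
              (C.mball f e \<times> C.mball g e)"
        by (simp add: openin_prod_Times_iff mtopology_of_def)
      moreover have "(f, g) \<in> C.mball f e \<times> C.mball g e" using f g that by simp
      ultimately obtain p where p: "p \<in> ?G" "p \<in> C.mball f e \<times> C.mball g e"
        using fg unfolding graph_closure_def in_closure_of by metis
      obtain f' g' where "p = (f', g')" by (cases p)
      then show ?thesis
        using p mdist_C0_le_iff[of f f' e] mdist_C0_le_iff[of g g' e]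
        by (intro exI[of _ f'] exI[of _ g']) auto
    qed
    have "f (Some x) = f None - \<gamma> x * g (Some x)" for x
    proof -
      have "\<bar>f (Some x) - (f None - \<gamma> x * g (Some x))\<bar> \<le> 0 + e" if "e > 0" for e
      proof -
        define d where "d = e / (2 + \<gamma> x)"
        have d: "d > 0" using that gamma_pos[of x] by (simp add: d_def add_pos_pos)
        obtain f' g' where *: "(f', g') \<in> ?G" "\<And>x. \<bar>f x - f' x\<bar> \<le> d" "\<And>x. \<bar>g x - g' x\<bar> \<le> d"
          using approx[OF d] by blast
        have eq: "f' (Some x) = f' None - \<gamma> x * g' (Some x)"
          using *(1) operator_graph_iff by blast
        have "f (Some x) - (f None - \<gamma> x * g (Some x)) =
          (f (Some x) - f' (Some x)) - (f None - f' None) + \<gamma> x * (g (Some x) - g' (Some x))"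
          using eq by (simp add: algebra_simps)
        also have "\<bar>\<dots>\<bar> \<le> d + d + \<gamma> x * d"
          using *(2)[of "Some x"] *(2)[of None] mult_left_mono[OF *(3)[of "Some x"] less_imp_le[OF gamma_pos[of x]]]
            abs_mult[of "\<gamma> x" "g (Some x) - g' (Some x)"] gamma_pos[of x]
          by linarith
        also have "\<dots> = d * (2 + \<gamma> x)" by (simp add: algebra_simps)
        also have "\<dots> = e" using gamma_pos[of x] by (simp add: d_def)
        finally show ?thesis by simp
      qed
      from field_le_epsilon[OF this] show ?thesis by simp
    qed
    moreover have "(\<integral>x. lam x * \<gamma> x * g (Some x) \<partial>states) = 0"
    proof -
      define S where "S = (\<integral>x. lam x * \<gamma> x \<partial>states)"
      have S: "S \<ge> 0" unfolding S_def
        by (intro integral_nonneg_AE) (auto simp: less_imp_le[OF lam_pos] less_imp_le[OF gamma_pos])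
      have "\<bar>\<integral>x. lam x * \<gamma> x * g (Some x) \<partial>states\<bar> \<le> 0 + e" if "e > 0" for e
      proof -
        define d where "d = e / (1 + S)"
        have d: "d > 0" using that S by (simp add: d_def)
        obtain f' g' where *: "(f', g') \<in> ?G" "\<And>x. \<bar>g x - g' x\<bar> \<le> d"
          using approx[OF d] by blast
        obtain B where B: "\<And>x. \<bar>g x\<bar> \<le> B" using C0_bounded[OF g] by blast
        have "g' \<in> C\<^sub>0" using *(1) operator_graph_iff by blast
        then obtain B' where B': "\<And>x. \<bar>g' x\<bar> \<le> B'" using C0_bounded by blast
        have int: "integrable states (\<lambda>x. lam x * \<gamma> x * g (Some x))"
          "integrable states (\<lambda>x. lam x * \<gamma> x * g' (Some x))"
          by (rule integrable_lam_gamma_mult, rule B, rule integrable_lam_gamma_mult, rule B')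
        have "(\<integral>x. lam x * \<gamma> x * g (Some x) \<partial>states) =
           (\<integral>x. lam x * \<gamma> x * g (Some x) - lam x * \<gamma> x * g' (Some x) \<partial>states)"
          using *(1) operator_graph_iff[of f' g'] int by simp
        also have "\<bar>\<dots>\<bar> \<le> (\<integral>x. \<bar>lam x * \<gamma> x * g (Some x) - lam x * \<gamma> x * g' (Some x)\<bar> \<partial>states)"
          by (rule integral_abs_bound)
        also have "\<dots> \<le> (\<integral>x. lam x * \<gamma> x * d \<partial>states)"
        proof (rule integral_mono)
          show "integrable states (\<lambda>x. \<bar>lam x * \<gamma> x * g (Some x) - lam x * \<gamma> x * g' (Some x)\<bar>)"
            by (intro integrable_abs Bochner_Integration.integrable_diff int)
          show "integrable states (\<lambda>x. lam x * \<gamma> x * d)"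
            using integrable_lam_gamma by (rule integrable_mult_left)
          show "\<bar>lam x * \<gamma> x * g (Some x) - lam x * \<gamma> x * g' (Some x)\<bar> \<le> lam x * \<gamma> x * d" for x
            using *(2)[of "Some x"] lam_pos[of x] gamma_pos[of x]
            by (simp add: right_diff_distrib[symmetric] abs_mult)
        qed
        also have "\<dots> = S * d" by (simp add: S_def)
        also have "\<dots> \<le> e" using that S by (simp add: d_def divide_simps)
        finally show ?thesis by simp
      qed
      from field_le_epsilon[OF this] show ?thesis by simp
    qed
    ultimately show "(f, g) \<in> ?G"
      using f g by (simp add: operator_graph_iff)
  qed
qed

text \<open>
  The resolvent equation \<open>f - A f = q\<close> is solved by hand. On the states it gives \<open>f\<close> in terms
  of \<open>q\<close> and \<open>c = f None\<close>, and the vanishing of the weighted sum of the image then determines \<open>c\<close>.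
\<close>
lemma resolvent_equation_solvable:
  assumes q: "q \<in> C\<^sub>0"
  shows "\<exists>f g. (f, g) \<in> A_graph \<and> (\<forall>x. f x - g x = q x)"
proof -
  define w where "w x = lam x * \<gamma> x / (1 + \<gamma> x)" for x
  have g1: "1 + \<gamma> x > 0" for x using gamma_pos[of x] by simp
  have w: "w x > 0" "w x \<le> lam x * \<gamma> x" for x
    using gamma_pos[of x] lam_pos[of x] by (auto simp: w_def divide_simps)
  have iw: "integrable states w"
    by (rule Bochner_Integration.integrable_bound[OF integrable_lam_gamma])
       (use w gamma_pos lam_pos in \<open>auto simp: abs_of_pos\<close>)
  obtain B where B: "B > 0" "\<And>x. \<bar>q x\<bar> \<le> B" using C0_bounded[OF q] by blast
  have iwq: "integrable states (\<lambda>x. w x * q (Some x))"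
  proof (rule Bochner_Integration.integrable_bound[OF integrable_mult_left[OF iw, of B]])
    show "AE x in states. norm (w x * q (Some x)) \<le> norm (w x * B)"
      using w B by (auto simp: abs_mult less_imp_le abs_of_pos)
  qed simp
  define W where "W = (\<integral>x. w x \<partial>states)"
  have "W > 0"
  proof -
    have "W \<noteq> 0"
      using w(1) integral_nonneg_eq_0_iff_AE[OF iw] unfolding W_def
      by (auto simp: AE_count_space less_imp_le less_imp_neq[THEN not_sym])
    moreover have "W \<ge> 0"
      unfolding W_def using w(1) by (intro integral_nonneg_AE) (auto simp: less_imp_le)
    ultimately show ?thesis by simp
  qed
  define c where "c = (\<integral>x. w x * q (Some x) \<partial>states) / W"
  define f where "f y = (c + ext_gamma \<gamma> y * q y) / (1 + ext_gamma \<gamma> y)" for y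
  define g where "g y = (c - q y) / (1 + ext_gamma \<gamma> y)" for y
  have gS: "g (Some x) = (c - q (Some x)) / (1 + \<gamma> x)" for x
    by (simp add: g_def ext_gamma_def)
  have [simp]: "f None = c" "g None = c - q None"
    "f (Some x) = (c + \<gamma> x * q (Some x)) / (1 + \<gamma> x)" for x
    by (simp_all add: f_def g_def ext_gamma_def)
  have gam0: "(\<gamma> \<longlongrightarrow> 0) (to_infinity \<gamma>)"
    by (simp add: to_infinity_def filterlim_filtercomap)
  have lq: "((\<lambda>x. q (Some x)) \<longlongrightarrow> q None) (to_infinity \<gamma>)"
    using q by (simp add: mem_C0_iff_tendsto)
  have "((\<lambda>x. g (Some x)) \<longlongrightarrow> (c - q None) / (1 + 0)) (to_infinity \<gamma>)"
    unfolding gS by (intro tendsto_intros gam0 lq) simp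
  moreover have gb: "\<bar>g y\<bar> \<le> \<bar>c\<bar> + B" for y
  proof -
    have e: "ext_gamma \<gamma> y \<ge> 0" using gamma_pos by (auto simp: ext_gamma_def less_imp_le split: option.split)
    have "\<bar>g y\<bar> = \<bar>c - q y\<bar> / (1 + ext_gamma \<gamma> y)" using e by (simp add: g_def abs_divide)
    also have "\<dots> \<le> \<bar>c - q y\<bar> / 1" using e by (intro divide_left_mono) auto
    also have "\<dots> \<le> \<bar>c\<bar> + B" using B(2)[of y] by (subst div_by_1) linarith
    finally show ?thesis .
  qed
  ultimately have g0: "g \<in> C\<^sub>0"
    by (auto simp: mem_C0_iff_tendsto bounded_iff)
  have fg: "f y = q y + g y" for y
  proof -
    have e: "1 + ext_gamma \<gamma> y > 0"
      using gamma_pos by (auto simp: ext_gamma_def less_imp_le add_pos_pos split: option.split)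
    then show ?thesis by (simp add: f_def g_def field_simps)
  qed
  then have "f = (\<lambda>y. 1 * q y + 1 * g y)" by auto
  then have f0: "f \<in> C\<^sub>0" using C0_combination[OF q g0, of 1 1] by simp
  have "(\<integral>x. lam x * \<gamma> x * g (Some x) \<partial>states) =
        (\<integral>x. w x * c - w x * q (Some x) \<partial>states)"
    by (intro Bochner_Integration.integral_cong) (auto simp: w_def gS diff_divide_distrib right_diff_distrib)
  also have "\<dots> = W * c - (\<integral>x. w x * q (Some x) \<partial>states)"
    using iw iwq by (simp add: W_def)
  also have "\<dots> = 0" using \<open>W > 0\<close> by (simp add: c_def)
  finally have "(f, g) \<in> A_graph"
    unfolding operator_graph_iff using f0 g0 g1
    by (auto simp: gS field_simps less_imp_neq[THEN not_sym])
  then show ?thesis using fg by (intro exI[of _ f] exI[of _ g]) simp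
qed

text \<open>
  An extension of the operator that is the generator of contractions cannot be proper: the
  resolvent equation leaves for the difference only an eigenvector \<open>d\<close> with eigenvalue 1, and a
  contraction cannot multiply the norm of \<open>d\<close> by \<open>1 + t + o(t)\<close>.
\<close>
lemma generator_graph_eqI:
  assumes graph: "A_graph \<subseteq> generator_graph (C0 \<gamma>) P"
    and contraction: "\<And>t f B x. t > 0 \<Longrightarrow> f \<in> C\<^sub>0 \<Longrightarrow> (\<And>y. \<bar>f y\<bar> \<le> B) \<Longrightarrow> \<bar>P t f x\<bar> \<le> B"
    and diff: "\<And>t f g x. t > 0 \<Longrightarrow> f \<in> C\<^sub>0 \<Longrightarrow> g \<in> C\<^sub>0 \<Longrightarrow>
                 P t (\<lambda>y. f y - g y) x = P t f x - P t g x"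
  shows "generator_graph (C0 \<gamma>) P = A_graph"
proof (intro subset_antisym graph subrelI)
  fix f g assume fg: "(f, g) \<in> generator_graph (C0 \<gamma>) P"
  then have f: "f \<in> C\<^sub>0" and g: "g \<in> C\<^sub>0" by (auto simp: generator_graph_iff)
  obtain h k where hk: "(h, k) \<in> A_graph"
    and hkq: "\<And>x. h x - k x = f x - g x"
    using resolvent_equation_solvable[OF C0_diff[OF f g]] by blast
  have hk': "(h, k) \<in> generator_graph (C0 \<gamma>) P" using hk graph by blast
  then have h: "h \<in> C\<^sub>0" by (auto simp: generator_graph_iff)
  define d where "d x = f x - h x" for x
  have d: "d \<in> C\<^sub>0" unfolding d_def[abs_def] by (rule C0_diff[OF f h])
  have bdd: "bdd_above (range (\<lambda>x. \<bar>d x\<bar>))"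
    using C0_bounded[OF d] by (metis bdd_aboveI2)
  define D where "D = (SUP x. \<bar>d x\<bar>)"
  have dD: "\<bar>d x\<bar> \<le> D" for x unfolding D_def using bdd by (rule cSUP_upper2) auto
  have "D \<le> 0 + e" if "e > 0" for e
  proof -
    have "e / 2 > 0" using that by simp
    have "\<forall>\<^sub>F t in at_right 0. t > 0 \<and>
       (\<forall>x. \<bar>(P t f x - f x) / t - g x\<bar> \<le> e / 2) \<and> (\<forall>x. \<bar>(P t h x - h x) / t - k x\<bar> \<le> e / 2)"
    proof (intro eventually_conj eventually_at_right_less)
      show "\<forall>\<^sub>F t in at_right 0. \<forall>x. \<bar>(P t f x - f x) / t - g x\<bar> \<le> e / 2"
        using fg \<open>e / 2 > 0\<close> unfolding generator_graph_iff by (blast intro: eventually_mono)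
      show "\<forall>\<^sub>F t in at_right 0. \<forall>x. \<bar>(P t h x - h x) / t - k x\<bar> \<le> e / 2"
        using hk' \<open>e / 2 > 0\<close> unfolding generator_graph_iff by (blast intro: eventually_mono)
    qed
    then obtain t where t: "t > 0" "\<And>x. \<bar>(P t f x - f x) / t - g x\<bar> \<le> e / 2"
        "\<And>x. \<bar>(P t h x - h x) / t - k x\<bar> \<le> e / 2"
      using eventually_happens'[OF trivial_limit_at_right_real] by blast
    have "\<bar>d x\<bar> \<le> (D + t * e) / (1 + t)" for x
    proof -
      have "P t d x = P t f x - P t h x"
        unfolding d_def[abs_def] by (rule diff[OF t(1) f h])
      then have "(P t d x - d x) / t - d x =
          ((P t f x - f x) / t - g x) - ((P t h x - h x) / t - k x)"
        using hkq[of x] by (simp add: d_def diff_divide_distrib)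
      then have "\<bar>(P t d x - d x) / t - d x\<bar> \<le> e"
        using t(2)[of x] t(3)[of x] by linarith
      then have "\<bar>t * ((P t d x - d x) / t - d x)\<bar> \<le> t * e"
        using t(1) by (simp add: abs_mult)
      moreover have "(1 + t) * d x = P t d x - t * ((P t d x - d x) / t - d x)"
        using t(1) by (simp add: field_simps)
      moreover have "\<bar>P t d x\<bar> \<le> D" using contraction[OF t(1) d dD] .
      ultimately have "\<bar>(1 + t) * d x\<bar> \<le> D + t * e"
        using abs_triangle_ineq4[of "P t d x" "t * ((P t d x - d x) / t - d x)"] by simp
      then show ?thesis using t(1) by (simp add: abs_mult field_simps)
    qed
    then have "D \<le> (D + t * e) / (1 + t)"
      unfolding D_def by (intro cSUP_least) auto
    then show ?thesis using t(1) by (simp add: field_simps)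
  qed
  from field_le_epsilon[OF this] have "D \<le> 0" .
  then have "d x = 0" for x using dD[of x] by simp
  then have "f x = h x" "g x = k x" for x using hkq[of x] by (auto simp: d_def)
  then have "f = h" "g = k" by auto
  then show "(f, g) \<in> A_graph" using hk by simp
qed

end

section \<open>The clock as a sum of jumps\<close>

lemma countable_nn_integral_eq_SUP:
  fixes f :: "'a \<Rightarrow> ennreal"
  assumes "countable (UNIV :: 'a set)"
  shows "(\<integral>\<^sup>+x. f x \<partial>count_space UNIV) = (SUP F\<in>{F. finite F}. sum f F)"
proof (rule antisym)
  show "(SUP F\<in>{F. finite F}. sum f F) \<le> (\<integral>\<^sup>+x. f x \<partial>count_space UNIV)"
  proof (rule SUP_least)
    fix F :: "'a set" assume "F \<in> {F. finite F}"
    then have "sum f F = (\<integral>\<^sup>+x. f x * indicator F x \<partial>count_space UNIV)"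
      by (subst nn_integral_count_space'[where A = F])
         (auto simp: indicator_def intro!: sum.cong)
    also have "\<dots> \<le> (\<integral>\<^sup>+x. f x \<partial>count_space UNIV)"
      by (intro nn_integral_mono) (auto simp: indicator_def)
    finally show "sum f F \<le> (\<integral>\<^sup>+x. f x \<partial>count_space UNIV)" .
  qed
  show "(\<integral>\<^sup>+x. f x \<partial>count_space UNIV) \<le> (SUP F\<in>{F. finite F}. sum f F)"
  proof (cases "finite (UNIV :: 'a set)")
    case True
    then show ?thesis by (subst nn_integral_count_space_finite) (auto intro: SUP_upper)
  next
    case False
    let ?e = "from_nat_into (UNIV :: 'a set)"
    have bij: "bij_betw ?e UNIV UNIV"
      using assms False by (rule bij_betw_from_nat_into)
    have "(\<integral>\<^sup>+x. f x \<partial>count_space UNIV) = (\<Sum>n. f (?e n))"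
      by (simp add: nn_integral_bij_count_space[symmetric, OF bij] nn_integral_count_space_nat)
    also have "\<dots> = (SUP n. \<Sum>i<n. f (?e i))"
      by (rule suminf_eq_SUP)
    also have "\<dots> \<le> (SUP F\<in>{F. finite F}. sum f F)"
    proof (rule SUP_least)
      fix n
      have "(\<Sum>i<n. f (?e i)) = sum f (?e ` {..<n})"
        using bij by (subst sum.reindex) (auto simp: bij_betw_def inj_on_def)
      then show "(\<Sum>i<n. f (?e i)) \<le> (SUP F\<in>{F. finite F}. sum f F)"
        by (auto intro!: SUP_upper)
    qed
    finally show ?thesis .
  qed
qed

lemma ennreal_infsum_eq_nn_integral:
  fixes f :: "'a \<Rightarrow> ennreal"
  assumes "countable (UNIV :: 'a set)"
  shows "infsum f UNIV = (\<integral>\<^sup>+x. f x \<partial>count_space UNIV)"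
  using nonneg_infsum_complete[of UNIV f] countable_nn_integral_eq_SUP[OF assms, of f] by simp

sublocale K_process_data \<subseteq> K_parameters \<gamma> lam
  by unfold_locales (fact gamma_pos lam_pos lam_sum_infinite lam_gamma_summable)+

context K_process_data
begin

lemma mark_increasing:
  assumes "w \<in> space M" "1 \<le> i" "i < j"
  shows "\<sigma> x i w < \<sigma> x j w"
proof -
  have step: "\<sigma> x k w < \<sigma> x (Suc k) w" if "1 \<le> k" for k
    using poisson[of x] assms(1) that by (auto simp: poisson_process_def)
  show ?thesis
    using assms(3) assms(2)
  proof (induction rule: less_Suc_induct)
    case (1 k) then show ?case using step by simp
  next
    case (2 k l m) then show ?case by simp
  qed
qed

lemma mark_pos: "w \<in> space M \<Longrightarrow> 1 \<le> i \<Longrightarrow> 0 < \<sigma> x i w"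
  using poisson[of x] by (auto simp: poisson_process_def)

lemma mark_le_iff:
  assumes w: "w \<in> space M" and i: "1 \<le> i"
  shows "\<sigma> x i w \<le> s \<longleftrightarrow> i \<le> mark_count (\<sigma> x) s w"
proof -
  let ?D = "{i. 1 \<le> i \<and> \<sigma> x i w \<le> s}"
  have fin: "finite ?D"
  proof (cases "s \<ge> 0")
    case True then show ?thesis using poisson[of x] w by (auto simp: poisson_process_def)
  next
    case False
    then have "k \<notin> ?D" for k using mark_pos[OF w, of k x] by auto
    then have "?D = {}" by blast
    then show ?thesis by (metis finite.emptyI)
  qed
  have down: "{1..k} \<subseteq> ?D" if "k \<in> ?D" for k
  proof
    fix j assume "j \<in> {1..k}"
    then show "j \<in> ?D" using mark_increasing[OF w, of j k x] that by (cases "j = k") auto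
  qed
  show ?thesis
  proof
    assume "\<sigma> x i w \<le> s"
    then have "{1..i} \<subseteq> ?D" using down i by simp
    from card_mono[OF fin this] show "i \<le> mark_count (\<sigma> x) s w" by (simp add: mark_count_def)
  next
    assume le: "i \<le> mark_count (\<sigma> x) s w"
    show "\<sigma> x i w \<le> s"
    proof (rule ccontr)
      assume "\<not> \<sigma> x i w \<le> s"
      then have "i \<notin> ?D" by simp
      then have "k < i" if "k \<in> ?D" for k using down[OF that] i by (meson atLeastAtMost_iff not_le subsetD)
      then have "?D \<subseteq> {1..<i}" by auto
      from card_mono[OF _ this] show False using le i by (simp add: mark_count_def)
    qed
  qed
qed

abbreviation jump :: "'s \<times> nat \<Rightarrow> 'w \<Rightarrow> real" where
  "jump p w \<equiv> \<gamma> (fst p) * T (fst p) (snd p) w"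

text \<open>
  For a fixed outcome, the jumps of the clock form a measure on pairs of a state and a mark
  number. The clock at \<open>s\<close> is the mass of the marks up to \<open>s\<close>, so that one-sided limits and
  additivity are those of a measure.
\<close>
definition jumps :: "'w \<Rightarrow> ('s \<times> nat) measure" where
  "jumps w = density (count_space UNIV) (\<lambda>p. ennreal (jump p w))"

definition marks :: "('s \<times> nat) set" where
  "marks = {p. 1 \<le> snd p}"

definition mark :: "'s \<times> nat \<Rightarrow> 'w \<Rightarrow> real" where
  "mark p = \<sigma> (fst p) (snd p)"

definition marks_upto :: "real \<Rightarrow> 'w \<Rightarrow> ('s \<times> nat) set" where
  "marks_upto s w = {p \<in> marks. mark p w \<le> s}"

definition marks_before :: "real \<Rightarrow> 'w \<Rightarrow> ('s \<times> nat) set" where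
  "marks_before s w = {p \<in> marks. mark p w < s}"

definition time_upto :: "real \<Rightarrow> 'w \<Rightarrow> ennreal" where
  "time_upto s w = emeasure (jumps w) (marks_upto s w)"

definition time_before :: "real \<Rightarrow> 'w \<Rightarrow> ennreal" where
  "time_before s w = emeasure (jumps w) (marks_before s w)"

lemma countable_pairs: "countable (A :: ('s \<times> nat) set)"
  by (rule countable_subset[OF subset_UNIV]) (metis UNIV_Times_UNIV countable_SIGMA countableI_type countable_states)

lemma sets_jumps [simp]: "A \<in> sets (jumps w)"
  by (simp add: jumps_def)

lemma space_jumps [simp]: "space (jumps w) = UNIV"
  by (simp add: jumps_def)

lemma emeasure_jumps:
  "emeasure (jumps w) A =
     (\<integral>\<^sup>+p. ennreal (jump p w) * indicator A p \<partial>count_space UNIV)"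
  by (simp add: jumps_def emeasure_density)

lemma emeasure_jumps_singleton:
  "emeasure (jumps w) {p} = ennreal (jump p w)"
  by (simp add: emeasure_jumps nn_integral_count_space'[where A = "{p}"])

lemma clock_eq:
  assumes "w \<in> space M"
  shows "clock \<gamma> \<sigma> T0 T y w s = ennreal (ext_gamma \<gamma> y * T0 w) + time_upto s w"
proof -
  have "(\<Sum>i=1..mark_count (\<sigma> z) s w. ennreal (\<gamma> z * T z i w)) =
    (\<integral>\<^sup>+i. ennreal (\<gamma> z * T z i w) * indicator (marks_upto s w) (z, i) \<partial>count_space UNIV)" for z
    by (subst nn_integral_count_space'[where A = "{1..mark_count (\<sigma> z) s w}"])
       (auto simp: indicator_def marks_upto_def marks_def mark_def mark_le_iff[OF assms] intro!: sum.cong)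
  then have "(\<Sum>\<^sub>\<infinity>z. \<Sum>i=1..mark_count (\<sigma> z) s w. ennreal (\<gamma> z * T z i w)) = time_upto s w"
    by (simp add: ennreal_infsum_eq_nn_integral[OF countable_states] nn_integral_fst_count_space
        time_upto_def emeasure_jumps
        nn_integral_fst_count_space[where f = "\<lambda>p. ennreal (jump p w) * indicator (marks_upto s w) p", simplified])
  then show ?thesis by (simp add: clock_def)
qed

lemma clock_left_eq:
  assumes "w \<in> space M"
  shows "clock_left \<gamma> \<sigma> T0 T y w s = ennreal (ext_gamma \<gamma> y * T0 w) + time_before s w"
proof -
  have "((\<lambda>r. time_upto r w) \<longlongrightarrow> time_before s w) (at_left s)"
  proof (rule tendsto_at_left_sequentially[of "s - 1"])
    fix S :: "nat \<Rightarrow> real"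
    assume S: "\<And>n. S n < s" "incseq S" "S \<longlonglongrightarrow> s"
    have "(\<Union>n. marks_upto (S n) w) = marks_before s w"
    proof safe
      fix z i assume "(z, i) \<in> marks_before s w"
      then have m: "(z, i) \<in> marks" "mark (z, i) w < s" by (auto simp: marks_before_def)
      obtain n where "mark (z, i) w < S n"
        using order_tendstoD(1)[OF S(3) m(2)] by (auto simp: eventually_sequentially)
      then show "(z, i) \<in> (\<Union>n. marks_upto (S n) w)" using m by (auto simp: marks_upto_def intro!: exI[of _ n])
    qed (use S(1) in \<open>auto simp: marks_upto_def marks_before_def intro: le_less_trans\<close>)
    moreover have "incseq (\<lambda>n. marks_upto (S n) w)"
      using S(2) by (auto simp: incseq_def marks_upto_def intro: order_trans)
    ultimately show "(\<lambda>n. time_upto (S n) w) \<longlonglongrightarrow> time_before s w"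
      using Lim_emeasure_incseq[of "\<lambda>n. marks_upto (S n) w" "jumps w"]
      by (simp add: time_upto_def time_before_def image_subset_iff)
  qed simp
  then have "((\<lambda>r. ennreal (ext_gamma \<gamma> y * T0 w) + time_upto r w) \<longlongrightarrow>
      ennreal (ext_gamma \<gamma> y * T0 w) + time_before s w) (at_left s)"
    by (intro tendsto_add tendsto_const)
  then show ?thesis
    unfolding clock_left_def clock_eq[OF assms] by (intro tendsto_Lim) simp_all
qed

text \<open>
  The condition \<open>0 \<le> t\<close> is there because \<^const>\<open>ennreal\<close> sends negative times to \<open>0\<close>.
\<close>
definition visit :: "'s \<times> nat \<Rightarrow> 'w \<Rightarrow> real set" where
  "visit p w = {t. 0 \<le> t \<and> time_before (mark p w) w \<le> ennreal t \<and> ennreal t < time_upto (mark p w) w}"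

definition visit_duration :: "'s \<times> nat \<Rightarrow> real \<Rightarrow> 'w \<Rightarrow> ennreal" where
  "visit_duration p t w = (\<integral>\<^sup>+r. indicator {0..t} r * indicator (visit p w) r \<partial>lborel)"

text \<open>
  Two marks coincide only on a null event. Outside it, each mark contributes a single jump of the
  clock, and the visits are disjoint.
\<close>
definition regular :: "'w \<Rightarrow> bool" where
  "regular w \<longleftrightarrow> w \<in> space M \<and> inj_on (\<lambda>p. mark p w) marks"

lemma time_upto_mark:
  assumes "regular w" "p \<in> marks"
  shows "time_upto (mark p w) w =
    time_before (mark p w) w + ennreal (jump p w)"
proof -
  have "marks_upto (mark p w) w = marks_before (mark p w) w \<union> {p}"
    using assms by (auto simp: marks_upto_def marks_before_def regular_def less_le dest: inj_onD)
  moreover have "p \<notin> marks_before (mark p w) w" by (simp add: marks_before_def)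
  ultimately show ?thesis
    unfolding time_upto_def time_before_def
    by (simp add: plus_emeasure[symmetric] emeasure_jumps_singleton del: Un_insert_right)
qed

lemma time_upto_mono: "s \<le> s' \<Longrightarrow> time_upto s w \<le> time_upto s' w"
  unfolding time_upto_def by (intro emeasure_mono) (auto simp: marks_upto_def)

lemma time_upto_le_before: "s < s' \<Longrightarrow> time_upto s w \<le> time_before s' w"
  unfolding time_upto_def time_before_def
  by (intro emeasure_mono) (auto simp: marks_upto_def marks_before_def)

lemma time_before_le_upto: "time_before s w \<le> time_upto s w"
  unfolding time_upto_def time_before_def
  by (intro emeasure_mono) (auto simp: marks_upto_def marks_before_def)

lemma disjoint_visits:
  assumes "regular w"
  shows "disjoint_family_on (\<lambda>p. visit p w) marks"
proof -
  have "visit p w \<inter> visit q w = {}" if "mark p w < mark q w" for p q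
    using time_upto_le_before[OF that, of w] by (auto simp: visit_def)
  then have "visit p w \<inter> visit q w = {}" if "p \<in> marks" "q \<in> marks" "p \<noteq> q" for p q
    using assms that
    by (metis Int_commute inj_onD linorder_neqE_linordered_idom regular_def)
  then show ?thesis by (simp add: disjoint_family_on_def)
qed

lemma emeasure_visit:
  assumes "regular w" "p \<in> marks" "time_before (mark p w) w < \<infinity>"
  shows "emeasure lborel (visit p w) = ennreal (jump p w)"
    and "visit p w \<in> sets borel"
proof -
  define l where "l = max 0 (jump p w)"
  obtain a where a: "time_before (mark p w) w = ennreal a" "0 \<le> a"
    using assms(3) by (cases "time_before (mark p w) w") auto
  have l: "ennreal (jump p w) = ennreal l" "l \<ge> 0"
    by (auto simp: l_def max_def ennreal_neg)
  have "visit p w = {a..<a + l}"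
    using a l(2) by (auto simp: visit_def time_upto_mark[OF assms(1,2)] l(1) ennreal_less_iff simp flip: ennreal_plus)
  then show "emeasure lborel (visit p w) = ennreal (jump p w)"
    "visit p w \<in> sets borel"
    using l by simp_all
qed

text \<open>
  The clock increases by jumps only: the visits up to local time \<open>s\<close> are disjoint intervals in
  \<open>[0, time_upto s)\<close>, and their lengths add up to the length of this interval. Hence almost every
  time belongs to a visit.
\<close>
lemma visits_cover:
  assumes w: "regular w" and fin: "time_upto s w < \<infinity>" and t: "0 \<le> t" "ennreal t < time_upto s w"
  shows "(\<integral>\<^sup>+p. visit_duration p t w \<partial>count_space marks) = ennreal t"
proof -
  define Q where "Q = marks_upto s w"
  define U where "U = (\<Union>p\<in>Q. visit p w)"
  obtain b where b: "time_upto s w = ennreal b" "0 \<le> b"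
    using fin by (cases "time_upto s w") auto
  have finp: "time_before (mark p w) w < \<infinity>" if "p \<in> Q" for p
    using time_before_le_upto[of "mark p w" w] time_upto_mono[of "mark p w" s w] fin that
    by (auto simp: Q_def marks_upto_def)
  have QM: "Q \<subseteq> marks" by (auto simp: Q_def marks_upto_def)
  have sets: "visit p w \<in> sets lborel" if "p \<in> Q" for p
    using emeasure_visit(2)[OF w, of p] finp[OF that] that QM by auto
  have "emeasure lborel U = (\<integral>\<^sup>+p. emeasure lborel (visit p w) \<partial>count_space Q)"
    unfolding U_def using disjoint_family_on_mono[OF QM disjoint_visits[OF w]]
    by (intro emeasure_UN_countable countable_pairs sets) auto
  also have "\<dots> = (\<integral>\<^sup>+p. ennreal (jump p w) \<partial>count_space Q)"
    using emeasure_visit(1)[OF w] finp QM by (intro nn_integral_cong) auto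
  also have "\<dots> = ennreal b"
    by (simp add: b(1)[symmetric] time_upto_def emeasure_jumps Q_def nn_integral_count_space_indicator)
  finally have eU: "emeasure lborel U = ennreal b" .
  have UR: "U \<subseteq> {0..<b}"
  proof
    fix r assume "r \<in> U"
    then obtain p where p: "p \<in> Q" "r \<in> visit p w" by (auto simp: U_def)
    then have "ennreal r < time_upto s w"
      using time_upto_mono[of "mark p w" s w] by (auto simp: visit_def Q_def marks_upto_def)
    then show "r \<in> {0..<b}" using p b by (auto simp: visit_def ennreal_less_iff)
  qed
  have Us: "U \<in> sets lborel" unfolding U_def by (intro sets.countable_UN'' countable_pairs sets)
  have null: "emeasure lborel ({0..<b} - U) = 0"
    using UR Us b eU by (subst emeasure_Diff) auto
  have tb: "{0..t} \<subseteq> {0..<b}" using t b by (auto simp: ennreal_less_iff)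
  have "emeasure lborel ({0..t} - U) \<le> emeasure lborel ({0..<b} - U)"
    using Us tb by (intro emeasure_mono) auto
  then have null: "emeasure lborel ({0..t} - U) = 0" using null by simp
  have late: "visit p w \<inter> {0..t} = {}" if "p \<in> marks" "p \<notin> Q" for p
  proof -
    have "time_upto s w \<le> time_before (mark p w) w"
      using that by (intro time_upto_le_before) (auto simp: Q_def marks_upto_def)
    then show ?thesis using t(2)
      by (auto simp: visit_def) (meson ennreal_leI not_le order_trans)
  qed
  have "ennreal t = emeasure lborel {0..t}" using t by simp
  also have "\<dots> = emeasure lborel ({0..t} \<inter> U) + emeasure lborel ({0..t} - U)"
    using Us by (subst plus_emeasure) (auto simp: Int_Diff_Un)
  also have "\<dots> = emeasure lborel ({0..t} \<inter> U)" by (simp add: null)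
  also have "{0..t} \<inter> U = (\<Union>p\<in>Q. visit p w \<inter> {0..t})" by (auto simp: U_def)
  also have "emeasure lborel \<dots> = (\<integral>\<^sup>+p. emeasure lborel (visit p w \<inter> {0..t}) \<partial>count_space Q)"
  proof (intro emeasure_UN_countable countable_pairs)
    show "disjoint_family_on (\<lambda>p. visit p w \<inter> {0..t}) Q"
      using disjoint_family_on_mono[OF QM disjoint_visits[OF w]]
      unfolding disjoint_family_on_def by blast
  qed (use sets in auto)
  also have "\<dots> = (\<integral>\<^sup>+p. emeasure lborel (visit p w \<inter> {0..t}) \<partial>count_space marks)"
    using QM late by (auto simp: nn_integral_count_space_indicator indicator_def intro!: nn_integral_cong)
  also have "\<dots> = (\<integral>\<^sup>+p. visit_duration p t w \<partial>count_space marks)"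
  proof (intro nn_integral_cong)
    fix p assume "p \<in> space (count_space marks)"
    then have p: "p \<in> marks" by simp
    have "visit p w \<inter> {0..t} \<in> sets lborel"
    proof (cases "p \<in> Q")
      case True then show ?thesis using sets by auto
    next
      case False then show ?thesis using late[OF p] by simp
    qed
    then show "emeasure lborel (visit p w \<inter> {0..t}) = visit_duration p t w"
      unfolding visit_duration_def
      by (subst indicator_inter_arith[symmetric], subst Int_commute) (rule nn_integral_indicator[symmetric])
  qed
  finally show ?thesis ..
qed

end

section \<open>Independence and the laws of the inputs\<close>

lemma borel_measurable_nn_integral_count_space:
  fixes f :: "'i \<Rightarrow> 'a \<Rightarrow> ennreal"
  assumes "countable I" and [measurable]: "\<And>i. i \<in> I \<Longrightarrow> f i \<in> borel_measurable N"
  shows "(\<lambda>x. \<integral>\<^sup>+i. f i x \<partial>count_space I) \<in> borel_measurable N"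
proof (cases "finite I")
  case True then show ?thesis by (simp add: nn_integral_count_space_finite)
next
  case False
  then have [simp]: "I \<noteq> {}" by auto
  note * = bij_betw_from_nat_into[OF \<open>countable I\<close> False]
  have "(\<lambda>x. \<integral>\<^sup>+i. f i x \<partial>count_space I) = (\<lambda>x. \<Sum>n. f (from_nat_into I n) x)"
    by (simp add: nn_integral_bij_count_space[symmetric, OF *] nn_integral_count_space_nat)
  then show ?thesis by (simp add: from_nat_into)
qed

lemma Int_stable_preimages: "Int_stable {X -` A \<inter> S |A. A \<in> sets N}"
proof (rule Int_stableI)
  fix a b assume "a \<in> {X -` A \<inter> S |A. A \<in> sets N}" "b \<in> {X -` A \<inter> S |A. A \<in> sets N}"
  then obtain A B where *: "A \<in> sets N" "B \<in> sets N" "a = X -` A \<inter> S" "b = X -` B \<inter> S"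
    by (elim CollectE exE conjE) rule
  then have "a \<inter> b = X -` (A \<inter> B) \<inter> S" by auto
  with * show "a \<inter> b \<in> {X -` A \<inter> S |A. A \<in> sets N}"
    by (intro CollectI exI[of _ "A \<inter> B"] conjI sets.Int)
qed

lemma erlang_density_eq_poisson:
  assumes "0 < l" "0 < r"
  shows "erlang_density n l r = l * pmf (poisson_pmf (l * r)) n"
  using assms by (simp add: erlang_density_def power_mult_distrib)

lemma suminf_erlang_density:
  assumes "0 < l" "0 < r"
  shows "(\<Sum>n. ennreal (erlang_density n l r)) = ennreal l"
proof -
  have "(\<Sum>n. ennreal (erlang_density n l r)) = ennreal l * (\<Sum>n. ennreal (pmf (poisson_pmf (l * r)) n))"
    using assms
    by (subst ennreal_suminf_cmult[symmetric])
       (simp add: erlang_density_eq_poisson ennreal_mult less_imp_le del: pmf_poisson)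
  also have "(\<Sum>n. ennreal (pmf (poisson_pmf (l * r)) n)) = (\<integral>\<^sup>+n. pmf (poisson_pmf (l * r)) n \<partial>count_space UNIV)"
    by (simp add: nn_integral_count_space_nat)
  also have "\<dots> = 1" by (rule nn_integral_pmf_eq_1)
  finally show ?thesis by simp
qed

context K_process_data
begin

definition sources :: "'s source set" where
  "sources = range Marks \<union> {Initial} \<union> {Stay x n | x n. 1 \<le> n}"

definition info :: "'s source set \<Rightarrow> 'w measure" where
  "info J = sigma (space M) (\<Union>j\<in>J. source_sets M \<sigma> T0 T j)"

lemma source_sets_events: "j \<in> sources \<Longrightarrow> source_sets M \<sigma> T0 T j \<subseteq> events"
  using independent unfolding indep_sets_def sources_def by blast

lemma source_sets_Pow:
  assumes "J \<subseteq> sources" shows "(\<Union>j\<in>J. source_sets M \<sigma> T0 T j) \<subseteq> Pow (space M)"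
  using source_sets_events assms sets.space_closed[of M] by blast

lemma space_info [simp]: "space (info J) = space M"
  by (simp add: info_def space_measure_of_conv)

lemma sets_info: "J \<subseteq> sources \<Longrightarrow> sets (info J) = sigma_sets (space M) (\<Union>j\<in>J. source_sets M \<sigma> T0 T j)"
  unfolding info_def using source_sets_Pow by (rule sets_measure_of)

lemma sets_info_subset: "J \<subseteq> sources \<Longrightarrow> sets (info J) \<subseteq> events"
  unfolding sets_info using source_sets_events by (intro sets.sigma_sets_subset) blast

lemma measurable_info: "J \<subseteq> sources \<Longrightarrow> f \<in> measurable (info J) N \<Longrightarrow> f \<in> measurable M N"
  using sets_info_subset[of J] by (auto simp: measurable_def)

lemma id_measurable_info: "J \<subseteq> sources \<Longrightarrow> (\<lambda>w. w) \<in> measurable M (info J)"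
  by (rule measurable_info[of J]) auto

lemma source_sets_info:
  assumes "j \<in> J" "J \<subseteq> sources" "A \<in> source_sets M \<sigma> T0 T j"
  shows "A \<in> sets (info J)"
  unfolding sets_info[OF assms(2)] using assms by blast

lemma Int_stable_source_sets: "Int_stable (source_sets M \<sigma> T0 T j)"
proof (cases j)
  case (Marks x)
  let ?S = "{mark_count (\<sigma> x) t -` A \<inter> space M | t A. 0 \<le> t}"
  interpret S: sigma_algebra "space M" "sigma_sets (space M) ?S"
    by (rule sigma_algebra_sigma_sets) auto
  show ?thesis unfolding Marks source_sets.simps by (rule Int_stableI) (rule S.Int)
qed (simp_all only: source_sets.simps Int_stable_preimages)

text \<open>
  A whole group of inputs is treated as one random variable, namely the identity map into the
  sigma-algebra that the group generates.
\<close>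
lemma indep_info:
  assumes I: "I \<subseteq> sources" and J: "J \<subseteq> sources" and disj: "I \<inter> J = {}"
  shows "indep_var (info I) (\<lambda>w. w) (info J) (\<lambda>w. w)"
proof -
  have "indep_sets (\<lambda>b. sigma_sets (space M) (\<Union>i\<in>case_bool I J b. source_sets M \<sigma> T0 T i)) (UNIV :: bool set)"
  proof (rule indep_sets_collect_sigma)
    have "(\<Union>j\<in>UNIV. case_bool I J j) \<subseteq> sources"
      using I J by (simp add: UNIV_bool)
    then show "indep_sets (source_sets M \<sigma> T0 T) (\<Union>j\<in>UNIV. case_bool I J j)"
      unfolding sources_def using independent by (rule indep_sets_mono_index)
    show "disjoint_family_on (case_bool I J) (UNIV :: bool set)"
      using disj unfolding disjoint_family_on_def UNIV_bool by auto
  qed (rule Int_stable_source_sets)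
  moreover have "(\<lambda>b. sigma_sets (space M) (\<Union>i\<in>case_bool I J b. source_sets M \<sigma> T0 T i)) =
      case_bool (sets (info I)) (sets (info J))"
    unfolding sets_info[OF I] sets_info[OF J] by (rule ext) (simp split: bool.split)
  ultimately have ind: "indep_set (sets (info I)) (sets (info J))"
    unfolding indep_set_def by (simp only:)
  have preimages: "sigma_sets (space M) {(\<lambda>w. w) -` A \<inter> space M |A. A \<in> sets (info K)} = sets (info K)" for K
  proof -
    have "(\<lambda>A. (\<lambda>w. w) -` A \<inter> space M) ` sets (info K) = (\<lambda>A. A) ` sets (info K)"
    proof (rule image_cong[OF refl])
      fix A assume "A \<in> sets (info K)"
      then have "A \<subseteq> space M" using sets.sets_into_space[of A "info K"] by (simp only: space_info)
      then show "(\<lambda>w. w) -` A \<inter> space M = A" by blast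
    qed
    then have "{(\<lambda>w. w) -` A \<inter> space M |A. A \<in> sets (info K)} = sets (info K)"
      unfolding setcompr_eq_image image_ident Collect_mem_eq .
    then show ?thesis using sets.sigma_sets_eq[of "info K"] by (simp only: space_info)
  qed
  show ?thesis
    unfolding indep_var_eq preimages by (intro conjI id_measurable_info I J ind)
qed

lemma distr_diagonal:
  assumes "I \<subseteq> sources" "J \<subseteq> sources" "I \<inter> J = {}"
  shows "distr M (info I) (\<lambda>w. w) \<Otimes>\<^sub>M distr M (info J) (\<lambda>w. w) =
     distr M (info I \<Otimes>\<^sub>M info J) (\<lambda>w. (w, w))"
  using indep_info[OF assms] unfolding indep_var_distribution_eq by (elim conjE)

lemma diagonal_measurable:
  assumes "I \<subseteq> sources" "J \<subseteq> sources"
  shows "(\<lambda>w. (w, w)) \<in> measurable M (info I \<Otimes>\<^sub>M info J)"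
  using id_measurable_info[OF assms(1)] id_measurable_info[OF assms(2)] by (rule measurable_Pair)

text \<open>
  Independence of two disjoint groups of inputs: in an expectation, the outcome seen by one of them
  may be replaced by an independent copy.
\<close>
lemma nn_integral_decouple:
  assumes I: "I \<subseteq> sources" and J: "J \<subseteq> sources" and disj: "I \<inter> J = {}"
    and F: "(\<lambda>(w, w'). F w w') \<in> borel_measurable (info I \<Otimes>\<^sub>M info J)"
  shows "(\<integral>\<^sup>+w. F w w \<partial>M) = (\<integral>\<^sup>+w. (\<integral>\<^sup>+w'. F w w' \<partial>M) \<partial>M)"
proof -
  let ?I = "distr M (info I) (\<lambda>w. w)" and ?J = "distr M (info J) (\<lambda>w. w)"
  interpret J: prob_space ?J
    using id_measurable_info[OF J] by (rule prob_space_distr)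
  have [measurable]: "(\<lambda>w. w) \<in> measurable M (info I)" "(\<lambda>w. w) \<in> measurable M (info J)"
    using id_measurable_info I J by auto
  note [measurable] = F
  have "(\<integral>\<^sup>+w. F w w \<partial>M) = (\<integral>\<^sup>+z. (case z of (w, w') \<Rightarrow> F w w') \<partial>distr M (info I \<Otimes>\<^sub>M info J) (\<lambda>w. (w, w)))"
    using diagonal_measurable[OF I J] F by (subst nn_integral_distr) auto
  also have "\<dots> = (\<integral>\<^sup>+z. (case z of (w, w') \<Rightarrow> F w w') \<partial>(?I \<Otimes>\<^sub>M ?J))"
    by (simp add: distr_diagonal[OF I J disj])
  also have "\<dots> = (\<integral>\<^sup>+w. (\<integral>\<^sup>+w'. F w w' \<partial>?J) \<partial>?I)"
    using F by (subst J.nn_integral_fst[symmetric]) (auto cong: measurable_cong_sets sets_pair_measure_cong)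
  also have "\<dots> = (\<integral>\<^sup>+w. (\<integral>\<^sup>+w'. F w w' \<partial>?J) \<partial>M)"
  proof (rule nn_integral_distr[OF id_measurable_info[OF I]])
    show "(\<lambda>w. \<integral>\<^sup>+w'. F w w' \<partial>?J) \<in> borel_measurable (?I)"
      using J.borel_measurable_nn_integral_fst[of "\<lambda>(w, w'). F w w'" "info I"] F
      by (simp cong: measurable_cong_sets sets_pair_measure_cong)
  qed
  also have "\<dots> = (\<integral>\<^sup>+w. (\<integral>\<^sup>+w'. F w w' \<partial>M) \<partial>M)"
  proof (intro nn_integral_cong)
    fix w assume w: "w \<in> space M"
    have "F w \<in> borel_measurable (info J)"
      using measurable_Pair2[OF F, of w] w by simp
    then show "(\<integral>\<^sup>+w'. F w w' \<partial>?J) = (\<integral>\<^sup>+w'. F w w' \<partial>M)"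
      by (subst nn_integral_distr) auto
  qed
  finally show ?thesis .
qed

lemma Marks_in_sources [simp]: "Marks x \<in> sources"
  and Initial_in_sources [simp]: "Initial \<in> sources"
  and Stay_in_sources [simp]: "Stay x n \<in> sources \<longleftrightarrow> 1 \<le> n"
  by (auto simp: sources_def)

lemma mark_count_measurable_info:
  assumes "Marks x \<in> J" "J \<subseteq> sources" "0 \<le> t"
  shows "mark_count (\<sigma> x) t \<in> measurable (info J) (count_space UNIV)"
proof (rule measurableI)
  fix A :: "nat set"
  have "mark_count (\<sigma> x) t -` A \<inter> space M \<in> source_sets M \<sigma> T0 T (Marks x)"
    using assms(3) by auto
  then show "mark_count (\<sigma> x) t -` A \<inter> space (info J) \<in> sets (info J)"
    using source_sets_info[OF assms(1,2)] by simp
qed simp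

lemma mark_measurable_info:
  assumes "Marks (fst p) \<in> J" "J \<subseteq> sources" "p \<in> marks"
  shows "mark p \<in> borel_measurable (info J)"
  unfolding borel_measurable_iff_le
proof
  fix a :: real
  have i: "1 \<le> snd p" using assms(3) by (simp add: marks_def)
  show "{w \<in> space (info J). mark p w \<le> a} \<in> sets (info J)"
  proof (cases "a \<ge> 0")
    case True
    have "{w \<in> space (info J). mark p w \<le> a} = mark_count (\<sigma> (fst p)) a -` {snd p..} \<inter> space (info J)"
      using mark_le_iff[OF _ i] by (auto simp: mark_def)
    also have "\<dots> \<in> sets (info J)"
      using mark_count_measurable_info[OF assms(1,2) True] by (rule measurable_sets) simp
    finally show ?thesis .
  next
    case False
    have "{w \<in> space (info J). mark p w \<le> a} = {}"
      using mark_pos[OF _ i, of _ "fst p"] False by (force simp: mark_def)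
    then show ?thesis by (simp only: sets.empty_sets)
  qed
qed

lemma T_measurable_info:
  assumes "Stay x n \<in> J" "J \<subseteq> sources"
  shows "T x n \<in> borel_measurable (info J)"
  by (rule measurableI) (auto intro!: source_sets_info[OF assms], blast)

lemma T0_measurable_info:
  assumes "Initial \<in> J" "J \<subseteq> sources"
  shows "T0 \<in> borel_measurable (info J)"
  by (rule measurableI) (auto intro!: source_sets_info[OF assms], blast)

lemma mark_measurable [measurable]: "p \<in> marks \<Longrightarrow> mark p \<in> borel_measurable M"
  using mark_measurable_info[of p sources] measurable_info[of sources] by simp

lemma T_measurable: "1 \<le> n \<Longrightarrow> T x n \<in> borel_measurable M"
  using T_measurable_info[of x n sources] measurable_info[of sources] by simp

lemma T0_measurable [measurable]: "T0 \<in> borel_measurable M"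
  using T0_measurable_info[of sources] measurable_info[of sources] by simp

lemma emeasure_mark_count_eq:
  assumes "0 < s"
  shows "emeasure M {w \<in> space M. mark_count (\<sigma> x) s w = n} = ennreal (pmf (poisson_pmf (lam x * s)) n)"
proof -
  have [measurable]: "mark_count (\<sigma> x) t \<in> measurable M (count_space UNIV)" if "0 \<le> t" for t
    using poisson[of x] that by (auto simp: poisson_process_def)
  have zero: "mark_count (\<sigma> x) 0 w = 0" if w: "w \<in> space M" for w
  proof -
    have "{i. 1 \<le> i \<and> \<sigma> x i w \<le> 0} = {}"
      using mark_pos[OF w, of _ x] by (auto simp: not_le[symmetric])
    then show ?thesis unfolding mark_count_def by (simp only: card.empty)
  qed
  have "distr M (count_space UNIV) (\<lambda>w. mark_count (\<sigma> x) s w - mark_count (\<sigma> x) 0 w)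
      = measure_pmf (poisson_pmf (lam x * (s - 0)))"
    using poisson[of x] assms unfolding poisson_process_def by blast
  then have "ennreal (pmf (poisson_pmf (lam x * s)) n) =
      emeasure (distr M (count_space UNIV) (\<lambda>w. mark_count (\<sigma> x) s w - mark_count (\<sigma> x) 0 w)) {n}"
    by (simp add: emeasure_pmf_single)
  also have "\<dots> = emeasure M ((\<lambda>w. mark_count (\<sigma> x) s w - mark_count (\<sigma> x) 0 w) -` {n} \<inter> space M)"
    using assms by (subst emeasure_distr) auto
  also have "(\<lambda>w. mark_count (\<sigma> x) s w - mark_count (\<sigma> x) 0 w) -` {n} \<inter> space M =
      {w \<in> space M. mark_count (\<sigma> x) s w = n}"
    using zero by auto
  finally show ?thesis ..
qed

text \<open>
  The first \<open>n + 1\<close> marks lie in \<open>[0, a]\<close> exactly if the number of marks there exceeds \<open>n\<close>.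
\<close>
lemma mark_distributed:
  "distributed M lborel (mark (x, Suc n)) (erlang_density n (lam x))"
proof (rule erlang_distributedI)
  show "mark (x, Suc n) \<in> borel_measurable M" by (rule mark_measurable) (simp add: marks_def)
  show "0 < lam x" by (rule lam_pos)
  fix a :: real assume a: "0 \<le> a"
  show "emeasure M {w \<in> space M. mark (x, Suc n) w \<le> a} = ennreal (erlang_CDF n (lam x) a)"
  proof (cases "a = 0")
    case True
    have "{w \<in> space M. mark (x, Suc n) w \<le> 0} = {}"
      using mark_pos[of _ "Suc n" x] by (force simp: mark_def)
    then show ?thesis by (simp only: True erlang_CDF_at0 emeasure_empty ennreal_0)
  next
    case False
    then have a: "0 < a" using a by simp
    have meas: "mark_count (\<sigma> x) a \<in> measurable M (count_space UNIV)"
      using poisson[of x] a by (auto simp: poisson_process_def)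
    have p: "prob {w \<in> space M. mark_count (\<sigma> x) a w = k} = pmf (poisson_pmf (lam x * a)) k" for k
      using emeasure_mark_count_eq[OF a, of x k] by (simp add: emeasure_eq_measure del: poisson_pmf.rep_eq)
    have ev: "{w \<in> space M. mark_count (\<sigma> x) a w \<in> K} \<in> events" for K
      using measurable_sets[OF meas, of K] by (simp add: vimage_def Int_def conj_commute)
    have "{w \<in> space M. mark (x, Suc n) w \<le> a} = space M - {w \<in> space M. mark_count (\<sigma> x) a w \<in> {..n}}"
      using mark_le_iff[of _ "Suc n" x a] by (auto simp: mark_def)
    then have "prob {w \<in> space M. mark (x, Suc n) w \<le> a} = 1 - prob {w \<in> space M. mark_count (\<sigma> x) a w \<in> {..n}}"
      using ev by (simp only: prob_compl)
    also have "{w \<in> space M. mark_count (\<sigma> x) a w \<in> {..n}} = (\<Union>k\<in>{..n}. {w \<in> space M. mark_count (\<sigma> x) a w = k})"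
      by auto
    also have "prob \<dots> = (\<Sum>k\<le>n. prob {w \<in> space M. mark_count (\<sigma> x) a w = k})"
      using ev[of "{_}"] by (intro finite_measure_finite_Union) (auto simp: disjoint_family_on_def)
    also have "1 - \<dots> = erlang_CDF n (lam x) a"
      using a lam_pos[of x] by (simp add: p erlang_CDF_def)
    finally show ?thesis by (simp add: emeasure_eq_measure)
  qed
qed

text \<open>
  Marks of the same process increase strictly; marks of two processes are independent with densities.
\<close>
lemma AE_regular: "AE w in M. regular w"
proof -
  have "AE w in M. p \<noteq> q \<longrightarrow> mark p w \<noteq> mark q w" if pq: "p \<in> marks" "q \<in> marks" for p q
  proof (cases "fst p = fst q")
    case True
    have "mark p w \<noteq> mark q w" if "p \<noteq> q" "w \<in> space M" for w
    proof -
      have "snd p \<noteq> snd q" using that True by (auto simp: prod_eq_iff)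
      moreover have "1 \<le> snd p" "1 \<le> snd q" using pq by (auto simp: marks_def)
      ultimately show ?thesis
        using True mark_increasing[OF that(2), of "snd p" "snd q" "fst p"]
          mark_increasing[OF that(2), of "snd q" "snd p" "fst p"]
        by (cases "snd p < snd q") (auto simp: mark_def)
    qed
    then show ?thesis by (intro AE_I2) auto
  next
    case False
    let ?P = "{Marks (fst p)}" and ?Q = "{Marks (fst q)}"
    have [measurable]: "mark p \<in> borel_measurable (info ?P)" "mark q \<in> borel_measurable (info ?Q)"
      using pq by (auto intro!: mark_measurable_info)
    have "(\<integral>\<^sup>+w. of_bool (mark q w = mark p w) \<partial>M) =
      (\<integral>\<^sup>+w. (\<integral>\<^sup>+w'. of_bool (mark q w = mark p w') \<partial>M) \<partial>M)"
      using False by (intro nn_integral_decouple[of ?Q ?P]) auto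
    also have "\<dots> = (\<integral>\<^sup>+w. 0 \<partial>M)"
    proof (rule nn_integral_cong)
      fix w
      obtain x n where p: "p = (x, Suc n)"
        using pq(1) by (cases p; cases "snd p") (auto simp: marks_def)
      have "(\<integral>\<^sup>+w'. of_bool (mark q w = mark p w') \<partial>M) =
          (\<integral>\<^sup>+r. ennreal (erlang_density n (lam x) r) * of_bool (mark q w = r) \<partial>lborel)"
        unfolding p by (rule distributed_nn_integral[OF mark_distributed, symmetric]) simp
      also have "\<dots> = (\<integral>\<^sup>+r. 0 \<partial>(lborel :: real measure))"
        by (intro nn_integral_cong_AE eventually_mono[OF AE_lborel_singleton[of "mark q w"]]) auto
      finally show "(\<integral>\<^sup>+w'. of_bool (mark q w = mark p w') \<partial>M) = 0" by simp
    qed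
    finally have "(\<integral>\<^sup>+w. of_bool (mark q w = mark p w) \<partial>M) = 0" by simp
    then have "AE w in M. of_bool (mark q w = mark p w) = (0 :: ennreal)"
      using pq by (subst (asm) nn_integral_0_iff_AE) auto
    then show ?thesis by eventually_elim auto
  qed
  then have "AE w in M. \<forall>p\<in>marks. \<forall>q\<in>marks. p \<noteq> q \<longrightarrow> mark p w \<noteq> mark q w"
    by (simp add: AE_ball_countable countable_pairs)
  then show ?thesis
    using AE_space by eventually_elim (auto simp: regular_def inj_on_def)
qed

lemma nn_integral_marks:
  "(\<integral>\<^sup>+p. f p \<partial>count_space marks) = (\<integral>\<^sup>+x. (\<Sum>n. f (x, Suc n)) \<partial>count_space UNIV)"
proof -
  have bij: "bij_betw Suc UNIV {1..}"
    by (auto simp: bij_betw_def image_iff) (metis Suc_le_D)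
  have "(\<integral>\<^sup>+p. f p \<partial>count_space marks) = (\<integral>\<^sup>+p. f p * indicator marks p \<partial>count_space UNIV)"
    by (simp add: nn_integral_count_space_indicator)
  also have "\<dots> = (\<integral>\<^sup>+x. (\<integral>\<^sup>+i. f (x, i) * indicator marks (x, i) \<partial>count_space UNIV) \<partial>count_space UNIV)"
    by (rule nn_integral_fst_count_space[symmetric])
  also have "\<dots> = (\<integral>\<^sup>+x. (\<Sum>n. f (x, Suc n)) \<partial>count_space UNIV)"
  proof (rule nn_integral_cong)
    fix x
    have "(\<integral>\<^sup>+i. f (x, i) * indicator marks (x, i) \<partial>count_space UNIV) = (\<integral>\<^sup>+i. f (x, i) \<partial>count_space {1..})"
      by (auto simp: nn_integral_count_space_indicator marks_def indicator_def intro!: nn_integral_cong)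
    also have "\<dots> = (\<Sum>n. f (x, Suc n))"
      unfolding nn_integral_bij_count_space[OF bij, symmetric] nn_integral_count_space_nat ..
    finally show "(\<integral>\<^sup>+i. f (x, i) * indicator marks (x, i) \<partial>count_space UNIV) = (\<Sum>n. f (x, Suc n))" .
  qed
  finally show ?thesis .
qed

lemma time_upto_eq:
  "time_upto s w = (\<integral>\<^sup>+p. ennreal (jump p w) * of_bool (mark p w \<le> s) \<partial>count_space marks)"
proof -
  have "indicator (marks_upto s w) p = (of_bool (mark p w \<le> s) * indicator marks p :: ennreal)" for p
    by (auto simp: marks_upto_def indicator_def)
  then show ?thesis
    unfolding time_upto_def emeasure_jumps by (simp add: nn_integral_count_space_indicator mult.assoc)
qed

lemma time_before_eq:
  "time_before s w = (\<integral>\<^sup>+p. ennreal (jump p w) * of_bool (mark p w < s) \<partial>count_space marks)"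
proof -
  have "indicator (marks_before s w) p = (of_bool (mark p w < s) * indicator marks p :: ennreal)" for p
    by (auto simp: marks_before_def indicator_def)
  then show ?thesis
    unfolding time_before_def emeasure_jumps by (simp add: nn_integral_count_space_indicator mult.assoc)
qed

text \<open>
  The expected clock at \<open>s\<close> is \<open>s\<close> times the finite sum of \<open>lam x * \<gamma> x\<close>, because the Erlang
  densities of the marks of \<open>x\<close> add up to \<open>lam x\<close>.
\<close>
lemma AE_time_upto_finite: "AE w in M. \<forall>s. time_upto s w < \<infinity>"
proof -
  have fin: "AE w in M. time_upto s w \<noteq> \<infinity>" if "0 \<le> s" for s
  proof -
    let ?L = "\<lambda>x n. \<integral>\<^sup>+r. ennreal (erlang_density n (lam x) r) * of_bool (r \<le> s) \<partial>lborel"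
    have meas [measurable]: "(\<lambda>w. ennreal (jump p w) * of_bool (mark p w \<le> s)) \<in> borel_measurable M"
      if p: "p \<in> marks" for p
    proof -
      note [measurable] = mark_measurable[OF p]
      have [measurable]: "T (fst p) (snd p) \<in> borel_measurable M"
        using p by (intro T_measurable) (simp add: marks_def)
      show ?thesis by measurable
    qed
    have one: "(\<integral>\<^sup>+w. ennreal (\<gamma> x * T x (Suc n) w) * of_bool (mark (x, Suc n) w \<le> s) \<partial>M) =
       ennreal (\<gamma> x) * ?L x n" for x n
    proof -
      have [measurable]: "T x (Suc n) \<in> borel_measurable (info {Stay x (Suc n)})"
        by (intro T_measurable_info) auto
      have [measurable]: "mark (x, Suc n) \<in> borel_measurable (info {Marks x})"
        by (intro mark_measurable_info) (auto simp: marks_def)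
      have T: "distributed M lborel (T x (Suc n)) (exponential_density 1)"
        by (rule T_exponential) simp
      have "(\<integral>\<^sup>+w. ennreal (\<gamma> x * T x (Suc n) w) * of_bool (mark (x, Suc n) w \<le> s) \<partial>M) =
        (\<integral>\<^sup>+w. (\<integral>\<^sup>+w'. ennreal (\<gamma> x * T x (Suc n) w) * of_bool (mark (x, Suc n) w' \<le> s) \<partial>M) \<partial>M)"
        by (intro nn_integral_decouple[of "{Stay x (Suc n)}" "{Marks x}"]) auto
      also have "\<dots> = (\<integral>\<^sup>+w. ennreal (\<gamma> x * T x (Suc n) w) *
           ?L x n \<partial>M)"
        using mark_measurable[of "(x, Suc n)"]
        by (simp add: nn_integral_cmult marks_def distributed_nn_integral[OF mark_distributed])
      also have "\<dots> = (\<integral>\<^sup>+w. ennreal (\<gamma> x * T x (Suc n) w) \<partial>M) *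
           ?L x n"
        using T_measurable[of "Suc n" x] by (intro nn_integral_multc) simp
      also have "(\<integral>\<^sup>+w. ennreal (\<gamma> x * T x (Suc n) w) \<partial>M) =
          (\<integral>\<^sup>+t. ennreal (exponential_density 1 t) * ennreal (\<gamma> x * t) \<partial>lborel)"
        by (rule distributed_nn_integral[OF T, symmetric]) simp
      also have "\<dots> = (\<integral>\<^sup>+t. ennreal (\<gamma> x) * ennreal (erlang_density 0 1 t * t ^ 1) \<partial>lborel)"
        using gamma_pos[of x]
        by (intro nn_integral_cong) (auto simp: ennreal_mult'[symmetric] erlang_density_def algebra_simps)
      also have "\<dots> = ennreal (\<gamma> x)"
        using nn_integral_erlang_ith_moment[of 1 0 1] by (subst nn_integral_cmult) auto
      finally show ?thesis .
    qed
    have "(\<integral>\<^sup>+w. time_upto s w \<partial>M) = (\<integral>\<^sup>+p. (\<integral>\<^sup>+w. ennreal (jump p w) * of_bool (mark p w \<le> s) \<partial>M) \<partial>count_space marks)"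
      unfolding time_upto_eq by (intro nn_integral_count_space_nn_integral countable_pairs meas)
    also have "\<dots> = (\<integral>\<^sup>+x. (\<Sum>n. ennreal (\<gamma> x) * ?L x n) \<partial>count_space UNIV)"
      by (simp add: nn_integral_marks one)
    also have "\<dots> = (\<integral>\<^sup>+x. ennreal (lam x * \<gamma> x) * ennreal s \<partial>count_space UNIV)"
    proof (rule nn_integral_cong)
      fix x
      have "(\<Sum>n. ennreal (\<gamma> x) * ?L x n) =
         ennreal (\<gamma> x) * (\<integral>\<^sup>+r. (\<Sum>n. ennreal (erlang_density n (lam x) r) * of_bool (r \<le> s)) \<partial>lborel)"
        by (subst nn_integral_suminf) (auto intro: ennreal_suminf_cmult)
      also have "(\<integral>\<^sup>+r. (\<Sum>n. ennreal (erlang_density n (lam x) r) * of_bool (r \<le> s)) \<partial>lborel) =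
          (\<integral>\<^sup>+r. ennreal (lam x) * indicator {0..s} r \<partial>lborel)"
      proof (intro nn_integral_cong_AE eventually_mono[OF AE_lborel_singleton[of "0::real"]])
        fix r :: real assume "r \<noteq> 0"
        then show "(\<Sum>n. ennreal (erlang_density n (lam x) r) * of_bool (r \<le> s)) =
            ennreal (lam x) * indicator {0..s} r"
          using suminf_erlang_density[OF lam_pos, of r x]
          using \<open>r \<noteq> 0\<close> by (cases "r < 0") (auto simp: indicator_def erlang_density_def[of _ _ r])
      qed
      also have "\<dots> = ennreal (lam x) * ennreal s"
        using that by (subst nn_integral_cmult_indicator) auto
      finally show "(\<Sum>n. ennreal (\<gamma> x) * ?L x n) =
          ennreal (lam x * \<gamma> x) * ennreal s"
        using lam_pos[of x] gamma_pos[of x] by (simp add: ennreal_mult mult_ac)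
    qed
    also have "\<dots> = (\<integral>\<^sup>+x. ennreal (lam x * \<gamma> x) \<partial>count_space UNIV) * ennreal s"
      by (rule nn_integral_multc) simp
    also have "\<dots> < \<infinity>"
    proof -
      have "(\<integral>\<^sup>+x. ennreal (norm (lam x * \<gamma> x)) \<partial>count_space UNIV) < \<infinity>"
        using integrable_lam_gamma by (simp add: integrable_iff_bounded)
      then show ?thesis
        by (simp add: abs_mult abs_of_pos[OF lam_pos] abs_of_pos[OF gamma_pos] ennreal_mult_less_top)
    qed
    finally have "(\<integral>\<^sup>+w. time_upto s w \<partial>M) \<noteq> \<infinity>" by simp
    moreover have "time_upto s \<in> borel_measurable M"
      unfolding time_upto_eq[abs_def]
      by (intro borel_measurable_nn_integral_count_space countable_pairs meas)
    ultimately show ?thesis by (intro nn_integral_PInf_AE)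
  qed
  have "AE w in M. \<forall>n::nat. time_upto (real n) w \<noteq> \<infinity>"
    using fin by (simp add: AE_all_countable)
  then show ?thesis
  proof eventually_elim
    case (elim w)
    show ?case
    proof
      fix s
      obtain n where "s \<le> real n" using real_arch_simple by blast
      then have "time_upto s w \<le> time_upto (real n) w" by (rule time_upto_mono)
      then show "time_upto s w < \<infinity>" using elim by (simp add: le_less_trans less_top)
    qed
  qed
qed

end

section \<open>Occupation of the states from infinity\<close>

lemma emeasure_lborel_greaterThan: "emeasure lborel {0::real<..} = \<infinity>"
proof -
  have "ennreal (real n) \<le> emeasure lborel {0::real<..}" for n
  proof -
    have "ennreal (real n) = emeasure lborel {0<..real n}" by simp
    also have "\<dots> \<le> emeasure lborel {0::real<..}" by (intro emeasure_mono) auto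
    finally show ?thesis .
  qed
  then show ?thesis
    by (metis ennreal_Ex_less_of_nat ennreal_of_nat_eq_real_of_nat infinity_ennreal_def leD less_top)
qed

lemma exponential_tail:
  assumes "0 < c" "0 \<le> u"
  shows "(\<integral>\<^sup>+\<tau>. ennreal (exponential_density 1 \<tau>) * of_bool (u < c * \<tau>) \<partial>lborel) = ennreal (exp (- u / c))"
proof -
  have "((\<lambda>x. - exp (- x)) \<longlongrightarrow> - 0) (at_top :: real filter)"
    by (intro tendsto_minus filterlim_compose[OF exp_at_bot] filterlim_uminus_at_bot_at_top)
  then have "(\<integral>\<^sup>+\<tau>. ennreal (exp (- \<tau>)) * indicator {u / c..} \<tau> \<partial>lborel) = ennreal (0 - (- exp (- (u / c))))"
    by (intro nn_integral_FTC_atLeast[where F = "\<lambda>x. - exp (- x)"]) (auto intro!: derivative_eq_intros)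
  moreover have "(\<integral>\<^sup>+\<tau>. ennreal (exponential_density 1 \<tau>) * of_bool (u < c * \<tau>) \<partial>lborel) =
      (\<integral>\<^sup>+\<tau>. ennreal (exp (- \<tau>)) * indicator {u / c..} \<tau> \<partial>lborel)"
  proof (intro nn_integral_cong_AE eventually_mono[OF AE_lborel_singleton[of "u / c"]])
    fix \<tau> :: real assume ne: "\<tau> \<noteq> u / c"
    show "ennreal (exponential_density 1 \<tau>) * of_bool (u < c * \<tau>) = ennreal (exp (- \<tau>)) * indicator {u / c..} \<tau>"
    proof (cases "u / c < \<tau>")
      case True
      then have "0 \<le> \<tau>" using assms by (meson divide_nonneg_pos less_imp_le order_trans)
      moreover have "u < c * \<tau>" using True assms by (simp add: pos_divide_less_eq mult.commute)
      ultimately show ?thesis using True by (simp add: exponential_density_def indicator_def)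
    next
      case False
      then have "\<tau> < u / c" using ne by simp
      then have "\<not> u < c * \<tau>" using assms by (simp add: pos_less_divide_eq mult.commute)
      then show ?thesis using False ne by (simp add: indicator_def)
    qed
  qed
  ultimately show ?thesis by simp
qed

text \<open>
  Whether a visit that starts at time \<open>a\<close> is still going on at time \<open>t\<close>, plus the rate \<open>1 / c\<close>
  times the duration of the visit up to time \<open>t\<close>.
\<close>
definition survival :: "real \<Rightarrow> real \<Rightarrow> ennreal \<Rightarrow> real \<Rightarrow> ennreal" where
  "survival c t a \<tau> =
     of_bool (a \<le> ennreal t \<and> ennreal t < a + ennreal (c * \<tau>)) + ennreal (1 / c) *
       (\<integral>\<^sup>+r. indicator {0..t} r * of_bool (a \<le> ennreal r \<and> ennreal r < a + ennreal (c * \<tau>)) \<partial>lborel)"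

lemma survival_measurable [measurable]:
  "(\<lambda>(a, \<tau>). survival c t a \<tau>) \<in> borel_measurable (borel \<Otimes>\<^sub>M borel)"
proof -
  have [measurable]: "(\<lambda>z. \<integral>\<^sup>+r. indicator {0..t} r *
      of_bool (fst z \<le> ennreal r \<and> ennreal r < fst z + ennreal (c * snd z)) \<partial>lborel)
    \<in> borel_measurable (borel \<Otimes>\<^sub>M borel)"
    by (rule lborel.borel_measurable_nn_integral) simp
  show ?thesis by (simp add: survival_def split_beta')
qed

text \<open>
  A visit that has started ends at rate \<open>1 / c\<close>.
\<close>
lemma nn_integral_survival:
  assumes c: "0 < c" and t: "0 \<le> t"
  shows "(\<integral>\<^sup>+\<tau>. ennreal (exponential_density 1 \<tau>) * survival c t a \<tau> \<partial>lborel) = of_bool (a \<le> ennreal t)"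
proof (cases "a \<le> ennreal t")
  case False
  have "survival c t a \<tau> = 0" for \<tau>
  proof -
    have "(indicator {0..t} r * of_bool (a \<le> ennreal r \<and> ennreal r < a + ennreal (c * \<tau>)) :: ennreal) = 0" for r
      using False by (auto simp: indicator_def) (meson ennreal_leI order_trans)
    then have "(\<integral>\<^sup>+r. indicator {0..t} r * of_bool (a \<le> ennreal r \<and> ennreal r < a + ennreal (c * \<tau>)) \<partial>lborel) =
       (\<integral>\<^sup>+r. 0 \<partial>(lborel :: real measure))"
      by (intro nn_integral_cong)
    then show ?thesis using False by (simp add: survival_def)
  qed
  then show ?thesis using False by simp
next
  case True
  then obtain b where b: "a = ennreal b" "0 \<le> b" "b \<le> t"
    using t by (cases a) (auto simp: top_unique)
  let ?e = "\<lambda>\<tau>. ennreal (exponential_density 1 \<tau>)"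
  let ?D = "\<lambda>\<tau> r. ?e \<tau> * of_bool (r - b < c * \<tau>)"
  have cond: "a \<le> ennreal r \<and> ennreal r < a + ennreal (c * \<tau>) \<longleftrightarrow> b \<le> r \<and> r - b < c * \<tau>" if "0 \<le> \<tau>" "0 \<le> r" for \<tau> r
    using b c that by (auto simp: ennreal_less_iff simp flip: ennreal_plus)
  have e1: "exp (- (t - b) / c) \<le> 1" using b c by (simp add: divide_le_0_iff)
  have e0: "?e \<tau> = 0" if "\<tau> < 0" for \<tau> using that by (simp add: exponential_density_def)
  have "(\<integral>\<^sup>+\<tau>. ?e \<tau> * survival c t a \<tau> \<partial>lborel) =
    (\<integral>\<^sup>+\<tau>. ?D \<tau> t + ennreal (1 / c) *
       (\<integral>\<^sup>+r. indicator {b..t} r * ?D \<tau> r \<partial>lborel) \<partial>lborel)"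
  proof (rule nn_integral_cong)
    fix \<tau> :: real
    show "?e \<tau> * survival c t a \<tau> = ?D \<tau> t + ennreal (1 / c) *
       (\<integral>\<^sup>+r. indicator {b..t} r * ?D \<tau> r \<partial>lborel)"
    proof (cases "\<tau> < 0")
      case False
      have "(\<integral>\<^sup>+r. indicator {0..t} r * of_bool (a \<le> ennreal r \<and> ennreal r < a + ennreal (c * \<tau>)) \<partial>lborel) =
        (\<integral>\<^sup>+r. indicator {b..t} r * of_bool (r - b < c * \<tau>) \<partial>lborel)"
      proof (rule nn_integral_cong)
        fix r :: real
        show "indicator {0..t} r * of_bool (a \<le> ennreal r \<and> ennreal r < a + ennreal (c * \<tau>)) =
          (indicator {b..t} r * of_bool (r - b < c * \<tau>) :: ennreal)"
        proof (cases "0 \<le> r")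
          case True
          then show ?thesis using cond[of \<tau> r] False b by (auto simp: indicator_def)
        qed (use b in \<open>simp add: indicator_def\<close>)
      qed
      moreover have "?e \<tau> * (\<integral>\<^sup>+r. indicator {b..t} r * of_bool (r - b < c * \<tau>) \<partial>lborel) =
          (\<integral>\<^sup>+r. indicator {b..t} r * ?D \<tau> r \<partial>lborel)"
        by (subst nn_integral_cmult[symmetric]) (auto simp: mult_ac)
      ultimately show ?thesis
        using cond[of \<tau> t] False t b by (simp add: survival_def distrib_left mult.left_commute)
    qed (simp add: e0)
  qed
  also have "\<dots> = (\<integral>\<^sup>+\<tau>. ?D \<tau> t \<partial>lborel) + ennreal (1 / c) *
     (\<integral>\<^sup>+\<tau>. (\<integral>\<^sup>+r. indicator {b..t} r * ?D \<tau> r \<partial>lborel) \<partial>lborel)"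
    by (subst nn_integral_add) (auto simp: nn_integral_cmult)
  also have "(\<integral>\<^sup>+\<tau>. (\<integral>\<^sup>+r. indicator {b..t} r * ?D \<tau> r \<partial>lborel) \<partial>lborel) =
      (\<integral>\<^sup>+r. (\<integral>\<^sup>+\<tau>. indicator {b..t} r * ?D \<tau> r \<partial>lborel) \<partial>lborel)"
    by (rule lborel_pair.Fubini') simp
  also have "\<dots> = (\<integral>\<^sup>+r. ennreal (exp (- (r - b) / c)) * indicator {b..t} r \<partial>lborel)"
    using exponential_tail[OF c] by (intro nn_integral_cong) (auto simp: nn_integral_cmult indicator_def diff_divide_distrib)
  also have "\<dots> = ennreal (- c * exp (- (t - b) / c) - - c * exp (- (b - b) / c))"
    using b c by (intro nn_integral_FTC_Icc) (auto intro!: derivative_eq_intros simp: field_simps)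
  also have "\<dots> = ennreal (c * (1 - exp (- (t - b) / c)))"
    by (simp add: algebra_simps)
  also have "ennreal (1 / c) * \<dots> = ennreal (1 - exp (- (t - b) / c))"
    using b c e1 by (subst ennreal_mult[symmetric]) (auto simp: zero_le_mult_iff divide_le_0_iff)
  also have "(\<integral>\<^sup>+\<tau>. ?D \<tau> t \<partial>lborel) = ennreal (exp (- (t - b) / c))"
    using b by (intro exponential_tail[OF c]) simp
  also have "ennreal (exp (- (t - b) / c)) + ennreal (1 - exp (- (t - b) / c)) = 1"
    using b c by (subst ennreal_plus[symmetric]) (auto simp: divide_le_0_iff)
  finally show ?thesis using True by simp
qed

context K_process_data
begin

lemma measurable_pair_info:
  assumes "J \<subseteq> sources" "f \<in> measurable (N \<Otimes>\<^sub>M info J) K"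
  shows "f \<in> measurable (N \<Otimes>\<^sub>M M) K"
proof -
  have "(\<lambda>z. (fst z, snd z)) \<in> measurable (N \<Otimes>\<^sub>M M) (N \<Otimes>\<^sub>M info J)"
    using measurable_compose[OF measurable_snd id_measurable_info[OF assms(1)]] by (intro measurable_Pair) auto
  from measurable_compose[OF this assms(2)] show ?thesis by simp
qed

definition clock_sources :: "'s source set" where
  "clock_sources = sources - {Initial}"

lemma clock_sources_subset: "clock_sources \<subseteq> sources"
  by (auto simp: clock_sources_def)

lemma jump_sum_measurable:
  assumes [measurable]: "\<And>q. q \<in> marks \<Longrightarrow> Measurable.pred N (P q)"
    and "\<And>q. q \<in> marks \<Longrightarrow> (\<lambda>z. if P q z then T (fst q) (snd q) (f z) else 0) \<in> borel_measurable N"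
  shows "(\<lambda>z. \<integral>\<^sup>+q. ennreal (jump q (f z)) * of_bool (P q z) \<partial>count_space marks)
    \<in> borel_measurable N"
proof (intro borel_measurable_nn_integral_count_space countable_pairs)
  fix q assume q: "q \<in> marks"
  note [measurable] = assms(2)[OF q]
  have "(\<lambda>z. ennreal (\<gamma> (fst q) * (if P q z then T (fst q) (snd q) (f z) else 0))) \<in> borel_measurable N"
    by measurable
  also have "(\<lambda>z. ennreal (\<gamma> (fst q) * (if P q z then T (fst q) (snd q) (f z) else 0))) =
     (\<lambda>z. ennreal (jump q (f z)) * of_bool (P q z))"
    by auto
  finally show "(\<lambda>z. ennreal (jump q (f z)) * of_bool (P q z)) \<in> borel_measurable N" .
qed

lemma clock_measurable:
  assumes [measurable]: "f \<in> measurable N (info clock_sources)" "g \<in> borel_measurable N"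
  shows "(\<lambda>z. time_upto (g z) (f z)) \<in> borel_measurable N"
    and "(\<lambda>z. time_before (g z) (f z)) \<in> borel_measurable N"
proof -
  have mm [measurable]: "mark q \<in> borel_measurable (info clock_sources)"
    and T: "T (fst q) (snd q) \<in> borel_measurable (info clock_sources)" if "q \<in> marks" for q
    using that clock_sources_subset
    by (auto intro!: mark_measurable_info T_measurable_info simp: clock_sources_def marks_def)
  show "(\<lambda>z. time_upto (g z) (f z)) \<in> borel_measurable N"
    unfolding time_upto_eq
  proof (rule jump_sum_measurable)
    fix q assume q: "q \<in> marks"
    note [measurable] = mm[OF q] T[OF q]
    show "Measurable.pred N (\<lambda>z. mark q (f z) \<le> g z)" by measurable
    then show "(\<lambda>z. if mark q (f z) \<le> g z then T (fst q) (snd q) (f z) else 0) \<in> borel_measurable N"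
      by measurable
  qed
  show "(\<lambda>z. time_before (g z) (f z)) \<in> borel_measurable N"
    unfolding time_before_eq
  proof (rule jump_sum_measurable)
    fix q assume q: "q \<in> marks"
    note [measurable] = mm[OF q] T[OF q]
    show "Measurable.pred N (\<lambda>z. mark q (f z) < g z)" by measurable
    then show "(\<lambda>z. if mark q (f z) < g z then T (fst q) (snd q) (f z) else 0) \<in> borel_measurable N"
      by measurable
  qed
qed

lemma visit_measurable_info:
  assumes p: "p \<in> marks"
  shows "(\<lambda>z. indicator (visit p (snd z)) (fst z) :: ennreal) \<in> borel_measurable (borel \<Otimes>\<^sub>M info clock_sources)"
    and "Measurable.pred (borel \<Otimes>\<^sub>M info clock_sources) (\<lambda>z. fst z \<in> visit p (snd z))"
proof -
  have [measurable]: "mark p \<in> borel_measurable (info clock_sources)"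
    using p clock_sources_subset by (auto intro!: mark_measurable_info simp: clock_sources_def)
  have [measurable]: "(\<lambda>z. time_before (mark p (snd z)) (snd z)) \<in> borel_measurable (borel \<Otimes>\<^sub>M info clock_sources)"
    "(\<lambda>z. time_upto (mark p (snd z)) (snd z)) \<in> borel_measurable (borel \<Otimes>\<^sub>M info clock_sources)"
    by (intro clock_measurable; measurable)+
  show *: "Measurable.pred (borel \<Otimes>\<^sub>M info clock_sources) (\<lambda>z. fst z \<in> visit p (snd z))"
    unfolding visit_def mem_Collect_eq by measurable
  have "(\<lambda>z. indicator (visit p (snd z)) (fst z) :: ennreal) = (\<lambda>z. of_bool (fst z \<in> visit p (snd z)))"
    by (auto simp: indicator_def)
  with * show "(\<lambda>z. indicator (visit p (snd z)) (fst z) :: ennreal) \<in> borel_measurable (borel \<Otimes>\<^sub>M info clock_sources)"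
    by simp
qed

lemma visit_measurable [measurable]:
  assumes p: "p \<in> marks"
  shows "(\<lambda>z. indicator (visit p (snd z)) (fst z) :: ennreal) \<in> borel_measurable (borel \<Otimes>\<^sub>M M)"
  by (rule measurable_pair_info[OF clock_sources_subset visit_measurable_info(1)[OF p]])

lemma visit_measurable_fixed [measurable]:
  assumes p: "p \<in> marks"
  shows "(\<lambda>w. indicator (visit p w) t :: ennreal) \<in> borel_measurable M"
  using measurable_Pair2[OF visit_measurable[OF p], of t] by simp

lemma visit_duration_measurable:
  assumes p: "p \<in> marks"
  shows "visit_duration p t \<in> borel_measurable M"
  unfolding visit_duration_def[abs_def]
proof (rule lborel.borel_measurable_nn_integral)
  have [measurable]: "(\<lambda>z. indicator (visit p (fst z)) (snd z) :: ennreal) \<in> borel_measurable (M \<Otimes>\<^sub>M lborel)"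
    using measurable_compose[OF measurable_Pair[OF measurable_snd measurable_fst] visit_measurable[OF p]]
    by (simp cong: measurable_cong_sets)
  show "(\<lambda>(w, r). indicator {0..t} r * indicator (visit p w) r :: ennreal) \<in> borel_measurable (M \<Otimes>\<^sub>M lborel)"
    unfolding split_beta' by measurable
qed

abbreviation visit_prob :: "'s \<times> nat \<Rightarrow> real \<Rightarrow> ennreal" where
  "visit_prob p t \<equiv> (\<integral>\<^sup>+w. indicator (visit p w) t \<partial>M)"

text \<open>
  The clock with the marks of \<open>x\<close> replaced by exactly \<open>n\<close> jumps at \<open>x\<close>. It is independent of the
  Poisson process at \<open>x\<close>, and it is the clock at local time \<open>s\<close> when that process has \<open>n\<close> marks
  up to \<open>s\<close>.
\<close>
definition other_time :: "'s \<Rightarrow> nat \<Rightarrow> real \<Rightarrow> 'w \<Rightarrow> ennreal" where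
  "other_time x n s w = emeasure (jumps w) {q \<in> marks. if fst q = x then snd q \<le> n else mark q w \<le> s}"

definition other_sources :: "'s \<Rightarrow> nat \<Rightarrow> 's source set" where
  "other_sources x n = {Marks z | z. z \<noteq> x} \<union> {Stay z i | z i. 1 \<le> i \<and> (z = x \<longrightarrow> i \<le> n)}"

lemma other_sources_subset: "other_sources x n \<subseteq> sources"
  by (auto simp: other_sources_def)

lemma Marks_in_other_sources [simp]: "Marks z \<in> other_sources x n \<longleftrightarrow> z \<noteq> x"
  and Stay_in_other_sources [simp]: "Stay z i \<in> other_sources x n \<longleftrightarrow> 1 \<le> i \<and> (z = x \<longrightarrow> i \<le> n)"
  by (auto simp: other_sources_def)

lemma other_time_measurable:
  assumes [measurable]: "f \<in> measurable N (info J)" "g \<in> borel_measurable N"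
    and J: "other_sources x n \<subseteq> J" "J \<subseteq> sources"
  shows "(\<lambda>z. other_time x n (g z) (f z)) \<in> borel_measurable N"
proof -
  have eq: "other_time x n s w = (\<integral>\<^sup>+q. ennreal (jump q w) *
      of_bool (if fst q = x then snd q \<le> n else mark q w \<le> s) \<partial>count_space marks)" for s w
  proof -
    have "indicator {q \<in> marks. if fst q = x then snd q \<le> n else mark q w \<le> s} p =
      (of_bool (if fst p = x then snd p \<le> n else mark p w \<le> s) * indicator marks p :: ennreal)" for p
      by (auto simp: indicator_def)
    then show ?thesis
      unfolding other_time_def emeasure_jumps
      by (simp only:) (simp add: nn_integral_count_space_indicator mult.assoc)
  qed
  show ?thesis
    unfolding eq
  proof (rule jump_sum_measurable)
    fix q assume q: "q \<in> marks"
    show P: "Measurable.pred N (\<lambda>z. if fst q = x then snd q \<le> n else mark q (f z) \<le> g z)"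
    proof (cases "fst q = x")
      case False
      then have [measurable]: "mark q \<in> borel_measurable (info J)"
        using q J subsetD[OF J(1), of "Marks (fst q)"] by (intro mark_measurable_info) simp_all
      show ?thesis using False by simp
    qed simp
    show "(\<lambda>z. if (if fst q = x then snd q \<le> n else mark q (f z) \<le> g z) then T (fst q) (snd q) (f z) else 0) \<in> borel_measurable N"
    proof (cases "fst q = x \<and> n < snd q")
      case True then show ?thesis by simp
    next
      case False
      then have [measurable]: "T (fst q) (snd q) \<in> borel_measurable (info J)"
        using q J subsetD[OF J(1), of "Stay (fst q) (snd q)"]
        by (intro T_measurable_info) (auto simp: marks_def)
      have "(\<lambda>z. T (fst q) (snd q) (f z)) \<in> borel_measurable N" by measurable
      then show ?thesis by (rule measurable_If[OF _ _ predE[OF P]]) simp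
    qed
  qed
qed

lemma time_before_eq_other:
  assumes "regular w"
  shows "time_before (mark (x, Suc n) w) w = other_time x n (mark (x, Suc n) w) w"
proof -
  have w: "w \<in> space M" using assms by (simp add: regular_def)
  have "q \<in> marks_before (mark (x, Suc n) w) w \<longleftrightarrow>
     q \<in> marks \<and> (if fst q = x then snd q \<le> n else mark q w \<le> mark (x, Suc n) w)" for q
  proof (cases "fst q = x \<and> q \<in> marks")
    case True
    then have q: "1 \<le> snd q" by (simp add: marks_def)
    have "mark q w < mark (x, Suc n) w \<longleftrightarrow> snd q \<le> n"
    proof (cases "snd q \<le> n")
      case True
      then show ?thesis using mark_increasing[OF w q, of "Suc n" x] \<open>fst q = x \<and> q \<in> marks\<close>
        by (simp add: mark_def)
    next
      case False
      then have "mark (x, Suc n) w \<le> mark q w"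
        using mark_increasing[OF w, of "Suc n" "snd q" x] \<open>fst q = x \<and> q \<in> marks\<close>
        by (cases "snd q = Suc n") (simp_all add: mark_def)
      then show ?thesis using False by simp
    qed
    then show ?thesis using True by (simp add: marks_before_def)
  next
    case False
    have "mark q w \<noteq> mark (x, Suc n) w" if "q \<in> marks"
    proof
      assume "mark q w = mark (x, Suc n) w"
      moreover have "(x, Suc n) \<in> marks" by (simp add: marks_def)
      ultimately have "q = (x, Suc n)" using assms that by (auto simp: regular_def dest: inj_onD)
      then show False using False that by simp
    qed
    then show ?thesis using False by (auto simp: marks_before_def less_le)
  qed
  then have "marks_before (mark (x, Suc n) w) w =
      {q \<in> marks. if fst q = x then snd q \<le> n else mark q w \<le> mark (x, Suc n) w}"
    by (intro set_eqI) simp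
  then show ?thesis unfolding time_before_def other_time_def by (simp only:)
qed

lemma time_upto_eq_other:
  assumes w: "w \<in> space M" and n: "mark_count (\<sigma> x) s w = n"
  shows "time_upto s w = other_time x n s w"
proof -
  have "marks_upto s w = {q \<in> marks. if fst q = x then snd q \<le> n else mark q w \<le> s}"
  proof (rule set_eqI)
    fix q
    show "q \<in> marks_upto s w \<longleftrightarrow> q \<in> {q \<in> marks. if fst q = x then snd q \<le> n else mark q w \<le> s}"
      using mark_le_iff[OF w, of "snd q" x s] n
      by (cases "fst q = x") (auto simp: marks_upto_def marks_def mark_def)
  qed
  then show ?thesis by (simp add: time_upto_def other_time_def)
qed

text \<open>
  By \<open>time_before_eq_other\<close>, the probability that visit number \<open>n + 1\<close> to \<open>x\<close> has started by \<open>t\<close>.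
\<close>
definition start_prob :: "'s \<Rightarrow> nat \<Rightarrow> real \<Rightarrow> ennreal" where
  "start_prob x n t = (\<integral>\<^sup>+w. of_bool (other_time x n (mark (x, Suc n) w) w \<le> ennreal t) \<partial>M)"

text \<open>
  The holding time of a visit is independent of its starting time, so that the latter can be taken
  for the constant \<open>a\<close> of \<open>nn_integral_survival\<close>.
\<close>
lemma visit_balance:
  assumes t: "0 \<le> t"
  shows "visit_prob (x, Suc n) t + ennreal (1 / \<gamma> x) *
      (\<integral>\<^sup>+r. visit_prob (x, Suc n) r * indicator {0..t} r \<partial>lborel) = start_prob x n t"
proof -
  let ?p = "(x, Suc n)"
  let ?A = "\<lambda>w. other_time x n (mark (x, Suc n) w) w"
  let ?I = "insert (Marks x) (other_sources x n)" and ?J = "{Stay x (Suc n)}"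
  have p: "?p \<in> marks" by (simp add: marks_def)
  note [measurable] = visit_measurable[OF p] visit_measurable_fixed[OF p]
  have I: "?I \<subseteq> sources" using other_sources_subset by auto
  have [measurable]: "mark ?p \<in> borel_measurable (info ?I)"
    using I p by (intro mark_measurable_info) auto
  have A: "?A \<in> borel_measurable (info ?I)"
    by (rule other_time_measurable[OF _ _ _ I]) auto
  have Tm: "T x (Suc n) \<in> borel_measurable (info ?J)"
    by (rule T_measurable_info) auto
  note dm = visit_duration_measurable[OF p, of t] and vm = visit_measurable_fixed[OF p, of t]
  have dm': "(\<lambda>w. ennreal (1 / \<gamma> x) * visit_duration ?p t w) \<in> borel_measurable M"
    using dm by (intro borel_measurable_times_ennreal borel_measurable_const)
  interpret P: pair_sigma_finite "lborel :: real measure" M by unfold_locales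
  have "(\<integral>\<^sup>+r. visit_prob ?p r * indicator {0..t} r \<partial>lborel) =
      (\<integral>\<^sup>+r. (\<integral>\<^sup>+w. indicator {0..t} r * indicator (visit ?p w) r \<partial>M) \<partial>lborel)"
    by (simp add: nn_integral_cmult mult.commute)
  also have "\<dots> = (\<integral>\<^sup>+w. visit_duration ?p t w \<partial>M)"
    unfolding visit_duration_def by (rule P.Fubini'[symmetric]) (simp add: split_beta')
  finally have "visit_prob ?p t + ennreal (1 / \<gamma> x) *
      (\<integral>\<^sup>+r. visit_prob ?p r * indicator {0..t} r \<partial>lborel) =
     (\<integral>\<^sup>+w. indicator (visit ?p w) t + ennreal (1 / \<gamma> x) *
        visit_duration ?p t w \<partial>M)"
    by (simp only: nn_integral_add[OF vm dm'] nn_integral_cmult[OF dm])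
  also have "\<dots> = (\<integral>\<^sup>+w. survival (\<gamma> x) t (?A w) (T x (Suc n) w) \<partial>M)"
  proof (intro nn_integral_cong_AE eventually_mono[OF AE_regular])
    fix w assume w: "regular w"
    have ind: "(indicator (visit ?p w) r :: ennreal) =
       of_bool (?A w \<le> ennreal r \<and>
          ennreal r < ?A w + ennreal (\<gamma> x * T x (Suc n) w))" if "0 \<le> r" for r
      using that time_upto_mark[OF w p]
      by (simp add: visit_def indicator_def time_before_eq_other[OF w])
    have "visit_duration ?p t w =
      (\<integral>\<^sup>+r. indicator {0..t} r * of_bool (?A w \<le> ennreal r \<and>
          ennreal r < ?A w + ennreal (\<gamma> x * T x (Suc n) w)) \<partial>lborel)"
      unfolding visit_duration_def
    proof (rule nn_integral_cong)
      fix r :: real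
      show "indicator {0..t} r * indicator (visit ?p w) r =
        (indicator {0..t} r * of_bool (?A w \<le> ennreal r \<and>
          ennreal r < ?A w + ennreal (\<gamma> x * T x (Suc n) w)) :: ennreal)"
        using ind[of r] by (cases "0 \<le> r") (simp_all only:, simp add: indicator_def)
    qed
    then show "indicator (visit ?p w) t + ennreal (1 / \<gamma> x) *
        visit_duration ?p t w =
      survival (\<gamma> x) t (?A w) (T x (Suc n) w)"
      unfolding survival_def ind[OF t] by (simp only:)
  qed
  also have "\<dots> = (\<integral>\<^sup>+w. (\<integral>\<^sup>+w'. survival (\<gamma> x) t (?A w) (T x (Suc n) w') \<partial>M) \<partial>M)"
  proof (rule nn_integral_decouple[OF I])
    have "(\<lambda>z. (?A (fst z), T x (Suc n) (snd z))) \<in>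
      measurable (info ?I \<Otimes>\<^sub>M info ?J) (borel \<Otimes>\<^sub>M borel)"
      using A Tm by measurable
    from measurable_compose[OF this survival_measurable]
    show "(\<lambda>(w, w'). survival (\<gamma> x) t (?A w) (T x (Suc n) w'))
      \<in> borel_measurable (info ?I \<Otimes>\<^sub>M info ?J)" by (simp add: split_beta')
  qed (auto simp: other_sources_def)
  also have "\<dots> = (\<integral>\<^sup>+w. of_bool (?A w \<le> ennreal t) \<partial>M)"
  proof (rule nn_integral_cong)
    fix w
    have "1 \<le> Suc n" by simp
    have "(\<lambda>\<tau>. survival (\<gamma> x) t a \<tau>) \<in> borel_measurable lborel" for a
      using measurable_Pair2[OF survival_measurable, of a] by simp
    then show "(\<integral>\<^sup>+w'. survival (\<gamma> x) t (?A w) (T x (Suc n) w') \<partial>M) =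
        of_bool (?A w \<le> ennreal t)"
      using nn_integral_survival[OF gamma_pos t]
      by (simp add: distributed_nn_integral[OF T_exponential[OF \<open>1 \<le> Suc n\<close>], symmetric])
  qed
  finally show ?thesis by (simp add: start_prob_def)
qed

text \<open>
  The mass of \<open>[0, t]\<close> under the potential measure of the clock as a subordinator.
\<close>
definition potential :: "real \<Rightarrow> ennreal" where
  "potential t = (\<integral>\<^sup>+s. (\<integral>\<^sup>+w. of_bool (time_upto s w \<le> ennreal t) \<partial>M) * indicator {0<..} s \<partial>lborel)"

text \<open>
  Conditioning on the \<open>n\<close>-th mark of \<open>x\<close>, whose density is \<open>lam x\<close> times a Poisson probability,
  turns the expected number of visits to \<open>x\<close> started by time \<open>t\<close> into an integral over local time
  in which \<open>x\<close> occurs only through the factor \<open>lam x\<close>.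
\<close>
lemma sum_start_prob:
  "(\<Sum>n. start_prob x n t) = ennreal (lam x) * potential t"
proof -
  let ?H = "\<lambda>n s. \<integral>\<^sup>+w. of_bool (other_time x n s w \<le> ennreal t) \<partial>M"
  let ?K = "\<lambda>s. \<integral>\<^sup>+w. of_bool (time_upto s w \<le> ennreal t) \<partial>M"
  interpret P: pair_sigma_finite "lborel :: real measure" M by unfold_locales
  have otherM: "(\<lambda>z. other_time x n (fst z) (snd z)) \<in> borel_measurable (borel \<Otimes>\<^sub>M M)" for n
    by (rule measurable_pair_info[OF other_sources_subset[of x n]])
       (rule other_time_measurable[OF _ _ _ other_sources_subset[of x n]], auto)
  have P1: "start_prob x n t = (\<integral>\<^sup>+s. ennreal (erlang_density n (lam x) s) *
       ?H n s \<partial>lborel)" for n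
  proof -
    let ?I = "other_sources x n" and ?J = "{Marks x}" and ?p = "(x, Suc n)"
    have mp: "mark ?p \<in> borel_measurable (info ?J)"
      by (intro mark_measurable_info) (auto simp: marks_def)
    have "start_prob x n t = (\<integral>\<^sup>+w. (\<integral>\<^sup>+w'. of_bool (other_time x n (mark ?p w') w \<le> ennreal t) \<partial>M) \<partial>M)"
      unfolding start_prob_def
    proof (rule nn_integral_decouple[OF other_sources_subset])
      have [measurable]: "(\<lambda>z. other_time x n (mark ?p (snd z)) (fst z)) \<in> borel_measurable (info ?I \<Otimes>\<^sub>M info ?J)"
        using mp by (intro other_time_measurable[OF _ _ _ other_sources_subset]) auto
      show "(\<lambda>(w, w'). of_bool (other_time x n (mark ?p w') w \<le> ennreal t))
          \<in> borel_measurable (info ?I \<Otimes>\<^sub>M info ?J)"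
        unfolding split_beta' by measurable
    qed (auto simp: other_sources_def)
    also have "\<dots> = (\<integral>\<^sup>+w. (\<integral>\<^sup>+s. ennreal (erlang_density n (lam x) s) * of_bool (other_time x n s w \<le> ennreal t) \<partial>lborel) \<partial>M)"
    proof (rule nn_integral_cong)
      fix w assume "w \<in> space M"
      then have [measurable]: "(\<lambda>s. other_time x n s w) \<in> borel_measurable borel"
        using measurable_Pair1[OF otherM, of w n] by simp
      show "(\<integral>\<^sup>+w'. of_bool (other_time x n (mark ?p w') w \<le> ennreal t) \<partial>M) =
          (\<integral>\<^sup>+s. ennreal (erlang_density n (lam x) s) * of_bool (other_time x n s w \<le> ennreal t) \<partial>lborel)"
        by (rule distributed_nn_integral[OF mark_distributed, symmetric]) measurable
    qed
    also have "\<dots> = (\<integral>\<^sup>+s. (\<integral>\<^sup>+w. ennreal (erlang_density n (lam x) s) * of_bool (other_time x n s w \<le> ennreal t) \<partial>M) \<partial>lborel)"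
      using otherM[of n] by (intro P.Fubini') (simp add: split_beta')
    also have "\<dots> = (\<integral>\<^sup>+s. ennreal (erlang_density n (lam x) s) *
       ?H n s \<partial>lborel)"
      using measurable_Pair2[OF otherM[of n]] by (intro nn_integral_cong nn_integral_cmult) simp
    finally show ?thesis .
  qed
  have P2: "(\<Sum>n. ennreal (erlang_density n (lam x) s) * ?H n s) =
      ennreal (lam x) * ?K s" if s: "0 < s" for s
  proof -
    let ?N = "mark_count (\<sigma> x) s"
    let ?U = "\<lambda>n w w'. of_bool (?N w = n) * of_bool (other_time x n s w' \<le> ennreal t) :: ennreal"
    have N: "?N \<in> measurable (info {Marks x}) (count_space UNIV)"
      using s by (intro mark_count_measurable_info) auto
    have NM: "?N \<in> measurable M (count_space UNIV)"
      by (rule measurable_info[OF _ N]) simp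
    have ev: "{w \<in> space M. ?N w = n} \<in> events" for n
      using measurable_sets[OF NM, of "{n}"] by (simp add: vimage_def Int_def conj_commute)
    have "?K s =
      (\<integral>\<^sup>+w. (\<Sum>n. ?U n w w) \<partial>M)"
    proof (rule nn_integral_cong)
      fix w assume w: "w \<in> space M"
      have "(\<Sum>n. ?U n w w) =
          (of_bool (other_time x (?N w) s w \<le> ennreal t) :: ennreal)"
        by (subst suminf_finite[of "{?N w}"]) auto
      then show "of_bool (time_upto s w \<le> ennreal t) =
          (\<Sum>n. ?U n w w)"
        using time_upto_eq_other[OF w refl] by simp
    qed
    also have "\<dots> = (\<Sum>n. \<integral>\<^sup>+w. ?U n w w \<partial>M)"
      using measurable_Pair2[OF otherM, of s] NM by (intro nn_integral_suminf) simp
    also have "\<dots> = (\<Sum>n. ennreal (pmf (poisson_pmf (lam x * s)) n) *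
        ?H n s)"
    proof (rule suminf_cong)
      fix n
      let ?I = "{Marks x}" and ?J = "other_sources x n"
      have oi [measurable]: "other_time x n s \<in> borel_measurable (info ?J)"
        using other_time_measurable[of "\<lambda>w. w" "info ?J" ?J "\<lambda>_. s" x n] other_sources_subset by simp
      have [measurable]: "other_time x n s \<in> borel_measurable M"
        by (rule measurable_info[OF other_sources_subset oi])
      have "(\<integral>\<^sup>+w. ?U n w w \<partial>M) =
        (\<integral>\<^sup>+w. (\<integral>\<^sup>+w'. ?U n w w' \<partial>M) \<partial>M)"
      proof (rule nn_integral_decouple[OF _ other_sources_subset])
        show "(\<lambda>(w, w'). ?U n w w')
            \<in> borel_measurable (info ?I \<Otimes>\<^sub>M info ?J)"
          using N by measurable
      qed simp_all
      also have "\<dots> = (\<integral>\<^sup>+w. of_bool (?N w = n) * ?H n s \<partial>M)"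
        by (intro nn_integral_cong nn_integral_cmult) measurable
      also have "\<dots> = (\<integral>\<^sup>+w. of_bool (?N w = n) \<partial>M) * ?H n s"
        using NM by (intro nn_integral_multc) measurable
      also have "(\<integral>\<^sup>+w. of_bool (?N w = n) \<partial>M) = (\<integral>\<^sup>+w. indicator {w \<in> space M. ?N w = n} w \<partial>M)"
        by (intro nn_integral_cong) (auto simp: indicator_def)
      also have "\<dots> = ennreal (pmf (poisson_pmf (lam x * s)) n)"
        unfolding nn_integral_indicator[OF ev] by (rule emeasure_mark_count_eq[OF s])
      finally show "(\<integral>\<^sup>+w. ?U n w w \<partial>M) =
        ennreal (pmf (poisson_pmf (lam x * s)) n) * ?H n s" .
    qed
    finally show ?thesis
      using lam_pos[of x] s
      by (simp add: erlang_density_eq_poisson ennreal_mult mult.assoc less_imp_le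
          ennreal_suminf_cmult del: pmf_poisson)
  qed
  have meas: "(\<lambda>s. \<integral>\<^sup>+w. of_bool (other_time x n s w \<le> ennreal t) \<partial>M) \<in> borel_measurable lborel" for n
    using otherM[of n] by (intro borel_measurable_nn_integral) (simp add: split_beta')
  have clockM: "(\<lambda>z. time_upto (fst z) (snd z)) \<in> borel_measurable (borel \<Otimes>\<^sub>M M)"
    by (rule measurable_pair_info[OF clock_sources_subset]) (rule clock_measurable, auto)
  have meas': "(\<lambda>s. \<integral>\<^sup>+w. of_bool (time_upto s w \<le> ennreal t) \<partial>M) \<in> borel_measurable lborel"
    using clockM by (intro borel_measurable_nn_integral) (simp add: split_beta')
  have "(\<Sum>n. start_prob x n t) = (\<integral>\<^sup>+s. (\<Sum>n. ennreal (erlang_density n (lam x) s) *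
       ?H n s) \<partial>lborel)"
    unfolding P1 by (intro nn_integral_suminf[symmetric] borel_measurable_times_ennreal meas) measurable
  also have "\<dots> = (\<integral>\<^sup>+s. ennreal (lam x) * (?K s * indicator {0<..} s) \<partial>lborel)"
  proof (intro nn_integral_cong_AE eventually_mono[OF AE_lborel_singleton[of "0::real"]])
    fix s :: real assume "s \<noteq> 0"
    then consider "0 < s" | "s < 0" by linarith
    then show "(\<Sum>n. ennreal (erlang_density n (lam x) s) * ?H n s) =
       ennreal (lam x) * (?K s * indicator {0<..} s)"
    proof cases
      case 1 then show ?thesis using P2[OF 1] by simp
    next
      case 2 then show ?thesis by (simp add: erlang_density_def)
    qed
  qed
  also have "\<dots> = ennreal (lam x) * potential t"
    unfolding potential_def by (intro nn_integral_cmult borel_measurable_times_ennreal meas') measurable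
  finally show ?thesis .
qed

definition occ :: "'s \<Rightarrow> real \<Rightarrow> ennreal" where
  "occ x t = (\<Sum>n. visit_prob (x, Suc n) t)"

definition occ_time :: "'s \<Rightarrow> real \<Rightarrow> ennreal" where
  "occ_time x t = (\<integral>\<^sup>+r. occ x r * indicator {0..t} r \<partial>lborel)"

lemma visit_prob_measurable [measurable]:
  "p \<in> marks \<Longrightarrow> visit_prob p \<in> borel_measurable borel"
  using visit_measurable[of p] by (intro borel_measurable_nn_integral) (simp add: split_beta')

lemma occ_measurable [measurable]: "occ x \<in> borel_measurable borel"
proof -
  have "(x, Suc n) \<in> marks" for n by (simp add: marks_def)
  then show ?thesis unfolding occ_def[abs_def] by measurable
qed

lemma occ_time_eq:
  "occ_time x t = (\<Sum>n. \<integral>\<^sup>+r. visit_prob (x, Suc n) r * indicator {0..t} r \<partial>lborel)"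
proof -
  have "(x, Suc n) \<in> marks" for n by (simp add: marks_def)
  note [measurable] = visit_prob_measurable[OF this]
  show ?thesis
    unfolding occ_time_def occ_def ennreal_suminf_multc[symmetric]
    by (rule nn_integral_suminf) measurable
qed

text \<open>
  The balance of visits to \<open>x\<close>: expected number started, minus expected number ended, is the
  probability of being at \<open>x\<close>.
\<close>
lemma occupation_balance:
  assumes "0 \<le> t"
  shows "occ x t + ennreal (1 / \<gamma> x) * occ_time x t = ennreal (lam x) * potential t"
proof -
  have "occ x t + ennreal (1 / \<gamma> x) * occ_time x t = (\<Sum>n. start_prob x n t)"
    unfolding occ_def occ_time_eq visit_balance[OF assms, symmetric] ennreal_suminf_cmult[symmetric]
    by (rule suminf_add[OF summableI summableI])
  then show ?thesis by (simp add: sum_start_prob)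
qed

lemma sum_occ_le_1: "(\<integral>\<^sup>+x. occ x t \<partial>count_space UNIV) \<le> 1"
proof -
  have "(\<integral>\<^sup>+x. occ x t \<partial>count_space UNIV) = (\<integral>\<^sup>+p. visit_prob p t \<partial>count_space marks)"
    by (simp add: nn_integral_marks occ_def)
  also have "\<dots> = (\<integral>\<^sup>+w. (\<integral>\<^sup>+p. indicator (visit p w) t \<partial>count_space marks) \<partial>M)"
    by (intro nn_integral_count_space_nn_integral[symmetric] countable_pairs visit_measurable_fixed)
  also have "\<dots> \<le> (\<integral>\<^sup>+w. 1 \<partial>M)"
  proof (intro nn_integral_mono_AE eventually_mono[OF AE_regular])
    fix w assume w: "regular w"
    show "(\<integral>\<^sup>+p. indicator (visit p w) t \<partial>count_space marks) \<le> (1 :: ennreal)"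
    proof (cases "\<exists>p\<in>marks. t \<in> visit p w")
      case True
      then obtain p where p: "p \<in> marks" "t \<in> visit p w" by blast
      have "(indicator (visit q w) t :: ennreal) = indicator {p} q" if "q \<in> marks" for q
        using disjoint_visits[OF w] that p by (auto simp: disjoint_family_on_def indicator_def)
      then have "(\<integral>\<^sup>+q. indicator (visit q w) t \<partial>count_space marks) = (\<integral>\<^sup>+q. (indicator {p} q :: ennreal) \<partial>count_space marks)"
        by (intro nn_integral_cong) simp
      also have "\<dots> = 1" using p(1) by (subst nn_integral_indicator) auto
      finally show ?thesis by simp
    next
      case False
      then have "(\<integral>\<^sup>+q. indicator (visit q w) t \<partial>count_space marks) = (\<integral>\<^sup>+q. (0 :: ennreal) \<partial>count_space marks)"
        by (intro nn_integral_cong) (auto simp: indicator_def)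
      then show ?thesis by simp
    qed
  qed
  also have "\<dots> = 1" by (simp add: emeasure_space_1)
  finally show ?thesis .
qed

lemma occ_le_1: "occ x t \<le> 1"
proof -
  have "occ x t = (\<integral>\<^sup>+z. occ z t * indicator {x} z \<partial>count_space UNIV)"
    by (subst nn_integral_count_space'[where A = "{x}"]) auto
  also have "\<dots> \<le> (\<integral>\<^sup>+x. occ x t \<partial>count_space UNIV)"
    by (intro nn_integral_mono) (auto simp: indicator_def)
  finally show ?thesis using sum_occ_le_1[of t] by simp
qed

lemma occ_time_le: "0 \<le> t \<Longrightarrow> occ_time x t \<le> ennreal t"
proof -
  assume "0 \<le> t"
  have "occ_time x t \<le> (\<integral>\<^sup>+r. indicator {0..t} r \<partial>lborel)"
    unfolding occ_time_def by (intro nn_integral_mono) (auto simp: indicator_def occ_le_1)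
  then show ?thesis using \<open>0 \<le> t\<close> by simp
qed

text \<open>
  The left-hand side of the balance is at most \<open>1 + t / \<gamma> x\<close>.
\<close>
lemma potential_finite:
  assumes "0 \<le> t"
  shows "potential t < \<infinity>"
proof -
  fix x :: 's
  have "occ x t + ennreal (1 / \<gamma> x) * occ_time x t \<le> 1 + ennreal (1 / \<gamma> x) * ennreal t"
    by (intro add_mono occ_le_1 mult_left_mono occ_time_le assms) simp
  also have "\<dots> < \<infinity>" by (simp add: ennreal_mult_less_top)
  finally have "ennreal (lam x) * potential t < \<infinity>" using occupation_balance[OF assms] by simp
  then show ?thesis using lam_pos[of x] by (auto simp: ennreal_mult_less_top)
qed

lemma potential_mono: "t \<le> t' \<Longrightarrow> potential t \<le> potential t'"
  unfolding potential_def
  by (intro nn_integral_mono mult_right_mono) (auto intro: order_trans ennreal_leI)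

text \<open>
  If the clock stayed below \<open>t\<close> forever with positive probability, the potential at \<open>t\<close> would be
  infinite, since that probability is a lower bound for its integrand at every local time.
\<close>
lemma AE_time_upto_unbounded:
  assumes "0 \<le> t"
  shows "AE w in M. \<exists>s. ennreal t < time_upto s w"
proof -
  let ?h = "\<lambda>s. \<integral>\<^sup>+w. of_bool (time_upto s w \<le> ennreal t) \<partial>M"
  let ?c = "\<integral>\<^sup>+w. of_bool (\<forall>n::nat. time_upto (real n) w \<le> ennreal t) \<partial>M"
  have le: "?c \<le> ?h s" for s
  proof (rule nn_integral_mono)
    fix w
    obtain n where "s \<le> real n" using real_arch_simple by blast
    then have "time_upto s w \<le> time_upto (real n) w" by (rule time_upto_mono)
    then show "of_bool (\<forall>n::nat. time_upto (real n) w \<le> ennreal t) \<le> (of_bool (time_upto s w \<le> ennreal t) :: ennreal)"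
      by (auto intro: order_trans)
  qed
  have "(\<integral>\<^sup>+s. ?c * indicator {0<..} s \<partial>(lborel :: real measure)) \<le> potential t"
    unfolding potential_def by (rule nn_integral_mono, rule mult_right_mono[OF le]) simp
  moreover have "(\<integral>\<^sup>+s. ?c * indicator {0<..} s \<partial>(lborel :: real measure)) = ?c * \<infinity>"
    by (subst nn_integral_cmult_indicator) (simp_all add: emeasure_lborel_greaterThan)
  ultimately have "?c * \<infinity> < \<infinity>" using potential_finite[OF assms] by (simp add: le_less_trans)
  then have c0: "?c = 0" by (cases "?c = 0") (auto simp: ennreal_mult_top)
  have [measurable]: "(\<lambda>w. time_upto s w) \<in> borel_measurable M" for s
    by (rule clock_measurable(1)[OF id_measurable_info[OF clock_sources_subset]]) simp
  from c0 have "AE w in M. of_bool (\<forall>n::nat. time_upto (real n) w \<le> ennreal t) = (0::ennreal)"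
    by (subst (asm) nn_integral_0_iff_AE) auto
  then show ?thesis by eventually_elim (auto simp: not_le)
qed

text \<open>
  Almost every time is spent in some state, which is where the absence of a drift in the clock enters.
\<close>
lemma sum_occ_time:
  assumes t: "0 \<le> t"
  shows "(\<integral>\<^sup>+x. occ_time x t \<partial>count_space UNIV) = ennreal t"
proof -
  interpret P: pair_sigma_finite "lborel :: real measure" M by unfold_locales
  note [measurable] = visit_measurable
  have swap: "(\<integral>\<^sup>+r. visit_prob p r * indicator {0..t} r \<partial>lborel) =
     (\<integral>\<^sup>+w. visit_duration p t w \<partial>M)" if p: "p \<in> marks" for p
  proof -
    have "(\<integral>\<^sup>+r. visit_prob p r * indicator {0..t} r \<partial>lborel) =
        (\<integral>\<^sup>+r. (\<integral>\<^sup>+w. indicator (visit p w) r * indicator {0..t} r \<partial>M) \<partial>lborel)"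
      using visit_measurable_fixed[OF p] by (simp add: nn_integral_multc)
    also have "\<dots> = (\<integral>\<^sup>+w. visit_duration p t w \<partial>M)"
      using p unfolding visit_duration_def mult.commute[of "indicator {0..t} _"]
      by (intro P.Fubini'[symmetric]) (simp add: split_beta')
    finally show ?thesis .
  qed
  have "(\<integral>\<^sup>+x. occ_time x t \<partial>count_space UNIV) =
     (\<integral>\<^sup>+p. (\<integral>\<^sup>+r. visit_prob p r * indicator {0..t} r \<partial>lborel) \<partial>count_space marks)"
    by (simp add: nn_integral_marks occ_time_eq)
  also have "\<dots> = (\<integral>\<^sup>+p. (\<integral>\<^sup>+w. visit_duration p t w \<partial>M) \<partial>count_space marks)"
    using swap by (intro nn_integral_cong) auto
  also have "\<dots> = (\<integral>\<^sup>+w. (\<integral>\<^sup>+p. visit_duration p t w \<partial>count_space marks) \<partial>M)"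
    by (intro nn_integral_count_space_nn_integral[symmetric] countable_pairs visit_duration_measurable) simp
  also have "\<dots> = (\<integral>\<^sup>+w. ennreal t \<partial>M)"
  proof (intro nn_integral_cong_AE)
    show "AE w in M. (\<integral>\<^sup>+p. visit_duration p t w \<partial>count_space marks) = ennreal t"
      using AE_regular AE_time_upto_finite AE_time_upto_unbounded[OF t]
    proof eventually_elim
      case (elim w)
      then obtain s where "ennreal t < time_upto s w" by blast
      with elim t show ?case by (intro visits_cover[of w s]) auto
    qed
  qed
  also have "\<dots> = ennreal t" by (simp add: emeasure_space_1)
  finally show ?thesis .
qed

end

section \<open>The semigroup\<close>

context K_process_data
begin

lemma visiting_iff_visit:
  assumes w: "w \<in> space M" and t: "max 0 (ext_gamma \<gamma> y * T0 w) \<le> t"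
  shows "visiting \<gamma> \<sigma> T0 T y w t x \<longleftrightarrow>
    (\<exists>n. t - max 0 (ext_gamma \<gamma> y * T0 w) \<in> visit (x, Suc n) w)"
proof -
  define c where "c = max 0 (ext_gamma \<gamma> y * T0 w)"
  define r where "r = t - c"
  have c0: "0 \<le> c" "0 \<le> r" using t by (simp_all add: c_def r_def)
  have c: "ennreal (ext_gamma \<gamma> y * T0 w) = ennreal c"
    by (auto simp: c_def max_def ennreal_neg)
  have t': "ennreal t = ennreal c + ennreal r"
    using c0 by (subst ennreal_plus[symmetric]) (auto simp: r_def)
  have "visiting \<gamma> \<sigma> T0 T y w t x \<longleftrightarrow> (\<exists>i\<in>{1..}. r \<in> visit (x, i) w)"
    unfolding visiting_def clock_eq[OF w] clock_left_eq[OF w] c t' visit_def mark_def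
    using c0 by simp
  moreover have "{1..} = range Suc"
    by (auto simp: image_iff) (metis Suc_le_D)
  ultimately show ?thesis by (simp add: r_def c_def)
qed

abbreviation state :: "real \<Rightarrow> 'w \<Rightarrow> 's option" where
  "state t w \<equiv> K_process \<gamma> \<sigma> T0 T None t w"

abbreviation \<Psi> :: "real \<Rightarrow> ('s option \<Rightarrow> real) \<Rightarrow> 's option \<Rightarrow> real" where
  "\<Psi> \<equiv> K_semigroup M \<gamma> \<sigma> T0 T"

lemma state_eq_Some_iff:
  assumes w: "w \<in> space M"
  shows "state t w = Some x \<longleftrightarrow>
    (\<exists>n. t \<in> visit (x, Suc n) w) \<and> (\<forall>z. (\<exists>n. t \<in> visit (z, Suc n) w) \<longrightarrow> z = x)"
proof (cases "t < 0")
  case True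
  then show ?thesis by (simp add: K_process_def ext_gamma_def visit_def)
next
  case False
  define V where "V z \<longleftrightarrow> (\<exists>n. t \<in> visit (z, Suc n) w)" for z
  have "visiting \<gamma> \<sigma> T0 T None w t = V"
    using visiting_iff_visit[OF w, of None t] False by (intro ext) (simp add: ext_gamma_def V_def)
  then have "state t w = (if \<exists>!z. V z then Some (THE z. V z) else None)"
    using False by (simp add: K_process_def ext_gamma_def)
  moreover have "(if \<exists>!z. V z then Some (THE z. V z) else None) = Some x \<longleftrightarrow> V x \<and> (\<forall>z. V z \<longrightarrow> z = x)"
  proof (cases "\<exists>!z. V z")
    case True
    then obtain a where "V z \<longleftrightarrow> z = a" for z by blast
    then have "V = (\<lambda>z. z = a)" by auto
    then show ?thesis by auto
  next
    case False
    then have "\<not> (V x \<and> (\<forall>z. V z \<longrightarrow> z = x))" by blast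
    then show ?thesis using False by simp
  qed
  ultimately show ?thesis by (simp only: V_def)
qed

text \<open>
  The holding time in the initial state, in units of its mean. It is truncated at \<open>0\<close>, as it is in
  the clock, so that the next identity holds for every outcome.
\<close>
definition hold :: "'w \<Rightarrow> real" where
  "hold w = max 0 (T0 w)"

lemma ext_gamma_nonneg: "0 \<le> ext_gamma \<gamma> y"
  using gamma_pos by (auto simp: ext_gamma_def less_imp_le split: option.split)

text \<open>
  After the initial holding time, the process runs as if started from \<open>\<infinity>\<close>.
\<close>
lemma K_process_eq:
  assumes w: "w \<in> space M" and t: "0 \<le> t"
  shows "K_process \<gamma> \<sigma> T0 T y t w =
    (if t < ext_gamma \<gamma> y * hold w then y else state (t - ext_gamma \<gamma> y * hold w) w)"
proof -
  have c: "ext_gamma \<gamma> y * hold w = max 0 (ext_gamma \<gamma> y * T0 w)"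
    using ext_gamma_nonneg[of y] by (auto simp: hold_def max_def mult_le_0_iff zero_le_mult_iff)
  show ?thesis
  proof (cases "t < ext_gamma \<gamma> y * hold w")
    case True
    then have "t < ext_gamma \<gamma> y * T0 w" using t unfolding c by simp
    then show ?thesis using True by (simp add: K_process_def)
  next
    case False
    let ?r = "t - ext_gamma \<gamma> y * hold w"
    have "visiting \<gamma> \<sigma> T0 T y w t = visiting \<gamma> \<sigma> T0 T None w ?r"
    proof
      fix z
      have e0: "ext_gamma \<gamma> None = 0" by (simp add: ext_gamma_def)
      have le1: "max 0 (ext_gamma \<gamma> y * T0 w) \<le> t"
        using False unfolding c by (simp only: not_less)
      then have le2: "max 0 (ext_gamma \<gamma> None * T0 w) \<le> ?r"
        unfolding c e0 by simp
      show "visiting \<gamma> \<sigma> T0 T y w t z = visiting \<gamma> \<sigma> T0 T None w ?r z"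
        unfolding visiting_iff_visit[OF w le1] visiting_iff_visit[OF w le2]
        by (simp only: c e0 mult_zero_left max.idem diff_zero)
    qed
    moreover have "\<not> t < ext_gamma \<gamma> y * T0 w" "\<not> ?r < ext_gamma \<gamma> None * T0 w"
      using False unfolding c by (auto simp: ext_gamma_def)
    ultimately show ?thesis using False by (simp add: K_process_def)
  qed
qed

lemma state_measurable_info:
  "(\<lambda>z. state (fst z) (snd z)) \<in> measurable (borel \<Otimes>\<^sub>M info clock_sources) (count_space UNIV)"
proof -
  let ?N = "borel \<Otimes>\<^sub>M info clock_sources"
  let ?V = "\<lambda>x. {z \<in> space ?N. \<exists>n. fst z \<in> visit (x, Suc n) (snd z)}"
  have V: "?V x \<in> sets ?N" for x
  proof -
    have [measurable]: "Measurable.pred ?N (\<lambda>z. fst z \<in> visit (x, Suc n) (snd z))" for n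
      by (rule visit_measurable_info(2)) (simp add: marks_def)
    show ?thesis by measurable
  qed
  have inM: "snd z \<in> space M" if "z \<in> space ?N" for z
    using that by (auto simp: space_pair_measure)
  have S: "(\<lambda>z. state (fst z) (snd z)) -` {Some x} \<inter> space ?N \<in> sets ?N" for x
  proof -
    have "(\<lambda>z. state (fst z) (snd z)) -` {Some x} \<inter> space ?N = ?V x - (\<Union>z\<in>UNIV - {x}. ?V z)"
    proof (rule set_eqI)
      fix z
      show "z \<in> (\<lambda>z. state (fst z) (snd z)) -` {Some x} \<inter> space ?N \<longleftrightarrow> z \<in> ?V x - (\<Union>z\<in>UNIV - {x}. ?V z)"
        using state_eq_Some_iff[of "snd z" "fst z" x] inM[of z] by (cases "z \<in> space ?N") auto
    qed
    also have "\<dots> \<in> sets ?N"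
      by (intro sets.Diff sets.countable_UN'' V countable_subset[OF subset_UNIV countable_states])
    finally show ?thesis .
  qed
  have "(\<lambda>z. state (fst z) (snd z)) -` {None} \<inter> space ?N =
     space ?N - (\<Union>x. (\<lambda>z. state (fst z) (snd z)) -` {Some x} \<inter> space ?N)"
  proof (rule set_eqI)
    fix z
    show "z \<in> (\<lambda>z. state (fst z) (snd z)) -` {None} \<inter> space ?N \<longleftrightarrow>
      z \<in> space ?N - (\<Union>x. (\<lambda>z. state (fst z) (snd z)) -` {Some x} \<inter> space ?N)"
      by (cases "state (fst z) (snd z)") simp_all
  qed
  also have "\<dots> \<in> sets ?N"
    by (intro sets.Diff sets.top sets.countable_UN'' S countable_states)
  finally have N: "(\<lambda>z. state (fst z) (snd z)) -` {None} \<inter> space ?N \<in> sets ?N" .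
  have all: "(\<lambda>z. state (fst z) (snd z)) -` {y} \<inter> space ?N \<in> sets ?N" for y
    by (cases y) (simp_all only: S N)
  have cnt: "countable (UNIV :: 's option set)"
    unfolding UNIV_option_conv using countable_states by (intro countable_insert countable_image)
  show ?thesis
    unfolding measurable_count_space_eq_countable[OF cnt] by (intro conjI ballI all) simp
qed

lemma state_measurable_pair:
  "(\<lambda>z. state (fst z) (snd z)) \<in> measurable (borel \<Otimes>\<^sub>M M) (count_space UNIV)"
  by (rule measurable_pair_info[OF clock_sources_subset state_measurable_info])

lemma state_measurable: "state t \<in> measurable M (count_space UNIV)"
  using measurable_Pair2[OF state_measurable_pair, of t] by simp

lemma hold_measurable [measurable]: "hold \<in> borel_measurable M"
  unfolding hold_def[abs_def] by measurable

lemma K_process_measurable: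
  assumes "0 \<le> t"
  shows "K_process \<gamma> \<sigma> T0 T y t \<in> measurable M (count_space UNIV)"
proof -
  have "(\<lambda>w. (t - ext_gamma \<gamma> y * hold w, w)) \<in> measurable M (borel \<Otimes>\<^sub>M M)" by measurable
  from measurable_compose[OF this state_measurable_pair]
  have [measurable]: "(\<lambda>w. state (t - ext_gamma \<gamma> y * hold w) w) \<in> measurable M (count_space UNIV)" by simp
  have "(\<lambda>w. if t < ext_gamma \<gamma> y * hold w then y else state (t - ext_gamma \<gamma> y * hold w) w)
    \<in> measurable M (count_space UNIV)"
    by measurable
  then show ?thesis
    using K_process_eq[OF _ assms, of _ y] by (simp cong: measurable_cong)
qed

lemma integrable_K_process:
  assumes "0 \<le> t" "\<And>x. \<bar>f x\<bar> \<le> B"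
  shows "integrable M (\<lambda>w. f (K_process \<gamma> \<sigma> T0 T y t w) :: real)"
  using measurable_compose[OF K_process_measurable[OF assms(1)], of f borel y] assms(2)
  by (intro integrable_const_bound[where B = B]) auto

lemma semigroup_contraction:
  assumes "0 \<le> t" "\<And>x. \<bar>f x\<bar> \<le> B"
  shows "\<bar>\<Psi> t f y\<bar> \<le> B"
proof -
  have "0 \<le> B" using order_trans[OF abs_ge_zero assms(2)] .
  have "\<bar>\<Psi> t f y\<bar> \<le> (\<integral>w. \<bar>f (K_process \<gamma> \<sigma> T0 T y t w)\<bar> \<partial>M)"
    unfolding K_semigroup_def by (rule integral_abs_bound)
  also have "\<dots> \<le> (\<integral>w. B \<partial>M)"
    using assms \<open>0 \<le> B\<close> by (intro integral_mono integrable_abs integrable_K_process[where B = B]) auto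
  finally show ?thesis by (simp add: prob_space)
qed

lemma semigroup_diff:
  assumes "0 \<le> t" "f \<in> C\<^sub>0" "g \<in> C\<^sub>0"
  shows "\<Psi> t (\<lambda>y. f y - g y) x = \<Psi> t f x - \<Psi> t g x"
proof -
  obtain F G where F: "\<And>x. \<bar>f x\<bar> \<le> F" and G: "\<And>x. \<bar>g x\<bar> \<le> G"
    using assms C0_bounded by metis
  show ?thesis
    unfolding K_semigroup_def
    by (rule Bochner_Integration.integral_diff) (rule integrable_K_process[OF assms(1)], rule F,
        rule integrable_K_process[OF assms(1)], rule G)
qed

subsection \<open>Starting from infinity\<close>

lemma prob_state: "(\<integral>\<^sup>+w. of_bool (state t w = Some x) \<partial>M) = occ x t"
proof -
  have p: "(x, Suc n) \<in> marks" for n by (simp add: marks_def)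
  have "(\<integral>\<^sup>+w. of_bool (state t w = Some x) \<partial>M) = (\<integral>\<^sup>+w. (\<Sum>n. indicator (visit (x, Suc n) w) t) \<partial>M)"
  proof (intro nn_integral_cong_AE eventually_mono[OF AE_regular])
    fix w assume w: "regular w"
    then have sp: "w \<in> space M" by (simp add: regular_def)
    have unique: "z = z' \<and> n = n'" if "t \<in> visit (z, Suc n) w" "t \<in> visit (z', Suc n') w" for z z' n n'
    proof (rule ccontr)
      assume "\<not> (z = z' \<and> n = n')"
      then have "(z, Suc n) \<noteq> (z', Suc n')" by simp
      moreover have "(z, Suc n) \<in> marks" "(z', Suc n') \<in> marks" by (auto simp: marks_def)
      ultimately have "visit (z, Suc n) w \<inter> visit (z', Suc n') w = {}"
        using disjoint_family_onD[OF disjoint_visits[OF w]] by simp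
      then show False using that by blast
    qed
    show "of_bool (state t w = Some x) = (\<Sum>n. indicator (visit (x, Suc n) w) t :: ennreal)"
    proof (cases "\<exists>n. t \<in> visit (x, Suc n) w")
      case True
      then obtain n where n: "t \<in> visit (x, Suc n) w" by blast
      then have "state t w = Some x"
        unfolding state_eq_Some_iff[OF sp] using unique by blast
      moreover have "(\<Sum>k. indicator (visit (x, Suc k) w) t :: ennreal) = (\<Sum>k\<in>{n}. indicator (visit (x, Suc k) w) t)"
        using unique[OF n] by (intro suminf_finite) (auto simp: indicator_def)
      ultimately show ?thesis using n by simp
    next
      case False
      then have "state t w \<noteq> Some x" unfolding state_eq_Some_iff[OF sp] by blast
      then show ?thesis using False by simp
    qed
  qed
  also have "\<dots> = occ x t"
    unfolding occ_def using visit_measurable_fixed[OF p] by (rule nn_integral_suminf)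
  finally show ?thesis .
qed

definition occ_prob :: "'s \<Rightarrow> real \<Rightarrow> real" where
  "occ_prob x t = enn2real (occ x t)"

definition sojourn :: "'s \<Rightarrow> real \<Rightarrow> real" where
  "sojourn x t = enn2real (occ_time x t)"

definition potential_real :: "real \<Rightarrow> real" where
  "potential_real t = enn2real (potential t)"

lemma occ_eq_real: "occ x t = ennreal (occ_prob x t)"
proof -
  have "occ x t < \<top>" using occ_le_1[of x t] by (rule le_less_trans) simp
  then show ?thesis by (simp add: occ_prob_def)
qed

lemma occ_time_eq_real: "0 \<le> t \<Longrightarrow> occ_time x t = ennreal (sojourn x t)"
proof -
  assume "0 \<le> t"
  then have "occ_time x t < \<top>" using occ_time_le[of t x] by (auto intro: le_less_trans)
  then show ?thesis by (simp add: sojourn_def)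
qed

lemma potential_eq_real: "0 \<le> t \<Longrightarrow> potential t = ennreal (potential_real t)"
  using potential_finite[of t] by (simp add: potential_real_def ennreal_enn2real_if)

lemma nonneg_real [simp]: "0 \<le> occ_prob x t" "0 \<le> sojourn x t" "0 \<le> potential_real t"
  by (simp_all add: occ_prob_def sojourn_def potential_real_def)

lemma occupation_balance_real:
  assumes "0 \<le> t"
  shows "occ_prob x t + sojourn x t / \<gamma> x = lam x * potential_real t"
proof -
  have "ennreal (occ_prob x t + sojourn x t / \<gamma> x) = ennreal (lam x * potential_real t)"
    using occupation_balance[OF assms, of x] gamma_pos[of x] lam_pos[of x]
    by (simp add: occ_eq_real occ_time_eq_real[OF assms] potential_eq_real[OF assms]
        ennreal_mult[symmetric] ennreal_plus[symmetric] less_imp_le del: ennreal_plus)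
  then show ?thesis
    using gamma_pos[of x] lam_pos[of x] by (subst (asm) ennreal_inj) (auto simp: less_imp_le)
qed

lemma occ_time_mono: "s \<le> t \<Longrightarrow> occ_time x s \<le> occ_time x t"
  unfolding occ_time_def by (intro nn_integral_mono mult_left_mono) (auto simp: indicator_def)

lemma sojourn_mono: "0 \<le> s \<Longrightarrow> s \<le> t \<Longrightarrow> sojourn x s \<le> sojourn x t"
  using occ_time_mono[of s t x] by (simp add: occ_time_eq_real)

lemma integrable_occ_time:
  assumes "0 \<le> t"
  shows "integrable states (\<lambda>x. sojourn x t)"
    and "(\<integral>x. sojourn x t \<partial>states) = t"
proof -
  have "has_bochner_integral states (\<lambda>x. sojourn x t) t"
    using sum_occ_time[OF assms] assms
    by (intro has_bochner_integral_nn_integral) (simp_all add: occ_time_eq_real)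
  then show "integrable states (\<lambda>x. sojourn x t)"
    "(\<integral>x. sojourn x t \<partial>states) = t"
    by (auto simp: has_bochner_integral_iff)
qed

lemma integrable_mult_occ_time:
  assumes t: "0 \<le> t" and G: "\<And>x. \<bar>h x\<bar> \<le> G"
  shows "integrable states (\<lambda>x. h x * sojourn x t)"
proof (rule Bochner_Integration.integrable_bound)
  show "integrable states (\<lambda>x. G * sojourn x t)"
    using integrable_occ_time(1)[OF t] by simp
  show "AE x in states. norm (h x * sojourn x t) \<le> norm (G * sojourn x t)"
    using G by (auto simp: abs_mult intro!: mult_right_mono order_trans[OF G abs_ge_self])
qed simp

lemma sojourn_le_potential:
  assumes t: "0 \<le> t"
  shows "sojourn x t \<le> t * lam x * potential_real t"
proof -
  have "occ x r \<le> ennreal (lam x * potential_real t)" if "r \<in> {0..t}" for r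
  proof -
    have "occ x r \<le> ennreal (lam x) * potential r"
      using occupation_balance[of r x] that by (metis atLeastAtMost_iff le_iff_add)
    also have "\<dots> \<le> ennreal (lam x) * potential t"
      using that by (intro mult_left_mono potential_mono) auto
    also have "\<dots> = ennreal (lam x * potential_real t)"
      using potential_eq_real[OF t] lam_pos[of x] by (simp add: ennreal_mult less_imp_le)
    finally show ?thesis .
  qed
  then have "occ_time x t \<le> (\<integral>\<^sup>+r. ennreal (lam x * potential_real t) * indicator {0..t} r \<partial>lborel)"
    unfolding occ_time_def by (intro nn_integral_mono) (simp add: indicator_def)
  also have "\<dots> = ennreal (lam x * potential_real t * t)"
    using t lam_pos[of x] by (subst nn_integral_cmult_indicator) (simp_all add: ennreal_mult less_imp_le)
  finally have "ennreal (sojourn x t) \<le> ennreal (lam x * potential_real t * t)"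
    by (simp add: occ_time_eq_real[OF t])
  then show ?thesis
    using t lam_pos[of x] by (subst (asm) ennreal_le_iff) (auto simp: less_imp_le mult_ac)
qed

text \<open>
  Here the divergence of the sum of the rates is used: summing the balance over finitely many
  states bounds the potential by the inverse of the sum of their rates, up to \<open>O(t)\<close>.
\<close>
lemma potential_tendsto_0: "(potential_real \<longlongrightarrow> 0) (at_right 0)"
proof (rule tendstoI)
  fix e :: real assume e: "0 < e"
  have "\<exists>F. finite F \<and> 2 / e < sum lam F"
  proof (rule ccontr)
    assume "\<not> (\<exists>F. finite F \<and> 2 / e < sum lam F)"
    then have "bdd_above (sum lam ` {F. F \<subseteq> UNIV \<and> finite F})"
      by (intro bdd_aboveI2[where M = "2 / e"]) (auto simp: not_less)
    then have "lam summable_on UNIV"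
      using lam_pos by (intro nonneg_bdd_above_summable_on) (auto simp: less_imp_le)
    then show False using lam_sum_infinite by simp
  qed
  then obtain F where F: "finite F" "2 / e < sum lam F" by blast
  define C where "C = (\<Sum>x\<in>F. 1 / \<gamma> x)"
  have C: "C \<ge> 0" unfolding C_def using gamma_pos by (intro sum_nonneg) (auto simp: less_imp_le)
  have "\<forall>\<^sub>F t in at_right 0. 0 < t \<and> t < 1 / (C + 1)"
    using C by (intro eventually_conj eventually_at_right_less eventually_at_rightI[where b = "1 / (C + 1)"]) auto
  then show "\<forall>\<^sub>F t in at_right 0. dist (potential_real t) 0 < e"
  proof eventually_elim
    case (elim t)
    have occ1: "(\<Sum>x\<in>F. occ_prob x t) \<le> 1"
    proof -
      have "ennreal (\<Sum>x\<in>F. occ_prob x t) = (\<Sum>x\<in>F. occ x t)"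
        by (simp add: occ_eq_real sum_ennreal)
      also have "\<dots> = (\<integral>\<^sup>+x. occ x t * indicator F x \<partial>count_space UNIV)"
        using F(1) by (subst nn_integral_count_space'[where A = F]) auto
      also have "\<dots> \<le> (\<integral>\<^sup>+x. occ x t \<partial>count_space UNIV)"
        by (intro nn_integral_mono) (auto simp: indicator_def)
      also have "\<dots> \<le> 1" by (rule sum_occ_le_1)
      finally show ?thesis by (simp add: sum_nonneg)
    qed
    have le: "sojourn x t / \<gamma> x \<le> t * (1 / \<gamma> x)" for x
      using occ_time_le[of t x] elim gamma_pos[of x]
      by (simp add: occ_time_eq_real divide_right_mono less_imp_le)
    have "sum lam F * potential_real t = (\<Sum>x\<in>F. occ_prob x t) + (\<Sum>x\<in>F. sojourn x t / \<gamma> x)"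
      using elim by (simp add: sum_distrib_right sum.distrib[symmetric] occupation_balance_real)
    also have "\<dots> \<le> 1 + t * C"
      unfolding C_def sum_distrib_left by (intro add_mono occ1 sum_mono le)
    also have "t * C \<le> 1"
    proof -
      have "t * C \<le> t * (C + 1)" using elim by simp
      also have "\<dots> \<le> 1" using elim C by (simp add: field_simps)
      finally show ?thesis .
    qed
    finally have *: "sum lam F * potential_real t \<le> 2" by simp
    show ?case
    proof (rule ccontr)
      assume "\<not> ?thesis"
      then have "e \<le> potential_real t" by simp
      then have "sum lam F * e \<le> sum lam F * potential_real t"
        using lam_pos by (intro mult_left_mono sum_nonneg) (auto simp: less_imp_le)
      moreover have "2 < sum lam F * e" using F(2) e by (simp add: field_simps)
      ultimately show False using * by simp
    qed
  qed
qed

lemma expectation_state: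
  assumes B: "\<And>y. \<bar>f y\<bar> \<le> B"
  shows "integrable states (\<lambda>x. (f (Some x) - f None) * occ_prob x t)"
    and "\<Psi> t f None - f None = (\<integral>x. (f (Some x) - f None) * occ_prob x t \<partial>states)"
proof -
  define h where "h x = f (Some x) - f None" for x
  have h: "\<bar>h x\<bar> \<le> 2 * B" for x
    unfolding h_def using B[of "Some x"] B[of None] by linarith
  interpret C: sigma_finite_measure "count_space (UNIV :: 's set)"
    by (rule sigma_finite_measure_count_space_countable[OF countable_states])
  interpret P: pair_sigma_finite "count_space (UNIV :: 's set)" M by unfold_locales
  note [measurable] = state_measurable
  have ev: "{w \<in> space M. state t w = Some x} \<in> events" for x
    using measurable_sets[OF state_measurable, of "{Some x}" t] by (simp add: vimage_def Int_def conj_commute)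
  have eb: "ennreal (of_bool P) = of_bool P" for P by (cases P) auto
  have occ_m: "(\<integral>\<^sup>+w. of_bool (state t w = Some x) \<partial>M) = ennreal (occ_prob x t)" for x
    using prob_state[of t x] by (simp add: occ_eq_real)
  have hb: "has_bochner_integral M (\<lambda>w. of_bool (state t w = Some x)) (occ_prob x t)" for x
    using occ_m by (intro has_bochner_integral_nn_integral) (auto simp: eb)
  have int1: "(\<integral>w. h x * of_bool (state t w = Some x) \<partial>M) = h x * occ_prob x t" for x
    using hb[of x] by (simp add: has_bochner_integral_iff)
  have meas: "(\<lambda>(x, w). h x * of_bool (state t w = Some x)) \<in> borel_measurable (count_space UNIV \<Otimes>\<^sub>M M)"
    by (rule measurable_pair_measure_countable1[OF countable_states]) simp
  have "(\<integral>\<^sup>+z. ennreal (norm (case z of (x, w) \<Rightarrow> h x * of_bool (state t w = Some x))) \<partial>(count_space UNIV \<Otimes>\<^sub>M M)) =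
     (\<integral>\<^sup>+x. (\<integral>\<^sup>+w. ennreal \<bar>h x\<bar> * of_bool (state t w = Some x) \<partial>M) \<partial>count_space UNIV)"
    using meas by (subst nn_integral_fst[symmetric]) (auto simp: abs_mult ennreal_mult eb)
  also have "\<dots> = (\<integral>\<^sup>+x. ennreal \<bar>h x\<bar> * occ x t \<partial>count_space UNIV)"
    by (intro nn_integral_cong) (simp add: nn_integral_cmult prob_state)
  also have "\<dots> \<le> (\<integral>\<^sup>+x. ennreal (2 * B) * occ x t \<partial>count_space UNIV)"
    using h by (intro nn_integral_mono mult_right_mono ennreal_leI) auto
  also have "\<dots> = ennreal (2 * B) * (\<integral>\<^sup>+x. occ x t \<partial>count_space UNIV)"
    by (rule nn_integral_cmult) simp
  also have "\<dots> \<le> ennreal (2 * B) * 1"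
    by (intro mult_left_mono sum_occ_le_1) simp
  also have "\<dots> < \<infinity>" by simp
  finally have int: "integrable (count_space UNIV \<Otimes>\<^sub>M M) (\<lambda>(x, w). h x * of_bool (state t w = Some x))"
    using meas by (simp add: integrable_iff_bounded)
  have "integrable states (\<lambda>x. \<integral>w. h x * of_bool (state t w = Some x) \<partial>M)"
    using P.integrable_fst[OF int] by simp
  then have "integrable states (\<lambda>x. h x * occ_prob x t)"
    unfolding int1 .
  then show "integrable states (\<lambda>x. (f (Some x) - f None) * occ_prob x t)"
    unfolding h_def .
  have "\<Psi> t f None - f None = (\<integral>w. f (state t w) - f None \<partial>M)"
  proof -
    have "integrable M (\<lambda>w. f (state t w))"
      using measurable_compose[OF state_measurable[of t], of f borel] B
      by (intro integrable_const_bound[where B = B]) auto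
    then show ?thesis by (simp add: K_semigroup_def prob_space)
  qed
  also have "\<dots> = (\<integral>w. (\<integral>x. h x * of_bool (state t w = Some x) \<partial>states) \<partial>M)"
  proof (rule Bochner_Integration.integral_cong[OF refl])
    fix w
    show "f (state t w) - f None = (\<integral>x. h x * of_bool (state t w = Some x) \<partial>states)"
    proof (cases "state t w")
      case None then show ?thesis by simp
    next
      case (Some z)
      have "(\<lambda>x. h x * of_bool (state t w = Some x)) = (\<lambda>x. indicator {z} x *\<^sub>R h z)"
        by (auto simp: Some indicator_def)
      then show ?thesis
        by (simp add: Some h_def measure_count_space)
    qed
  qed
  also have "\<dots> = (\<integral>x. (\<integral>w. h x * of_bool (state t w = Some x) \<partial>M) \<partial>states)"
    using int by (rule P.Fubini_integral)
  finally have "\<Psi> t f None - f None = (\<integral>x. h x * occ_prob x t \<partial>states)"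
    unfolding int1 .
  then show "\<Psi> t f None - f None = (\<integral>x. (f (Some x) - f None) * occ_prob x t \<partial>states)"
    unfolding h_def .
qed

text \<open>
  Dynkin's formula from \<open>\<infinity>\<close>. In the expectation of \<open>f - f(\<infinity>) = - \<gamma> * g\<close>, the balance of visits
  replaces the probability of \<open>x\<close> by \<open>lam x * potential - occ_time / \<gamma> x\<close>; the first term drops
  out because \<open>g\<close> integrates to zero against \<open>lam * \<gamma>\<close>.
\<close>
lemma dynkin:
  assumes fg: "(f, g) \<in> A_graph" and t: "0 \<le> t"
  shows "\<Psi> t f None - f None = (\<integral>x. g (Some x) * sojourn x t \<partial>states)"
proof -
  have f: "f \<in> C\<^sub>0" and g: "g \<in> C\<^sub>0"
    and eq: "\<And>x. f (Some x) = f None - \<gamma> x * g (Some x)"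
    and zero: "(\<integral>x. lam x * \<gamma> x * g (Some x) \<partial>states) = 0"
    using fg by (auto simp: operator_graph_iff)
  obtain F where F: "\<And>y. \<bar>f y\<bar> \<le> F" using C0_bounded[OF f] by blast
  obtain G where G: "\<And>y. \<bar>g y\<bar> \<le> G" using C0_bounded[OF g] by blast
  have i1: "integrable states (\<lambda>x. lam x * \<gamma> x * g (Some x))"
    by (rule integrable_lam_gamma_mult) (rule G)
  have e: "(f (Some x) - f None) * occ_prob x t =
      g (Some x) * sojourn x t - lam x * \<gamma> x * g (Some x) * potential_real t" for x
  proof -
    have "\<gamma> x * occ_prob x t + sojourn x t = \<gamma> x * (lam x * potential_real t)"
      using occupation_balance_real[OF t, of x] gamma_pos[of x] by (simp add: field_simps)
    then have "\<gamma> x * occ_prob x t = \<gamma> x * lam x * potential_real t - sojourn x t" by simp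
    moreover have "(f (Some x) - f None) * occ_prob x t = - g (Some x) * (\<gamma> x * occ_prob x t)"
      by (simp add: eq)
    ultimately have "(f (Some x) - f None) * occ_prob x t =
        - g (Some x) * (\<gamma> x * lam x * potential_real t - sojourn x t)"
      by (simp only:)
    also have "\<dots> = g (Some x) * sojourn x t - lam x * \<gamma> x * g (Some x) * potential_real t"
      by (simp add: algebra_simps)
    finally show ?thesis .
  qed
  have i2: "integrable states (\<lambda>x. g (Some x) * sojourn x t)"
    by (rule integrable_mult_occ_time[OF t]) (rule G)
  have "\<Psi> t f None - f None = (\<integral>x. (f (Some x) - f None) * occ_prob x t \<partial>states)"
    by (rule expectation_state(2)) (rule F)
  also have "\<dots> = (\<integral>x. g (Some x) * sojourn x t - lam x * \<gamma> x * g (Some x) * potential_real t \<partial>states)"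
    by (simp only: e)
  also have "\<dots> = (\<integral>x. g (Some x) * sojourn x t \<partial>states)"
    using i1 i2 zero by simp
  finally show ?thesis .
qed

text \<open>
  In Dynkin's formula, states with small \<open>\<gamma> x\<close> have \<open>g\<close> close to \<open>g None\<close>, and the time spent
  in the others is \<open>O(r * potential_real r)\<close>.
\<close>
lemma dynkin_error:
  assumes fg: "(f, g) \<in> A_graph"
    and G: "\<And>y. \<bar>g y\<bar> \<le> G" and e: "0 < e"
  shows "\<forall>\<^sub>F t in at_right 0. \<forall>r\<in>{0..t}. \<bar>\<Psi> r f None - f None - r * g None\<bar> \<le> e * r"
proof -
  have g: "g \<in> C\<^sub>0" using fg by (simp add: operator_graph_iff)
  have e2: "e / 2 > 0" using e by simp
  have "\<forall>\<^sub>F x in to_infinity \<gamma>. dist (g (Some x)) (g None) < e / 2"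
    using g e2 unfolding mem_C0_iff_tendsto by (intro tendstoD) auto
  then obtain d where d: "d > 0" "\<And>x. \<gamma> x < d \<Longrightarrow> \<bar>g (Some x) - g None\<bar> < e / 2"
    by (auto simp: eventually_to_infinity dist_real_def)
  define S where "S = (\<integral>x. lam x * \<gamma> x \<partial>states)"
  have S: "S \<ge> 0" unfolding S_def
    by (intro integral_nonneg_AE) (auto simp: less_imp_le[OF lam_pos] less_imp_le[OF gamma_pos])
  have G0: "G \<ge> 0" using G[of None] by simp
  define K where "K = 2 * G / d"
  have K: "K \<ge> 0" using G0 d by (simp add: K_def)
  \<comment> \<open>The bound on the potential that makes the contribution of the states with \<open>d \<le> \<gamma> x\<close> at most \<open>e / 2 * r\<close>.\<close>
  define \<eta> where "\<eta> = e / (2 * (K * S + 1))"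
  have \<eta>: "\<eta> > 0" using e K S by (simp add: \<eta>_def add_nonneg_pos)
  have "\<forall>\<^sub>F t in at_right 0. 0 < t \<and> potential_real t < \<eta>"
    using tendstoD[OF potential_tendsto_0 \<eta>]
    by (intro eventually_conj eventually_at_right_less) (auto elim: eventually_mono)
  then show ?thesis
  proof eventually_elim
    case (elim t)
    show ?case
    proof
      fix r assume r: "r \<in> {0..t}"
      then have r0: "0 \<le> r" by simp
      have pr: "potential_real r \<le> \<eta>"
      proof -
        have "potential r \<le> potential t" using r by (intro potential_mono) simp
        then show ?thesis using r elim by (simp add: potential_eq_real)
      qed
      have le: "\<bar>g (Some x) * sojourn x r - g None * sojourn x r\<bar> \<le>
         e / 2 * sojourn x r + lam x * \<gamma> x * (K * r * \<eta>)" for x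
      proof (cases "\<gamma> x < d")
        case True
        have "\<bar>g (Some x) * sojourn x r - g None * sojourn x r\<bar> =
           \<bar>g (Some x) - g None\<bar> * sojourn x r"
          by (simp add: left_diff_distrib[symmetric] abs_mult)
        also have "\<dots> \<le> e / 2 * sojourn x r"
          using d(2)[OF True] by (intro mult_right_mono) auto
        also have "\<dots> \<le> e / 2 * sojourn x r + lam x * \<gamma> x * (K * r * \<eta>)"
          using lam_pos[of x] gamma_pos[of x] K r0 \<eta> by simp
        finally show ?thesis .
      next
        case False
        have "\<bar>g (Some x) * sojourn x r - g None * sojourn x r\<bar> =
           \<bar>g (Some x) - g None\<bar> * sojourn x r"
          by (simp add: left_diff_distrib[symmetric] abs_mult)
        also have "\<dots> \<le> (2 * G) * (r * lam x * potential_real r)"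
          using G[of "Some x"] G[of None]
          by (intro mult_mono sojourn_le_potential r0) auto
        also have "\<dots> \<le> (2 * G) * (r * lam x * \<eta>)"
          using pr r0 G0 lam_pos[of x] by (intro mult_left_mono) auto
        also have "\<dots> \<le> (2 * G) * (r * lam x * \<eta>) * (\<gamma> x / d)"
        proof -
          have "1 \<le> \<gamma> x / d" using False d(1) by (simp add: pos_le_divide_eq)
          moreover have "0 \<le> (2 * G) * (r * lam x * \<eta>)" using G0 r0 lam_pos[of x] \<eta> by simp
          ultimately have "(2 * G) * (r * lam x * \<eta>) * 1 \<le> (2 * G) * (r * lam x * \<eta>) * (\<gamma> x / d)"
            by (rule mult_left_mono)
          then show ?thesis by (simp only: mult_1_right)
        qed
        also have "\<dots> = lam x * \<gamma> x * (K * r * \<eta>)" by (simp add: K_def)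
        also have "\<dots> \<le> e / 2 * sojourn x r + lam x * \<gamma> x * (K * r * \<eta>)"
          using e by simp
        finally show ?thesis .
      qed
      have i: "integrable states (\<lambda>x. g y * sojourn x r)" for y
        using integrable_occ_time(1)[OF r0] by simp
      have ig: "integrable states (\<lambda>x. g (Some x) * sojourn x r)"
        by (rule integrable_mult_occ_time[OF r0]) (rule G)
      have eq: "\<Psi> r f None - f None - r * g None =
         (\<integral>x. g (Some x) * sojourn x r - g None * sojourn x r \<partial>states)"
        unfolding dynkin[OF fg r0] Bochner_Integration.integral_diff[OF ig i]
        by (simp add: integrable_occ_time(2)[OF r0])
      have "\<bar>\<Psi> r f None - f None - r * g None\<bar> \<le>
          (\<integral>x. \<bar>g (Some x) * sojourn x r - g None * sojourn x r\<bar> \<partial>states)"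
        unfolding eq by (rule integral_abs_bound)
      also have "\<dots> \<le> (\<integral>x. e / 2 * sojourn x r + lam x * \<gamma> x * (K * r * \<eta>) \<partial>states)"
      proof (rule integral_mono)
        show "integrable states (\<lambda>x. \<bar>g (Some x) * sojourn x r - g None * sojourn x r\<bar>)"
          using ig i[of None] by (intro integrable_abs Bochner_Integration.integrable_diff)
        show "integrable states (\<lambda>x. e / 2 * sojourn x r + lam x * \<gamma> x * (K * r * \<eta>))"
          by (intro Bochner_Integration.integrable_add integrable_mult_right integrable_mult_left
              integrable_occ_time(1)[OF r0] integrable_lam_gamma)
      qed (rule le)
      also have "\<dots> = e / 2 * r + S * (K * r * \<eta>)"
        using integrable_occ_time[OF r0] integrable_lam_gamma by (simp add: S_def)
      also have "S * (K * r * \<eta>) \<le> e / 2 * r"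
      proof -
        have "K * S * \<eta> \<le> (K * S + 1) * \<eta>" using \<eta> by simp
        also have "\<dots> = e / 2"
        proof -
          have "w * (e / (2 * w)) = e / 2" if "w > 0" for w :: real using that by simp
          then show ?thesis unfolding \<eta>_def using K S by (simp only: add_nonneg_pos mult_nonneg_nonneg zero_less_one)
        qed
        finally have "K * S * \<eta> * r \<le> e / 2 * r" using r0 by (rule mult_right_mono)
        then show ?thesis by (simp add: mult_ac)
      qed
      finally show "\<bar>\<Psi> r f None - f None - r * g None\<bar> \<le> e * r" by simp
    qed
  qed
qed

lemma semigroup_infinity_lipschitz:
  assumes fg: "(f, g) \<in> A_graph"
    and G: "\<And>y. \<bar>g y\<bar> \<le> G" and st: "0 \<le> s" "s \<le> t"
  shows "\<bar>\<Psi> t f None - \<Psi> s f None\<bar> \<le> G * (t - s)"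
proof -
  have t: "0 \<le> t" using st by simp
  have i: "integrable states (\<lambda>x. g (Some x) * sojourn x r)" if "0 \<le> r" for r
    by (rule integrable_mult_occ_time[OF that]) (rule G)
  have "\<Psi> t f None - \<Psi> s f None = (\<Psi> t f None - f None) - (\<Psi> s f None - f None)" by simp
  also have "\<dots> = (\<integral>x. g (Some x) * sojourn x t - g (Some x) * sojourn x s \<partial>states)"
    unfolding dynkin[OF fg t] dynkin[OF fg st(1)] Bochner_Integration.integral_diff[OF i[OF t] i[OF st(1)]] ..
  finally have eq: "\<Psi> t f None - \<Psi> s f None =
    (\<integral>x. g (Some x) * sojourn x t - g (Some x) * sojourn x s \<partial>states)" .
  have "\<bar>\<Psi> t f None - \<Psi> s f None\<bar> \<le>
      (\<integral>x. \<bar>g (Some x) * sojourn x t - g (Some x) * sojourn x s\<bar> \<partial>states)"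
    unfolding eq by (rule integral_abs_bound)
  also have "\<dots> \<le> (\<integral>x. G * (sojourn x t - sojourn x s) \<partial>states)"
  proof (rule integral_mono)
    show "integrable states (\<lambda>x. \<bar>g (Some x) * sojourn x t - g (Some x) * sojourn x s\<bar>)"
      using i[OF t] i[OF st(1)] by (intro integrable_abs Bochner_Integration.integrable_diff)
    show "integrable states (\<lambda>x. G * (sojourn x t - sojourn x s))"
      by (intro integrable_mult_right Bochner_Integration.integrable_diff integrable_occ_time t st)
    fix x
    show "\<bar>g (Some x) * sojourn x t - g (Some x) * sojourn x s\<bar> \<le>
       G * (sojourn x t - sojourn x s)"
      using G[of "Some x"] sojourn_mono[OF st, of x]
      by (simp add: right_diff_distrib[symmetric] abs_mult mult_right_mono)
  qed
  also have "\<dots> = G * (t - s)"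
    using integrable_occ_time[OF t] integrable_occ_time[OF st(1)] by simp
  finally show ?thesis .
qed

end

context K_process_data
begin

subsection \<open>Starting from a state\<close>

lemma integral_decouple:
  fixes F :: "'w \<Rightarrow> 'w \<Rightarrow> real"
  assumes I: "I \<subseteq> sources" and J: "J \<subseteq> sources" and disj: "I \<inter> J = {}"
    and F: "(\<lambda>(w, w'). F w w') \<in> borel_measurable (info I \<Otimes>\<^sub>M info J)"
    and bound: "\<And>w w'. \<bar>F w w'\<bar> \<le> B"
  shows "(\<integral>w. F w w \<partial>M) = (\<integral>w. (\<integral>w'. F w w' \<partial>M) \<partial>M)"
proof -
  let ?I = "distr M (info I) (\<lambda>w. w)" and ?J = "distr M (info J) (\<lambda>w. w)"
  interpret I: prob_space ?I using id_measurable_info[OF I] by (rule prob_space_distr)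
  interpret J: prob_space ?J using id_measurable_info[OF J] by (rule prob_space_distr)
  interpret N: pair_prob_space ?I ?J ..
  have F': "(\<lambda>(w, w'). F w w') \<in> borel_measurable (?I \<Otimes>\<^sub>M ?J)"
    using F by (simp cong: measurable_cong_sets sets_pair_measure_cong)
  have int: "integrable (?I \<Otimes>\<^sub>M ?J) (\<lambda>(w, w'). F w w')"
    using F' bound by (intro N.P.integrable_const_bound[where B = B]) auto
  have meas: "(\<lambda>w. \<integral>w'. F w w' \<partial>?J) \<in> borel_measurable (info I)"
  proof (rule J.borel_measurable_lebesgue_integral)
    show "(\<lambda>(w, w'). F w w') \<in> borel_measurable (info I \<Otimes>\<^sub>M ?J)"
      using F by (simp cong: measurable_cong_sets sets_pair_measure_cong)
  qed
  have "(\<integral>w. F w w \<partial>M) = (\<integral>z. (case z of (w, w') \<Rightarrow> F w w') \<partial>distr M (info I \<Otimes>\<^sub>M info J) (\<lambda>w. (w, w)))"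
    by (simp add: integral_distr[OF diagonal_measurable[OF I J] F])
  also have "\<dots> = (\<integral>z. (case z of (w, w') \<Rightarrow> F w w') \<partial>(?I \<Otimes>\<^sub>M ?J))"
    by (simp only: distr_diagonal[OF I J disj])
  also have "\<dots> = (\<integral>w. (\<integral>w'. F w w' \<partial>?J) \<partial>?I)"
    using N.integral_fst'[OF int] by simp
  also have "\<dots> = (\<integral>w. (\<integral>w'. F w w' \<partial>?J) \<partial>M)"
    by (rule integral_distr[OF id_measurable_info[OF I] meas])
  also have "\<dots> = (\<integral>w. (\<integral>w'. F w w' \<partial>M) \<partial>M)"
  proof (rule Bochner_Integration.integral_cong[OF refl])
    fix w assume "w \<in> space M"
    then have "F w \<in> borel_measurable (info J)"
      using measurable_Pair2[OF F, of w] by simp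
    then show "(\<integral>w'. F w w' \<partial>?J) = (\<integral>w'. F w w' \<partial>M)"
      by (rule integral_distr[OF id_measurable_info[OF J]])
  qed
  finally show ?thesis .
qed

text \<open>
  The initial holding time is independent of the process run afterwards.
\<close>
lemma semigroup_eq:
  assumes t: "0 \<le> t" and B: "\<And>y. \<bar>f y\<bar> \<le> B"
  shows "\<Psi> t f y = (\<integral>w. (if t < ext_gamma \<gamma> y * hold w then f y else \<Psi> (t - ext_gamma \<gamma> y * hold w) f None) \<partial>M)"
proof -
  let ?c = "ext_gamma \<gamma> y"
  define F where "F w w' = (if t < ?c * hold w then f y else f (state (t - ?c * hold w) w'))" for w w'
  have "T0 \<in> borel_measurable (info {Initial})"
    by (rule T0_measurable_info) auto
  then have [measurable]: "hold \<in> borel_measurable (info {Initial})"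
    unfolding hold_def[abs_def] by measurable
  have "(\<lambda>z. (t - ?c * hold (fst z), snd z)) \<in> measurable (info {Initial} \<Otimes>\<^sub>M info clock_sources) (borel \<Otimes>\<^sub>M info clock_sources)"
    by measurable
  from measurable_compose[OF this state_measurable_info]
  have "(\<lambda>z. state (t - ?c * hold (fst z)) (snd z)) \<in> measurable (info {Initial} \<Otimes>\<^sub>M info clock_sources) (count_space UNIV)"
    by simp
  from measurable_compose[OF this, of f borel]
  have [measurable]: "(\<lambda>z. f (state (t - ?c * hold (fst z)) (snd z))) \<in> borel_measurable (info {Initial} \<Otimes>\<^sub>M info clock_sources)"
    by simp
  have "\<Psi> t f y = (\<integral>w. F w w \<partial>M)"
    unfolding K_semigroup_def
    by (rule Bochner_Integration.integral_cong[OF refl]) (simp add: F_def K_process_eq[OF _ t])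
  also have "\<dots> = (\<integral>w. (\<integral>w'. F w w' \<partial>M) \<partial>M)"
  proof (rule integral_decouple[of "{Initial}" clock_sources])
    show "(\<lambda>(w, w'). F w w') \<in> borel_measurable (info {Initial} \<Otimes>\<^sub>M info clock_sources)"
      unfolding F_def split_beta' by measurable
    show "\<bar>F w w'\<bar> \<le> B" for w w' by (simp add: F_def B)
  qed (auto simp: clock_sources_def)
  also have "\<dots> = (\<integral>w. (if t < ?c * hold w then f y else \<Psi> (t - ?c * hold w) f None) \<partial>M)"
    by (rule Bochner_Integration.integral_cong[OF refl]) (simp add: F_def K_semigroup_def prob_space)
  finally show ?thesis .
qed

lemma ext_gamma_Some: "ext_gamma \<gamma> (Some x) = \<gamma> x"
  by (simp add: ext_gamma_def)

lemma hold_nonneg: "0 \<le> hold w"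
  by (simp add: hold_def)

text \<open>
  The holding time ends at a constant rate: this is the balance of visits for the initial visit.
\<close>
lemma holding_balance:
  assumes c: "0 < c" and t: "0 \<le> t"
  shows "(\<integral>w. of_bool (t < c * hold w) + min (c * hold w) t / c \<partial>M) = 1"
proof -
  have eq: "survival c t 0 (T0 w) = ennreal (of_bool (t < c * hold w) + min (c * hold w) t / c)" for w
  proof -
    define a where "a = c * hold w"
    have a: "0 \<le> a" using c hold_nonneg by (simp add: a_def)
    have e: "ennreal (c * T0 w) = ennreal a"
      using c by (auto simp: a_def hold_def max_def ennreal_neg mult_nonneg_nonpos)
    have less: "ennreal r < ennreal a \<longleftrightarrow> r < a" if "0 \<le> r" for r
      using that by (rule ennreal_less_iff)
    let ?I = "\<integral>\<^sup>+r. indicator {0..t} r * of_bool (0 \<le> ennreal r \<and> ennreal r < 0 + ennreal a) \<partial>lborel"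
    have "?I =
      ennreal (min a t)"
    proof (cases "t < a")
      case True
      have "?I =
          (\<integral>\<^sup>+r. indicator {0..t} r \<partial>lborel)"
        using True less by (intro nn_integral_cong) (simp add: indicator_def)
      then show ?thesis using True t by simp
    next
      case False
      have "?I =
          (\<integral>\<^sup>+r. indicator {0..<a} r \<partial>lborel)"
        using False less by (intro nn_integral_cong) (simp add: indicator_def)
      then show ?thesis using False a by simp
    qed
    then have "survival c t 0 (T0 w) = of_bool (t < a) + ennreal (1 / c) * ennreal (min a t)"
      using less[OF t] by (simp add: survival_def e)
    also have "\<dots> = ennreal (of_bool (t < a)) + ennreal (min a t / c)"
      using c a t by (simp add: ennreal_mult[symmetric])
    also have "\<dots> = ennreal (of_bool (t < a) + min a t / c)"
      using c a t by (intro ennreal_plus[symmetric]) simp_all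
    finally show ?thesis by (simp add: a_def)
  qed
  have "(\<lambda>\<tau>. survival c t 0 \<tau>) \<in> borel_measurable lborel"
    using measurable_Pair2[OF survival_measurable, of 0] by simp
  then have "(\<integral>\<^sup>+w. survival c t 0 (T0 w) \<partial>M) = 1"
    using nn_integral_survival[OF c t, of 0]
    by (simp add: distributed_nn_integral[OF T0_exponential, symmetric])
  then have "has_bochner_integral M (\<lambda>w. of_bool (t < c * hold w) + min (c * hold w) t / c) 1"
    unfolding eq using c t hold_nonneg by (intro has_bochner_integral_nn_integral) simp_all
  then show ?thesis by (simp add: has_bochner_integral_iff)
qed

lemma integrable_hold:
  assumes "0 < c" "0 \<le> t"
  shows "integrable M (\<lambda>w. of_bool (t < c * hold w) :: real)" "integrable M (\<lambda>w. min (c * hold w) t)"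
  using assms hold_nonneg
  by (intro integrable_const_bound[where B = 1], simp_all)
     (intro integrable_const_bound[where B = t], simp_all)

lemma holding_balance':
  assumes c: "0 < c" and t: "0 \<le> t"
  shows "(\<integral>w. of_bool (t < c * hold w) \<partial>M) = 1 - (\<integral>w. min (c * hold w) t \<partial>M) / c"
  using holding_balance[OF c t] integrable_hold[OF c t] by simp

lemma expected_min_hold:
  assumes c: "0 < c" and t: "0 \<le> t"
  shows "(\<integral>w. min (c * hold w) t \<partial>M) \<le> c" "(\<integral>w. min (c * hold w) t \<partial>M) \<le> t"
    and "t - (\<integral>w. min (c * hold w) t \<partial>M) \<le> t * (t / c)"
proof -
  note i = integrable_hold[OF c t]
  let ?m = "\<integral>w. min (c * hold w) t \<partial>M"
  have "0 \<le> (\<integral>w. (of_bool (t < c * hold w) :: real) \<partial>M)" by (intro integral_nonneg_AE) simp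
  then show "?m \<le> c" using holding_balance'[OF c t] c by (simp add: field_simps)
  have "?m \<le> (\<integral>w. t \<partial>M)" using i(2) by (intro integral_mono) simp_all
  then show mt: "?m \<le> t" by (simp add: prob_space)
  have "t - ?m = (\<integral>w. t - min (c * hold w) t \<partial>M)" using i(2) by (simp add: prob_space)
  also have "\<dots> \<le> (\<integral>w. t * (1 - of_bool (t < c * hold w)) \<partial>M)"
    using i t c hold_nonneg by (intro integral_mono) (simp_all add: min_def)
  also have "\<dots> = t * (?m / c)" using i holding_balance'[OF c t] by (simp add: prob_space)
  also have "\<dots> \<le> t * (t / c)" using mt c t by (intro mult_left_mono divide_right_mono) simp_all
  finally show "t - ?m \<le> t * (t / c)" .
qed

lemma semigroup_measurable:
  "(\<lambda>r. \<Psi> r f None) \<in> borel_measurable borel"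
proof -
  have "(\<lambda>z. f (state (fst z) (snd z))) \<in> borel_measurable (borel \<Otimes>\<^sub>M M)"
    using measurable_compose[OF state_measurable_pair, of f borel] by simp
  then show ?thesis
    unfolding K_semigroup_def by (intro borel_measurable_lebesgue_integral) (simp add: split_beta')
qed

lemma integrable_restart:
  assumes t: "0 \<le> t" and B: "\<And>y. \<bar>f y\<bar> \<le> B"
  shows "integrable M (\<lambda>w. if t < c * hold w then f y else \<Psi> (t - c * hold w) f None)"
proof (rule integrable_const_bound[where B = B])
  note [measurable] = semigroup_measurable
  show "(\<lambda>w. if t < c * hold w then f y else \<Psi> (t - c * hold w) f None) \<in> borel_measurable M"
    by measurable
  show "AE w in M. norm (if t < c * hold w then f y else \<Psi> (t - c * hold w) f None) \<le> B"
    using B semigroup_contraction[of _ f B None] by (intro AE_I2) simp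
qed

text \<open>
  If the holding time ends by \<open>t\<close>, the process from \<open>\<infinity>\<close> is only delayed by it; otherwise it
  exceeds \<open>t\<close>, which has probability at most \<open>\<gamma> x / t\<close>.
\<close>
lemma semigroup_near_infinity:
  assumes fg: "(f, g) \<in> A_graph"
    and F: "\<And>y. \<bar>f y\<bar> \<le> F" and G: "\<And>y. \<bar>g y\<bar> \<le> G" and t: "0 < t"
  shows "\<bar>\<Psi> t f (Some x) - \<Psi> t f None\<bar> \<le> (G + 2 * F / t) * \<gamma> x"
proof -
  let ?c = "\<gamma> x"
  let ?R = "\<lambda>w. if t < ?c * hold w then f (Some x) else \<Psi> (t - ?c * hold w) f None"
  have c: "0 < ?c" by (rule gamma_pos)
  have t0: "0 \<le> t" using t by simp
  have G0: "0 \<le> G" using order_trans[OF abs_ge_zero G] .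
  have F0: "0 \<le> F" using order_trans[OF abs_ge_zero F] .
  have iR: "integrable M ?R" by (rule integrable_restart[OF t0 F])
  note im = integrable_hold(2)[OF c t0]
  have "\<Psi> t f (Some x) = (\<integral>w. ?R w \<partial>M)"
    using semigroup_eq[of t f F "Some x", OF t0 F] unfolding ext_gamma_Some .
  then have eq: "\<Psi> t f (Some x) - \<Psi> t f None = (\<integral>w. ?R w - \<Psi> t f None \<partial>M)"
    using iR by (simp add: prob_space)
  have "\<bar>\<Psi> t f (Some x) - \<Psi> t f None\<bar> \<le> (\<integral>w. \<bar>?R w - \<Psi> t f None\<bar> \<partial>M)"
    unfolding eq by (rule integral_abs_bound)
  also have "\<dots> \<le> (\<integral>w. (G + 2 * F / t) * min (?c * hold w) t \<partial>M)"
  proof (rule integral_mono)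
    show "integrable M (\<lambda>w. \<bar>?R w - \<Psi> t f None\<bar>)"
      using iR by (intro integrable_abs Bochner_Integration.integrable_diff) simp_all
    show "integrable M (\<lambda>w. (G + 2 * F / t) * min (?c * hold w) t)"
      using im by simp
    fix w
    show "\<bar>?R w - \<Psi> t f None\<bar> \<le> (G + 2 * F / t) * min (?c * hold w) t"
    proof (cases "t < ?c * hold w")
      case True
      have "\<bar>f (Some x) - \<Psi> t f None\<bar> \<le> 2 * F"
        using F[of "Some x"] semigroup_contraction[of t f F None, OF t0 F] by linarith
      also have "\<dots> = (2 * F / t) * t" using t by simp
      also have "\<dots> \<le> (G + 2 * F / t) * t" using G0 t by (intro mult_right_mono) simp_all
      finally show ?thesis using True by (simp add: min_def)
    next
      case False
      have h: "0 \<le> ?c * hold w" using c hold_nonneg by simp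
      have "\<bar>\<Psi> t f None - \<Psi> (t - ?c * hold w) f None\<bar> \<le> G * (t - (t - ?c * hold w))"
        using False h by (intro semigroup_infinity_lipschitz[OF fg G]) simp_all
      also have "\<dots> = G * (?c * hold w)" by simp
      also have "\<dots> \<le> (G + 2 * F / t) * (?c * hold w)"
        using h F0 t by (intro mult_right_mono) simp_all
      finally show ?thesis using False by (simp add: min_def abs_minus_commute)
    qed
  qed
  also have "\<dots> = (G + 2 * F / t) * (\<integral>w. min (?c * hold w) t \<partial>M)" by simp
  also have "\<dots> \<le> (G + 2 * F / t) * ?c"
    using expected_min_hold(1)[OF c t0] G0 F0 t by (intro mult_left_mono) simp_all
  finally show ?thesis .
qed

lemma semigroup_C0:
  assumes fg: "(f, g) \<in> A_graph" and t: "0 < t"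
  shows "\<Psi> t f \<in> C\<^sub>0"
proof -
  have f: "f \<in> C\<^sub>0" and g: "g \<in> C\<^sub>0" using fg by (auto simp: operator_graph_iff)
  obtain F where F: "\<And>y. \<bar>f y\<bar> \<le> F" using C0_bounded[OF f] by blast
  obtain G where G: "\<And>y. \<bar>g y\<bar> \<le> G" using C0_bounded[OF g] by blast
  have gam: "(\<gamma> \<longlongrightarrow> 0) (to_infinity \<gamma>)"
    by (simp add: to_infinity_def filterlim_filtercomap)
  have "((\<lambda>x. \<Psi> t f (Some x) - \<Psi> t f None) \<longlongrightarrow> 0) (to_infinity \<gamma>)"
  proof (rule Lim_null_comparison)
    show "((\<lambda>x. (G + 2 * F / t) * \<gamma> x) \<longlongrightarrow> 0) (to_infinity \<gamma>)"
      using tendsto_mult_left[OF gam, of "G + 2 * F / t"] by simp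
    show "\<forall>\<^sub>F x in to_infinity \<gamma>. norm (\<Psi> t f (Some x) - \<Psi> t f None) \<le> (G + 2 * F / t) * \<gamma> x"
      unfolding real_norm_def by (intro always_eventually allI semigroup_near_infinity[OF fg F G t])
  qed
  then have "((\<lambda>x. \<Psi> t f (Some x)) \<longlongrightarrow> \<Psi> t f None) (to_infinity \<gamma>)"
    by (rule LIM_zero_cancel)
  moreover have "\<bar>\<Psi> t f y\<bar> \<le> F" for y
    using t by (intro semigroup_contraction F) simp
  ultimately show ?thesis
    by (auto simp: mem_C0_iff_tendsto bounded_iff)
qed

text \<open>
  The error of the first-order expansion at a state \<open>x\<close>: before the end of the holding time the
  process has not moved, after it the expansion at \<open>\<infinity>\<close> applies, and by the balance of the
  holding time the two parts fit together up to the difference of the two values of \<open>g\<close>.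
\<close>
lemma semigroup_expansion_error:
  assumes fg: "(f, g) \<in> A_graph" and t: "0 < t" and e: "0 \<le> e"
    and err: "\<And>r. r \<in> {0..t} \<Longrightarrow> \<bar>\<Psi> r f None - f None - r * g None\<bar> \<le> e * r"
  shows "\<bar>\<Psi> t f (Some x) - f (Some x) - t * g (Some x)\<bar> \<le> \<bar>g None - g (Some x)\<bar> * (t * min 1 (t / \<gamma> x)) + e * t"
proof -
  let ?c = "\<gamma> x"
  have c: "0 < ?c" by (rule gamma_pos)
  have t0: "0 \<le> t" using t by simp
  have f: "f \<in> C\<^sub>0" and eq: "f (Some x) = f None - ?c * g (Some x)"
    using fg by (auto simp: operator_graph_iff)
  obtain F where F: "\<And>y. \<bar>f y\<bar> \<le> F" using C0_bounded[OF f] by blast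
  define R where "R w = (if t < ?c * hold w then f (Some x) else \<Psi> (t - ?c * hold w) f None)" for w
  define m where "m w = min (?c * hold w) t" for w
  \<comment> \<open>By the balance of the holding time, \<open>W\<close> has expectation \<open>0\<close>.\<close>
  define W where "W w = ?c * (1 - of_bool (t < ?c * hold w)) - m w" for w
  \<comment> \<open>What remains is \<open>0\<close> before the end of the holding time, and the error of the expansion at \<open>\<infinity>\<close> after it.\<close>
  define \<rho> where "\<rho> w = R w - f (Some x) - t * g (Some x) - g (Some x) * W w - (g None - g (Some x)) * (t - m w)" for w
  have iR: "integrable M R" unfolding R_def[abs_def] by (rule integrable_restart[OF t0 F])
  have im: "integrable M m" unfolding m_def[abs_def] by (rule integrable_hold(2)[OF c t0])
  have iW: "integrable M W" unfolding W_def[abs_def] using im integrable_hold(1)[OF c t0] by simp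
  have "(\<integral>w. W w \<partial>M) = ?c * (1 - (\<integral>w. of_bool (t < ?c * hold w) \<partial>M)) - (\<integral>w. m w \<partial>M)"
    unfolding W_def using im integrable_hold(1)[OF c t0] by (simp add: prob_space)
  also have "(\<integral>w. of_bool (t < ?c * hold w) \<partial>M) = 1 - (\<integral>w. m w \<partial>M) / ?c"
    unfolding m_def by (rule holding_balance'[OF c t0])
  finally have EW: "(\<integral>w. W w \<partial>M) = 0" using c by simp
  have i\<rho>: "integrable M \<rho>" unfolding \<rho>_def[abs_def] using iR im iW by simp
  have E\<rho>: "(\<integral>w. \<rho> w \<partial>M) = \<Psi> t f (Some x) - f (Some x) - t * g (Some x) - (g None - g (Some x)) * (t - (\<integral>w. m w \<partial>M))"
  proof -
    have "\<Psi> t f (Some x) = (\<integral>w. R w \<partial>M)"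
      using semigroup_eq[of t f F "Some x", OF t0 F] unfolding ext_gamma_Some R_def .
    then show ?thesis unfolding \<rho>_def using iR im iW EW by (simp add: prob_space)
  qed
  have le: "\<bar>\<rho> w\<bar> \<le> e * t" for w
  proof (cases "t < ?c * hold w")
    case True
    then have "\<rho> w = 0" by (simp add: \<rho>_def R_def W_def m_def)
    then show ?thesis using e t by simp
  next
    case False
    let ?r = "t - ?c * hold w"
    have h: "0 \<le> ?c * hold w" using c hold_nonneg by simp
    have "\<rho> w = \<Psi> ?r f None - f None - ?r * g None"
      using False by (simp add: \<rho>_def R_def W_def m_def min_def eq algebra_simps)
    also have "\<bar>\<dots>\<bar> \<le> e * ?r" using False h by (intro err) simp
    also have "\<dots> \<le> e * t" using e h by (intro mult_left_mono) simp_all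
    finally show ?thesis .
  qed
  have "\<bar>\<integral>w. \<rho> w \<partial>M\<bar> \<le> (\<integral>w. \<bar>\<rho> w\<bar> \<partial>M)" by (rule integral_abs_bound)
  also have "\<dots> \<le> (\<integral>w. e * t \<partial>M)" using i\<rho> by (intro integral_mono integrable_abs le) simp_all
  also have "\<dots> = e * t" by (simp add: prob_space)
  finally have 1: "\<bar>\<integral>w. \<rho> w \<partial>M\<bar> \<le> e * t" .
  define d where "d = t - (\<integral>w. m w \<partial>M)"
  have m0: "0 \<le> (\<integral>w. m w \<partial>M)"
    using c t0 hold_nonneg by (intro integral_nonneg_AE AE_I2) (simp add: m_def)
  have d: "0 \<le> d" "d \<le> t * min 1 (t / ?c)"
    using expected_min_hold(2,3)[OF c t0] m0 t by (auto simp: d_def m_def min_def)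
  have "\<bar>(g None - g (Some x)) * d\<bar> \<le> \<bar>g None - g (Some x)\<bar> * (t * min 1 (t / ?c))"
    using d by (simp add: abs_mult mult_left_mono)
  moreover have "\<Psi> t f (Some x) - f (Some x) - t * g (Some x) = (\<integral>w. \<rho> w \<partial>M) + (g None - g (Some x)) * d"
    unfolding E\<rho> d_def by simp
  ultimately show ?thesis
    using 1 abs_triangle_ineq[of "\<integral>w. \<rho> w \<partial>M" "(g None - g (Some x)) * d"] by linarith
qed

text \<open>
  The expansion error at \<open>x\<close> is small relative to \<open>t\<close> for two different reasons: for small \<open>\<gamma> x\<close>
  because \<open>g\<close> is continuous at \<open>\<infinity>\<close>, otherwise because the process rarely leaves \<open>x\<close> by time \<open>t\<close>.
\<close>
lemma graph_subset_generator:
  "A_graph \<subseteq> generator_graph (C0 \<gamma>) \<Psi>"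
proof (rule subrelI)
  fix f g assume fg: "(f, g) \<in> A_graph"
  then have f: "f \<in> C\<^sub>0" and g: "g \<in> C\<^sub>0" by (auto simp: operator_graph_iff)
  obtain G where G: "\<And>y. \<bar>g y\<bar> \<le> G" using C0_bounded[OF g] by blast
  have G0: "0 \<le> G" using order_trans[OF abs_ge_zero G] .
  have "\<forall>\<^sub>F t in at_right 0. (\<lambda>x. (\<Psi> t f x - f x) / t) \<in> C\<^sub>0 \<and>
      (\<forall>x. \<bar>(\<Psi> t f x - f x) / t - g x\<bar> \<le> e)" if e: "0 < e" for e
  proof -
    have e2: "0 < e / 2" using e by simp
    have "\<forall>\<^sub>F x in to_infinity \<gamma>. dist (g (Some x)) (g None) < e / 2"
      using g e2 unfolding mem_C0_iff_tendsto by (intro tendstoD) auto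
    then obtain d where d: "d > 0" "\<And>x. \<gamma> x < d \<Longrightarrow> \<bar>g None - g (Some x)\<bar> < e / 2"
      by (auto simp: eventually_to_infinity dist_real_def abs_minus_commute)
    \<comment> \<open>For \<open>t < b\<close> and \<open>d \<le> \<gamma> x\<close>, the factor \<open>t / \<gamma> x\<close> beats the bound \<open>2 * G\<close> on the difference of the values of \<open>g\<close>.\<close>
    define b where "b = e * d / (4 * G + 1)"
    have b: "0 < b" using e d G0 by (simp add: b_def)
    have "\<forall>\<^sub>F t in at_right 0. t < b"
      using b by (intro eventually_at_rightI[of 0 b]) auto
    moreover have "\<forall>\<^sub>F t in at_right (0::real). 0 < t" by (rule eventually_at_right_less)
    ultimately show ?thesis
      using dynkin_error[OF fg G e2]
    proof eventually_elim
      case (elim t)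
      then have t: "0 < t" "t < b"
        and err: "\<And>r. r \<in> {0..t} \<Longrightarrow> \<bar>\<Psi> r f None - f None - r * g None\<bar> \<le> e / 2 * r" by auto
      have "(\<lambda>x. (1 / t) * \<Psi> t f x + (- 1 / t) * f x) \<in> C\<^sub>0"
        by (rule C0_combination[OF semigroup_C0[OF fg t(1)] f])
      then have C: "(\<lambda>x. (\<Psi> t f x - f x) / t) \<in> C\<^sub>0"
        by (simp add: diff_divide_distrib)
      have main: "\<bar>\<Psi> t f y - f y - t * g y\<bar> \<le> e * t" for y
      proof (cases y)
        case None
        have "\<bar>\<Psi> t f None - f None - t * g None\<bar> \<le> e / 2 * t" using t by (intro err) simp
        also have "\<dots> \<le> e * t" using e t by simp
        finally show ?thesis using None by simp
      next
        case (Some x)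
        have "\<bar>g None - g (Some x)\<bar> * (t * min 1 (t / \<gamma> x)) \<le> e / 2 * t"
        proof (cases "\<gamma> x < d")
          case True
          have m: "0 \<le> t * min 1 (t / \<gamma> x)" using t gamma_pos[of x] by simp
          have "t * min 1 (t / \<gamma> x) \<le> t * 1" using t by (intro mult_left_mono) simp_all
          from mult_mono[OF less_imp_le[OF d(2)[OF True]] this less_imp_le[OF e2] m]
          have "\<bar>g None - g (Some x)\<bar> * (t * min 1 (t / \<gamma> x)) \<le> e / 2 * (t * 1)" .
          then show ?thesis by simp
        next
          case False
          have "t / \<gamma> x \<le> b / d" using False d(1) t by (intro frac_le) simp_all
          also have "\<dots> = e / (4 * G + 1)" using d(1) by (simp add: b_def)
          finally have "min 1 (t / \<gamma> x) \<le> e / (4 * G + 1)" by simp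
          then have tm: "t * min 1 (t / \<gamma> x) \<le> t * (e / (4 * G + 1))" using t by (intro mult_left_mono) simp_all
          have g2: "\<bar>g None - g (Some x)\<bar> \<le> 2 * G" using G[of None] G[of "Some x"] by linarith
          have m: "0 \<le> t * min 1 (t / \<gamma> x)" using t gamma_pos[of x] by simp
          have "0 \<le> 2 * G" using G0 by simp
          from mult_mono[OF g2 tm this m]
          have "\<bar>g None - g (Some x)\<bar> * (t * min 1 (t / \<gamma> x)) \<le> (2 * G) * (t * (e / (4 * G + 1)))" .
          also have "\<dots> = e * t * (2 * G / (4 * G + 1))" by simp
          also have "\<dots> \<le> e * t * (1 / 2)"
            using e t G0 by (intro mult_left_mono) (simp_all add: divide_simps)
          finally show ?thesis by simp
        qed
        then show ?thesis
          using semigroup_expansion_error[OF fg t(1) less_imp_le[OF e2] err, of x] Some by simp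
      qed
      have "\<bar>(\<Psi> t f x - f x) / t - g x\<bar> \<le> e" for x
      proof -
        have "(\<Psi> t f x - f x) / t - g x = (\<Psi> t f x - f x - t * g x) / t"
          using t by (simp add: diff_divide_distrib)
        then have "\<bar>(\<Psi> t f x - f x) / t - g x\<bar> = \<bar>\<Psi> t f x - f x - t * g x\<bar> / t"
          using t by (simp add: abs_divide)
        also have "\<dots> \<le> e" using main[of x] t by (simp add: pos_divide_le_eq)
        finally show ?thesis .
      qed
      with C show ?case by blast
    qed
  qed
  then show "(f, g) \<in> generator_graph (C0 \<gamma>) \<Psi>"
    using f g by (simp add: generator_graph_iff)
qed

lemma generator_eq:
  "generator_graph (C0 \<gamma>) \<Psi> = A_graph"
proof (rule generator_graph_eqI[OF graph_subset_generator])
  show "\<bar>\<Psi> t f x\<bar> \<le> B" if "0 < t" "\<And>y. \<bar>f y\<bar> \<le> B" for t f B x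
    using that by (intro semigroup_contraction) simp_all
  show "\<Psi> t (\<lambda>y. f y - g y) x = \<Psi> t f x - \<Psi> t g x"
    if "0 < t" "f \<in> C\<^sub>0" "g \<in> C\<^sub>0" for t f g x
    using that by (intro semigroup_diff) simp_all
qed

end

theorem theorem6p5:
  fixes M :: "'w measure"
    and \<gamma> lam :: "'s \<Rightarrow> real"
    and \<sigma> :: "'s \<Rightarrow> nat \<Rightarrow> 'w \<Rightarrow> real"
    and T0 :: "'w \<Rightarrow> real"
    and T :: "'s \<Rightarrow> nat \<Rightarrow> 'w \<Rightarrow> real"
  assumes "K_process_data M \<gamma> lam \<sigma> T0 T"
  shows "K_operator \<gamma> ` K_domain \<gamma> lam \<subseteq> mspace (C0 \<gamma>) \<and>
         single_valued (graph_closure (C0 \<gamma>) (operator_graph (K_domain \<gamma> lam) (K_operator \<gamma>))) \<and>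
         graph_closure (C0 \<gamma>) (operator_graph (K_domain \<gamma> lam) (K_operator \<gamma>))
           = generator_graph (C0 \<gamma>) (K_semigroup M \<gamma> \<sigma> T0 T)"
proof -
  interpret K_process_data M \<gamma> lam \<sigma> T0 T by (rule assms)
  have "K_operator \<gamma> f \<in> mspace (C0 \<gamma>)" if "f \<in> K_domain \<gamma> lam" for f
  proof -
    have "(f, K_operator \<gamma> f) \<in> operator_graph (K_domain \<gamma> lam) (K_operator \<gamma>)"
      using that by (auto simp: operator_graph_def)
    then show ?thesis by (simp add: operator_graph_iff)
  qed
  moreover have "single_valued (operator_graph (K_domain \<gamma> lam) (K_operator \<gamma>))"
    by (auto simp: single_valued_def operator_graph_def)
  ultimately show ?thesis
    by (auto simp: graph_closure_eq generator_eq)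
qed

end
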